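(* Let $G$ be a finite simple graph and $k$ a field. (1) If $G$ is unmixed, then $$\operatorname{reg}(\mathcal{I}(G))\le\operatorname{ht}\mathcal{I}(G)+1\le\operatorname{reg}(\mathcal{I}(G)^\vee)+1\quad\text{and}\quad \operatorname{pdim}(\mathcal{I}(G)^\vee)\le\operatorname{ht}\mathcal{I}(G)\le\operatorname{pdim}(\mathcal{I}(G))+1 .$$ (2) If $G$ is not unmixed, then $$\operatorname{reg}(\mathcal{I}(G))\le\operatorname{ht}\mathcal{I}(G)+1\le\operatorname{reg}(\mathcal{I}(G)^\vee)\quad\text{and}\quad \operatorname{pdim}(\mathcal{I}(G)^\vee)\le\operatorname{ht}\mathcal{I}(G)\le\operatorname{pdim}(\mathcal{I}(G)) .$$
   Context: For a simple graph $G$ on $\{x_1,\dots,x_n\}$, the edge ideal is $\mathcal{I}(G)=(x_ax_b : \{x_a,x_b\}\text{ an edge of }G)\subseteq R=k[x_1,\dots,x_n]$. A vertex cover of $G$ is a set of vertices meeting every edge; it is minimal if no proper subset is a vertex cover. $G$ is unmixed if all its minimal vertex covers have the same cardinality. The Alexander dual of a squarefree monomial ideal $I=(x_{11}\cdots x_{1i_1},\dots,x_{r1}\cdots x_{ri_r})$ is $I^\vee=(x_{11},\dots,x_{1i_1})\cap\dots\cap(x_{r1},\dots,x_{ri_r})$. For an ideal $I$, with graded Betti numbers $\beta_{i,j}(I)$ over $R$: $\operatorname{reg}(I)=\max\{j-i:\beta_{i,j}(I)\ne0\}$, $\operatorname{pdim}(I)=\max\{i:\beta_{i,j}(I)\neq0\text{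 for some }j\}$, with the conventions $\operatorname{reg}(0)=1$ and $\operatorname{pdim}(0)=-1$; $\operatorname{ht}$ denotes height. *)

theory Defs
  imports
    "HOL-Library.Poly_Mapping"
    "HOL-Algebra.Ideal"
    "Jordan_Normal_Form.Matrix"
begin

section \<open>Polynomial rings\<close>

text \<open>
  A polynomial is a finitely supported map from monomials to coefficients, and a monomial is a
  finitely supported exponent function on the variables. The carrier of \<open>poly_ring V\<close> is
  \<open>k[x\<^sub>v : v \<in> V]\<close>; only variables from \<open>V\<close> occur in it, so that the ambient ring
  is the right one even if the type \<open>'v\<close> has elements outside \<open>V\<close>.
\<close>

type_synonym ('v, 'k) mpoly = "('v \<Rightarrow>\<^sub>0 nat) \<Rightarrow>\<^sub>0 'k"

definition poly_ring :: "'v set \<Rightarrow> ('v, 'k::field) mpoly ring" where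
  "poly_ring V =
     \<lparr>carrier = {p. \<forall>m \<in> Poly_Mapping.keys p. Poly_Mapping.keys m \<subseteq> V},
      monoid.mult = (*), one = 1, zero = 0, add = (+)\<rparr>"

definition var :: "'v \<Rightarrow> ('v, 'k::field) mpoly" where
  "var v = Poly_Mapping.single (Poly_Mapping.single v 1) 1"

definition mon_degree :: "('v \<Rightarrow>\<^sub>0 nat) \<Rightarrow> nat" where
  "mon_degree m = (\<Sum>v \<in> Poly_Mapping.keys m. Poly_Mapping.lookup m v)"

definition height :: "('a, 'b) ring_scheme \<Rightarrow> 'a set \<Rightarrow> nat" where
  \<comment> \<open>The inner supremum ranges over the lengths of the chains of primes ending in \<open>P\<close>. It is a
      supremum of natural numbers, meaningful when these lengths are bounded, as they are in a
      polynomial ring in finitely many variables over a field.\<close>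
  "height R I =
     (INF P \<in> {P. primeideal P R \<and> I \<subseteq> P}.
        Sup {n. \<exists>Q :: nat \<Rightarrow> 'a set. (\<forall>i \<le> n. primeideal (Q i) R) \<and>
                  (\<forall>i < n. Q i \<subset> Q (Suc i)) \<and> Q n = P})"


section \<open>Graded Betti numbers, regularity and projective dimension\<close>

definition free_module :: "'v set \<Rightarrow> nat \<Rightarrow> ('v, 'k::field) mpoly vec set" where
  "free_module V r = {u \<in> carrier_vec r. \<forall>a < r. u $ a \<in> carrier (poly_ring V)}"

text \<open>
  \<open>min_graded_resolution V I D d\<close>: the matrices \<open>D 0, D 1, \<dots>\<close> form a minimal graded free
  resolution \<open>\<dots> \<rightarrow> F\<^sub>1 \<rightarrow> F\<^sub>0 \<rightarrow> I \<rightarrow> 0\<close> of the ideal \<open>I\<close> of \<open>R = poly_ring V\<close>, where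
  \<open>F\<^sub>i\<close> is the direct sum of the \<open>R(- d i b)\<close> for \<open>b < dim_col (D i)\<close>. The row \<open>D 0\<close> is the
  augmentation from \<open>F\<^sub>0\<close> to \<open>I \<subseteq> R\<close>, and \<open>D (Suc i)\<close> is the differential from \<open>F\<^sub>i\<^sub>+\<^sub>1\<close>
  to \<open>F\<^sub>i\<close>.
  The clauses on \<open>mon_degree\<close> say that these maps are homogeneous of degree 0, so an entry is zero
  if the difference of the two shifts is negative. Shifts of a minimal resolution of an ideal are
  never negative, so natural numbers suffice.
  The last clause is minimality: the entries of the differentials lie in the maximal ideal generated
  by the variables, that is, they have zero constant term.
\<close>

definition min_graded_resolution ::
    "'v set \<Rightarrow> ('v, 'k::field) mpoly set \<Rightarrow> (nat \<Rightarrow> ('v, 'k) mpoly mat) \<Rightarrow> (nat \<Rightarrow> nat \<Rightarrow> nat) \<Rightarrow> bool"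
  where
  "min_graded_resolution V I D d \<longleftrightarrow>
     dim_row (D 0) = 1 \<and>
     (\<forall>i. dim_row (D (Suc i)) = dim_col (D i)) \<and>
     (\<forall>i. elements_mat (D i) \<subseteq> carrier (poly_ring V)) \<and>
     (\<forall>b < dim_col (D 0). \<forall>m \<in> Poly_Mapping.keys (D 0 $$ (0, b)). mon_degree m = d 0 b) \<and>
     (\<forall>i. \<forall>a < dim_row (D (Suc i)). \<forall>b < dim_col (D (Suc i)).
        \<forall>m \<in> Poly_Mapping.keys (D (Suc i) $$ (a, b)). mon_degree m + d i a = d (Suc i) b) \<and>
     {(D 0 *\<^sub>v u) $ 0 | u. u \<in> free_module V (dim_col (D 0))} = I \<and>
     (\<forall>i. {D (Suc i) *\<^sub>v u | u. u \<in> free_module V (dim_col (D (Suc i)))} =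
          {u \<in> free_module V (dim_col (D i)). D i *\<^sub>v u = 0\<^sub>v (dim_row (D i))}) \<and>
     (\<forall>i. \<forall>p \<in> elements_mat (D (Suc i)). Poly_Mapping.lookup p 0 = 0)"

definition betti :: "'v set \<Rightarrow> ('v, 'k::field) mpoly set \<Rightarrow> nat \<Rightarrow> nat \<Rightarrow> nat" where
  \<comment> \<open>The number of summands \<open>R(-j)\<close> of \<open>F\<^sub>i\<close>. The choice is immaterial, since minimal graded free
      resolutions are unique up to isomorphism.\<close>
  "betti V I i j =
     (case (SOME (D, d). min_graded_resolution V I D d) of
        (D, d) \<Rightarrow> card {b. b < dim_col (D i) \<and> d i b = j})"

text \<open>
  For a nonzero homogeneous ideal the sets below are nonempty, and finite by Hilbert's syzygy theorem.
\<close>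

definition regularity :: "'v set \<Rightarrow> ('v, 'k::field) mpoly set \<Rightarrow> int" where
  "regularity V I =
     (if I = {0} then 1 else Max {int j - int i | i j. betti V I i j \<noteq> 0})"

definition proj_dim :: "'v set \<Rightarrow> ('v, 'k::field) mpoly set \<Rightarrow> int" where
  "proj_dim V I =
     (if I = {0} then -1 else Max {int i | i. \<exists>j. betti V I i j \<noteq> 0})"


section \<open>Squarefree monomial ideals and Alexander duality\<close>

definition sqfree_ideal :: "'v set \<Rightarrow> 'v set set \<Rightarrow> ('v, 'k::field) mpoly set" where
  "sqfree_ideal V F = Idl\<^bsub>poly_ring V\<^esub> {\<Prod>v\<in>A. var v | A. A \<in> F}"

definition var_ideal_Inter :: "'v set \<Rightarrow> 'v set set \<Rightarrow> ('v, 'k::field) mpoly set" where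
  \<comment> \<open>The intersection is taken inside the ring, so it is the unit ideal if \<open>F\<close> is empty.\<close>
  "var_ideal_Inter V F = carrier (poly_ring V) \<inter> (\<Inter>A\<in>F. Idl\<^bsub>poly_ring V\<^esub> (var ` A))"

definition alexander_dual :: "'v set \<Rightarrow> ('v, 'k::field) mpoly set \<Rightarrow> ('v, 'k) mpoly set" where
  \<comment> \<open>Independence of the generating family \<open>F\<close> is \<open>alexander_dual_sqfree_ideal\<close> below.\<close>
  "alexander_dual V I =
     (THE J. \<exists>F. F \<subseteq> Pow V \<and> I = sqfree_ideal V F \<and> J = var_ideal_Inter V F)"

lemma poly_ring_simps [simp]:
  "monoid.mult (poly_ring V) = (*)" "one (poly_ring V) = 1"
  "zero (poly_ring V) = 0" "add (poly_ring V) = (+)"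
  by (simp_all add: poly_ring_def)

lemma poly_ring_carrier:
  "p \<in> carrier (poly_ring V) \<longleftrightarrow> (\<forall>m \<in> Poly_Mapping.keys p. Poly_Mapping.keys m \<subseteq> V)"
  by (simp add: poly_ring_def)

lemma keys_add_nat:
  fixes m n :: "'v \<Rightarrow>\<^sub>0 nat"
  shows "Poly_Mapping.keys (m + n) = Poly_Mapping.keys m \<union> Poly_Mapping.keys n"
  by (auto simp: in_keys_iff lookup_add)

lemma keys_mult_obtain:
  fixes p q :: "('v, 'k::field) mpoly"
  assumes "m \<in> Poly_Mapping.keys (p * q)"
  obtains a b where "a \<in> Poly_Mapping.keys p" "b \<in> Poly_Mapping.keys q" "m = a + b"
  using keys_mult[of p q] assms by auto

lemma poly_ring_closed:
  fixes p q :: "('v, 'k::field) mpoly"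
  assumes "p \<in> carrier (poly_ring V)" "q \<in> carrier (poly_ring V)"
  shows "p + q \<in> carrier (poly_ring V)" "p * q \<in> carrier (poly_ring V)"
proof -
  show "p + q \<in> carrier (poly_ring V)"
    using assms keys_add[of p q] by (force simp: poly_ring_carrier)
  show "p * q \<in> carrier (poly_ring V)"
    unfolding poly_ring_carrier
  proof
    fix m assume "m \<in> Poly_Mapping.keys (p * q)"
    then obtain a b where "a \<in> Poly_Mapping.keys p" "b \<in> Poly_Mapping.keys q" "m = a + b"
      by (rule keys_mult_obtain)
    then show "Poly_Mapping.keys m \<subseteq> V"
      using assms by (auto simp: poly_ring_carrier keys_add_nat)
  qed
qed

lemma poly_ring_uminus_closed:
  fixes p :: "('v, 'k::field) mpoly"
  shows "p \<in> carrier (poly_ring V) \<Longrightarrow> - p \<in> carrier (poly_ring V)"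
  by (simp add: poly_ring_carrier)

lemma poly_ring_cring: "cring (poly_ring V :: ('v, 'k::field) mpoly ring)"
proof (rule cringI)
  show "abelian_group (poly_ring V :: ('v, 'k) mpoly ring)"
  proof (rule abelian_groupI)
    fix x :: "('v, 'k) mpoly" assume "x \<in> carrier (poly_ring V)"
    then show "\<exists>y\<in>carrier (poly_ring V). y \<oplus>\<^bsub>poly_ring V\<^esub> x = \<zero>\<^bsub>poly_ring V\<^esub>"
      by (intro bexI[of _ "- x"]) (auto simp: poly_ring_uminus_closed)
  qed (auto simp: poly_ring_closed algebra_simps, auto simp: poly_ring_carrier)
  show "comm_monoid (poly_ring V :: ('v, 'k) mpoly ring)"
    by (rule comm_monoidI)
      (auto simp: poly_ring_closed algebra_simps, auto simp: poly_ring_carrier)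
qed (auto simp: algebra_simps)

lemma ideal_poly_ringI:
  fixes I :: "('v, 'k::field) mpoly set"
  assumes "I \<subseteq> carrier (poly_ring V)" "0 \<in> I"
    and "\<And>p q. p \<in> I \<Longrightarrow> q \<in> I \<Longrightarrow> p + q \<in> I"
    and "\<And>p q. p \<in> I \<Longrightarrow> q \<in> carrier (poly_ring V) \<Longrightarrow> q * p \<in> I"
  shows "ideal I (poly_ring V)"
proof -
  interpret cring "poly_ring V :: ('v, 'k) mpoly ring" by (rule poly_ring_cring)
  have neg: "- p \<in> I" if "p \<in> I" for p
    using assms(4)[OF that poly_ring_uminus_closed[of 1 V]] one_closed by simp
  show ?thesis
  proof (rule idealI[OF ring_axioms])
    show "subgroup I (add_monoid (poly_ring V))"
    proof (rule add.subgroupI)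
      fix a assume a: "a \<in> I"
      have "\<ominus>\<^bsub>poly_ring V\<^esub> a = - a"
        using a assms(1) poly_ring_uminus_closed[of a V]
        by (intro minus_equality) auto
      then show "\<ominus>\<^bsub>poly_ring V\<^esub> a \<in> I"
        using neg[OF a] by simp
    next
      fix a b assume "a \<in> I" "b \<in> I"
      then show "a \<oplus>\<^bsub>poly_ring V\<^esub> b \<in> I"
        using assms(3) by simp
    qed (use assms in auto)
  next
    fix a x :: "('v, 'k) mpoly" assume ax: "a \<in> I" "x \<in> carrier (poly_ring V)"
    show "x \<otimes>\<^bsub>poly_ring V\<^esub> a \<in> I"
      using assms(4)[OF ax] by simp
    then show "a \<otimes>\<^bsub>poly_ring V\<^esub> x \<in> I"
      by (simp add: mult.commute)
  qed
qed

lemma keys_prod_var: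
  assumes "finite A"
  shows "\<exists>m. Poly_Mapping.keys m = A \<and>
           (\<Prod>v\<in>A. var v :: ('v, 'k::field) mpoly) = Poly_Mapping.single m 1"
  using assms
proof (induction A)
  case empty
  show ?case
    by (intro exI[of _ 0]) simp
next
  case (insert x A)
  then obtain m where m: "Poly_Mapping.keys m = A"
    "(\<Prod>v\<in>A. var v :: ('v, 'k) mpoly) = Poly_Mapping.single m 1" by blast
  show ?case
    using insert.hyps m
    by (intro exI[of _ "Poly_Mapping.single x 1 + m"])
       (simp add: keys_add_nat var_def mult_single)
qed

lemma sqfree_ideal_dvd:
  assumes "finite V" "F \<subseteq> Pow V" "B \<subseteq> V"
    and "(\<Prod>v\<in>B. var v :: ('v, 'k::field) mpoly) \<in> sqfree_ideal V F"
  shows "\<exists>A\<in>F. A \<subseteq> B"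
proof -
  define M :: "('v, 'k) mpoly set" where
    "M = {p \<in> carrier (poly_ring V).
            \<forall>m \<in> Poly_Mapping.keys p. \<exists>A\<in>F. A \<subseteq> Poly_Mapping.keys m}"
  have "ideal M (poly_ring V)"
  proof (rule ideal_poly_ringI)
    fix p q :: "('v, 'k) mpoly" assume "p \<in> M" "q \<in> M"
    then show "p + q \<in> M"
      using keys_add[of p q] by (fastforce simp: M_def poly_ring_closed)
  next
    fix p q :: "('v, 'k) mpoly" assume pq: "p \<in> M" "q \<in> carrier (poly_ring V)"
    have "\<exists>A\<in>F. A \<subseteq> Poly_Mapping.keys m" if m: "m \<in> Poly_Mapping.keys (q * p)" for m
    proof -
      obtain a b where ab: "a \<in> Poly_Mapping.keys q" "b \<in> Poly_Mapping.keys p" "m = a + b"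
        using m by (rule keys_mult_obtain)
      from ab(2) pq(1) obtain A where "A \<in> F" "A \<subseteq> Poly_Mapping.keys b"
        unfolding M_def by blast
      with ab(3) show ?thesis
        by (auto simp: keys_add_nat)
    qed
    then show "q * p \<in> M"
      using pq by (auto simp: M_def poly_ring_closed)
  qed (auto simp: M_def poly_ring_carrier)
  moreover have "(\<Prod>v\<in>A. var v) \<in> M" if "A \<in> F" for A
  proof -
    have "A \<subseteq> V" using that assms(2) by auto
    then have "finite A" using assms(1) by (rule finite_subset)
    from keys_prod_var[OF this, where 'k='k] that \<open>A \<subseteq> V\<close> show ?thesis
      by (auto simp: M_def poly_ring_carrier)
  qed
  ultimately have "sqfree_ideal V F \<subseteq> M"
    unfolding sqfree_ideal_def genideal_def by (intro Inter_lower) blast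
  with assms(4) have mem: "(\<Prod>v\<in>B. var v) \<in> M" by auto
  have "finite B" using assms(1,3) finite_subset by blast
  from keys_prod_var[OF this, where 'k='k] mem show ?thesis
    by (auto simp: M_def)
qed

lemma var_ideal_Inter_antimono:
  assumes "finite V" "F \<subseteq> Pow V" "F' \<subseteq> Pow V"
    and "(sqfree_ideal V F' :: ('v, 'k::field) mpoly set) \<subseteq> sqfree_ideal V F"
  shows "(var_ideal_Inter V F :: ('v, 'k) mpoly set) \<subseteq> var_ideal_Inter V F'"
proof -
  have "\<exists>A\<in>F. (Idl\<^bsub>poly_ring V\<^esub> (var ` A) :: ('v, 'k) mpoly set) \<subseteq> Idl\<^bsub>poly_ring V\<^esub> (var ` B)"
    if B: "B \<in> F'" for B
  proof -
    have "B \<subseteq> V" using B assms(3) by auto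
    have "(\<Prod>v\<in>B. var v :: ('v, 'k) mpoly) \<in> sqfree_ideal V F'"
      using B by (auto simp: sqfree_ideal_def genideal_def)
    then have "(\<Prod>v\<in>B. var v :: ('v, 'k) mpoly) \<in> sqfree_ideal V F"
      using assms(4) by blast
    then obtain A where "A \<in> F" "A \<subseteq> B"
      using sqfree_ideal_dvd[OF assms(1,2) \<open>B \<subseteq> V\<close>] by blast
    have "(Idl\<^bsub>poly_ring V\<^esub> (var ` A) :: ('v, 'k) mpoly set) \<subseteq> Idl\<^bsub>poly_ring V\<^esub> (var ` B)"
      unfolding genideal_def using \<open>A \<subseteq> B\<close> by (intro Inter_anti_mono) blast
    with \<open>A \<in> F\<close> show ?thesis by blast
  qed
  then show ?thesis
    unfolding var_ideal_Inter_def by blast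
qed

lemma alexander_dual_sqfree_ideal:
  assumes "finite V" "F \<subseteq> Pow V"
  shows "alexander_dual V (sqfree_ideal V F :: ('v, 'k::field) mpoly set) = var_ideal_Inter V F"
  unfolding alexander_dual_def
proof (rule the_equality)
  show "\<exists>F'. F' \<subseteq> Pow V \<and> (sqfree_ideal V F :: ('v, 'k) mpoly set) = sqfree_ideal V F' \<and>
          (var_ideal_Inter V F :: ('v, 'k) mpoly set) = var_ideal_Inter V F'"
    using assms by blast
next
  fix J :: "('v, 'k) mpoly set"
  assume "\<exists>F'. F' \<subseteq> Pow V \<and> (sqfree_ideal V F :: ('v, 'k) mpoly set) = sqfree_ideal V F' \<and>
            J = var_ideal_Inter V F'"
  then show "J = var_ideal_Inter V F"
    using var_ideal_Inter_antimono[OF assms(1), where 'k='k] assms(2)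
    by (metis order_refl subset_antisym)
qed


section \<open>Graphs\<close>

definition simple_graph :: "'v set \<Rightarrow> 'v set set \<Rightarrow> bool" where
  "simple_graph V E \<longleftrightarrow> finite V \<and> (\<forall>e\<in>E. e \<subseteq> V \<and> card e = 2)"

definition edge_ideal :: "'v set \<Rightarrow> 'v set set \<Rightarrow> ('v, 'k::field) mpoly set" where
  "edge_ideal V E = Idl\<^bsub>poly_ring V\<^esub> {var a * var b | a b. {a, b} \<in> E}"

definition vertex_cover :: "'v set \<Rightarrow> 'v set set \<Rightarrow> 'v set \<Rightarrow> bool" where
  "vertex_cover V E C \<longleftrightarrow> C \<subseteq> V \<and> (\<forall>e\<in>E. C \<inter> e \<noteq> {})"

definition minimal_vertex_cover :: "'v set \<Rightarrow> 'v set set \<Rightarrow> 'v set \<Rightarrow> bool" where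
  "minimal_vertex_cover V E C \<longleftrightarrow>
     vertex_cover V E C \<and> (\<forall>C'. C' \<subset> C \<longrightarrow> \<not> vertex_cover V E C')"

definition unmixed :: "'v set \<Rightarrow> 'v set set \<Rightarrow> bool" where
  "unmixed V E \<longleftrightarrow>
     (\<forall>C C'. minimal_vertex_cover V E C \<longrightarrow> minimal_vertex_cover V E C' \<longrightarrow> card C = card C')"

lemma edge_ideal_eq_sqfree_ideal:
  assumes "simple_graph V E"
  shows "(edge_ideal V E :: ('v, 'k::field) mpoly set) = sqfree_ideal V E"
proof -
  have pair: "(\<Prod>v\<in>{a, b}. var v :: ('v, 'k) mpoly) = var a * var b" if "{a, b} \<in> E" for a b
    using assms that by (cases "a = b") (auto simp: simple_graph_def)
  have "{var a * var b | a b. {a, b} \<in> E} = {\<Prod>v\<in>A. var v :: ('v, 'k) mpoly | A. A \<in> E}"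
  proof (intro equalityI subsetI)
    fix x :: "('v, 'k) mpoly" assume "x \<in> {var a * var b | a b. {a, b} \<in> E}"
    then show "x \<in> {\<Prod>v\<in>A. var v | A. A \<in> E}" using pair by force
  next
    fix x :: "('v, 'k) mpoly" assume "x \<in> {\<Prod>v\<in>A. var v | A. A \<in> E}"
    then obtain A where A: "A \<in> E" "x = (\<Prod>v\<in>A. var v)" by blast
    then obtain a b where "A = {a, b}"
      using assms by (auto simp: simple_graph_def card_2_iff)
    then show "x \<in> {var a * var b | a b. {a, b} \<in> E}" using A pair by force
  qed
  then show ?thesis by (simp add: edge_ideal_def sqfree_ideal_def)
qed

end

theory Submission
  imports Defs "HOL-Library.Function_Algebras"
begin

text \<open>
  Write \<open>R\<close> for the polynomial ring, \<open>I\<close> for the edge ideal and \<open>J\<close> for its Alexander dual. The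
  primes containing \<open>I\<close> contain the variables of some vertex cover, so \<open>ht I\<close> is the least size of a
  vertex cover (\<open>height_mon_ideal\<close>). The dual \<open>J\<close> is generated by the squarefree monomials of the
  vertex covers. The theorem combines four estimates.

  For a vertex cover \<open>C\<close>, \<open>reg I \<le> card C + 1\<close> and \<open>pdim J \<le> card C\<close>
  (\<open>regularity_bound_resolution\<close>, \<open>proj_dim_bound_resolution\<close>). Both rest on one construction: a
  squarefree ideal can be written as \<open>K + x L\<close> with \<open>K \<subseteq> L\<close> and generators free of \<open>x\<close>, and the mapping
  cone of the resolutions of \<open>K\<close> and \<open>L\<close> resolves it. This gives
  \<open>reg \<le> max (reg K) (reg L + 1)\<close> and \<open>pdim \<le> max (pdim K + 1) (pdim L)\<close>, and splitting
  successively at the vertices in \<open>C\<close> proves the bounds by induction. They are applied to a cover of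
  least size.

  For a minimal vertex cover \<open>C\<close>, \<open>reg J \<ge> card C\<close> and \<open>pdim I \<ge> card C - 1\<close>. The first holds
  because the monomial of \<open>C\<close> is a minimal generator of \<open>J\<close> (\<open>minimal_generator_degree\<close>). For the second,
  the product of the variables outside \<open>C\<close> is nonzero in \<open>R/I\<close> and annihilated by all variables
  in \<open>C\<close>, so \<open>Tor(R/I, R/(x\<^sub>v : v \<in> C))\<close> does not vanish in degree \<open>card C\<close>
  (\<open>length_ge_card_annihilator\<close>). If the graph is not unmixed, some minimal cover is larger than the
  smallest one, and the lower bounds improve by one.

  Regularity and projective dimension are defined through an unspecified minimal resolution. It exists
  because a finite resolution becomes minimal by cancelling unit entries
  (\<open>exists_minimal_subresolution\<close>), and its shifts occur in every other graded resolution
  (\<open>minimal_resolution_le\<close>). So upper bounds may be proved on the mapping cones.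
\<close>

section \<open>Polynomials and squarefree monomial ideals\<close>

abbreviation mons :: "('a \<Rightarrow>\<^sub>0 'b::zero) \<Rightarrow> 'a set" where "mons \<equiv> Poly_Mapping.keys"
abbreviation cf :: "('a \<Rightarrow>\<^sub>0 'b::zero) \<Rightarrow> 'a \<Rightarrow> 'b" where "cf \<equiv> Poly_Mapping.lookup"
abbreviation PR :: "'v set \<Rightarrow> ('v, 'k::field) mpoly set" where "PR V \<equiv> carrier (poly_ring V)"

lemma PR_zero [simp]: "0 \<in> PR V" and PR_one [simp]: "1 \<in> PR V"
  by (auto simp: poly_ring_carrier)

lemmas PR_add [simp] = poly_ring_closed(1)
lemmas PR_mult [simp] = poly_ring_closed(2)
lemmas PR_uminus [simp] = poly_ring_uminus_closed

lemma PR_diff [simp]: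
  fixes p q :: "('v, 'k::field) mpoly"
  shows "p \<in> PR V \<Longrightarrow> q \<in> PR V \<Longrightarrow> p - q \<in> PR V"
  using PR_add[of p V "- q"] by simp

lemma PR_sum [simp]:
  fixes f :: "'a \<Rightarrow> ('v, 'k::field) mpoly"
  shows "(\<And>a. a \<in> A \<Longrightarrow> f a \<in> PR V) \<Longrightarrow> sum f A \<in> PR V"
  by (induction A rule: infinite_finite_induct) auto

lemma PR_power [simp]:
  fixes p :: "('v, 'k::field) mpoly"
  shows "p \<in> PR V \<Longrightarrow> p ^ n \<in> PR V"
  by (induction n) auto

lemma PR_single [simp]: "mons m \<subseteq> V \<Longrightarrow> Poly_Mapping.single m c \<in> PR V"
  by (auto simp: poly_ring_carrier)

lemma mons_single_one [simp]: "mons (Poly_Mapping.single x (1::nat)) = {x}"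
  by simp

lemma PR_var [simp]: "x \<in> V \<Longrightarrow> var x \<in> PR V"
  by (auto simp: poly_ring_carrier var_def)

lemma poly_mapping_sum_single:
  fixes p :: "'a \<Rightarrow>\<^sub>0 'b::comm_monoid_add"
  shows "p = (\<Sum>m\<in>mons p. Poly_Mapping.single m (cf p m))"
  by (rule poly_mapping_eqI)
     (auto simp: lookup_sum lookup_single when_def sum.delta in_keys_iff)

lemma lookup_single_mult:
  fixes p :: "('v, 'k::field) mpoly"
  shows "cf (Poly_Mapping.single a c * p) (a + m) = c * cf p m"
proof -
  have "Poly_Mapping.single a c * p =
      (\<Sum>m\<in>mons p. Poly_Mapping.single (a + m) (c * cf p m))"
  proof -
    have "Poly_Mapping.single a c * p =
        Poly_Mapping.single a c * (\<Sum>m\<in>mons p. Poly_Mapping.single m (cf p m))"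
      using arg_cong[OF poly_mapping_sum_single] by blast
    also have "\<dots> = (\<Sum>m\<in>mons p. Poly_Mapping.single (a + m) (c * cf p m))"
      by (simp add: sum_distrib_left mult_single)
    finally show ?thesis .
  qed
  then show ?thesis
    by (auto simp: lookup_sum lookup_single when_def sum.delta in_keys_iff)
qed

lemma mons_var_mult:
  fixes p :: "('v, 'k::field) mpoly"
  shows "mons (var x * p) = (\<lambda>m. Poly_Mapping.single x 1 + m) ` mons p"
proof (intro equalityI subsetI)
  fix m assume "m \<in> mons (var x * p)"
  then obtain a b where "a \<in> mons (var x :: ('v,'k) mpoly)" "b \<in> mons p" "m = a + b"
    by (rule keys_mult_obtain)
  then show "m \<in> (\<lambda>m. Poly_Mapping.single x 1 + m) ` mons p"
    by (auto simp: var_def)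
next
  fix m assume "m \<in> (\<lambda>m. Poly_Mapping.single x 1 + m) ` mons p"
  then show "m \<in> mons (var x * p)"
    by (auto simp: in_keys_iff var_def lookup_single_mult)
qed

lemma var_mult_cancel:
  fixes p q :: "('v, 'k::field) mpoly"
  assumes "var x * p = var x * q"
  shows "p = q"
proof -
  have "mons (var x * (p - q)) = {}"
    using assms by (simp add: algebra_simps)
  then have "mons (p - q) = {}"
    unfolding mons_var_mult by simp
  then show ?thesis by simp
qed

lemma lookup_mult_zero:
  fixes p q :: "('v, 'k::field) mpoly"
  shows "cf (p * q) 0 = cf p 0 * cf q 0"
proof -
  have *: "(cf q b when 0 = a + b) = ((cf q b when b = 0) when a = 0)"
    for a b :: "'v \<Rightarrow>\<^sub>0 nat"
  proof -
    have "0 = a + b \<longleftrightarrow> a = 0 \<and> b = 0"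
    proof
      assume "0 = a + b"
      then have "mons (a + b) = {}" by (metis keys_zero)
      then show "a = 0 \<and> b = 0" by (simp add: keys_add_nat)
    qed simp
    then show ?thesis by (auto simp: when_def)
  qed
  show ?thesis
    unfolding lookup_mult * Sum_any_when_independent
    by (simp add: mult_when)
qed

lemma mon_degree_superset:
  assumes "finite A" "mons m \<subseteq> A"
  shows "mon_degree m = (\<Sum>v\<in>A. cf m v)"
  unfolding mon_degree_def using assms
  by (intro sum.mono_neutral_left) (auto simp: in_keys_iff)

lemma mon_degree_add [simp]: "mon_degree (m + n) = mon_degree m + mon_degree n"
proof -
  have "finite (mons m \<union> mons n)" by simp
  from mon_degree_superset[OF this] show ?thesis
    by (simp add: keys_add_nat lookup_add sum.distrib)
qed

lemma mon_degree_zero [simp]: "mon_degree 0 = 0"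
  by (simp add: mon_degree_def)

lemma mon_degree_single [simp]: "mon_degree (Poly_Mapping.single x 1) = 1"
  by (simp add: mon_degree_def)

lemma mon_degree_eq_0_iff: "mon_degree m = 0 \<longleftrightarrow> m = 0"
  by (auto simp: mon_degree_def in_keys_iff intro!: poly_mapping_eqI)

definition mon_part :: "('a \<Rightarrow> bool) \<Rightarrow> ('a \<Rightarrow>\<^sub>0 'b) \<Rightarrow> ('a \<Rightarrow>\<^sub>0 'b::comm_monoid_add)" where
  "mon_part P p = (\<Sum>m\<in>{m \<in> mons p. P m}. Poly_Mapping.single m (cf p m))"

lemma lookup_mon_part [simp]: "cf (mon_part P p) m = (if P m then cf p m else 0)"
  by (auto simp: mon_part_def lookup_sum lookup_single when_def sum.delta in_keys_iff)

lemma mons_mon_part [simp]: "mons (mon_part P p) = {m \<in> mons p. P m}"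
  by (auto simp: in_keys_iff split: if_splits)

lemma mon_part_PR [simp]: "p \<in> PR V \<Longrightarrow> mon_part P p \<in> PR V"
  by (auto simp: poly_ring_carrier)

lemma mon_part_id: "(\<And>m. m \<in> mons p \<Longrightarrow> P m) \<Longrightarrow> mon_part P p = p"
  by (rule poly_mapping_eqI) (auto simp: in_keys_iff)

lemma mon_part_eq_0: "(\<And>m. m \<in> mons p \<Longrightarrow> \<not> P m) \<Longrightarrow> mon_part P p = 0"
  by (rule poly_mapping_eqI) (auto simp: in_keys_iff)

lemma mon_part_add: "mon_part P (p + q) = mon_part P p + mon_part P q"
  by (rule poly_mapping_eqI) (auto simp: lookup_add)

lemma mon_part_zero [simp]: "mon_part P 0 = 0"
  by (rule poly_mapping_eqI) auto

lemma mon_part_sum: "mon_part P (sum f A) = (\<Sum>a\<in>A. mon_part P (f a))"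
  by (induction A rule: infinite_finite_induct) (auto simp: mon_part_add)

lemma mon_part_split: "p = mon_part P p + mon_part (\<lambda>m. \<not> P m) p"
  by (rule poly_mapping_eqI) (auto simp: lookup_add)

text \<open>
  Multiplication by a homogeneous polynomial shifts degrees. The hypothesis expresses this for an
  arbitrary grading: multiplying by a monomial of \<open>p\<close> turns \<open>P\<close> into \<open>Q\<close>.
\<close>

lemma mon_part_mult:
  fixes p q :: "('v, 'k::field) mpoly"
  assumes "\<And>m m'. m \<in> mons p \<Longrightarrow> Q (m + m') \<longleftrightarrow> P m'"
  shows "mon_part Q (p * q) = p * mon_part P q"
proof -
  have "p * q = p * mon_part P q + p * mon_part (\<lambda>m. \<not> P m) q"
    by (subst mon_part_split[of q P]) (simp add: algebra_simps)
  moreover have "mon_part Q (p * mon_part P q) = p * mon_part P q"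
    using assms by (intro mon_part_id) (auto elim!: keys_mult_obtain)
  moreover have "mon_part Q (p * mon_part (\<lambda>m. \<not> P m) q) = 0"
    using assms by (intro mon_part_eq_0) (auto elim!: keys_mult_obtain)
  ultimately show ?thesis
    by (simp add: mon_part_add)
qed

lemma monomial_divide:
  fixes m :: "'v \<Rightarrow>\<^sub>0 nat"
  assumes "\<And>v. cf n v \<le> cf m v"
  shows "m = n + (m - n)"
  using assms by (intro poly_mapping_eqI) (simp add: lookup_add lookup_minus)

lemma divide_var:
  fixes p :: "('v, 'k::field) mpoly"
  assumes "p \<in> PR V" "\<And>m. m \<in> mons p \<Longrightarrow> x \<in> mons m"
  shows "\<exists>r\<in>PR V. p = var x * r"
proof -
  let ?x = "Poly_Mapping.single x (1::nat)"
  define r :: "('v, 'k) mpoly" where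
    "r = (\<Sum>m\<in>mons p. Poly_Mapping.single (m - ?x) (cf p m))"
  have dv: "?x + (m - ?x) = m" if "m \<in> mons p" for m
    using assms(2)[OF that]
    by (intro monomial_divide[symmetric]) (auto simp: lookup_single when_def in_keys_iff Suc_le_eq)
  have "mons (m - ?x) \<subseteq> V" if "m \<in> mons p" for m
    using assms(1) that dv[OF that] keys_add_nat[of ?x "m - ?x"]
    by (auto simp: poly_ring_carrier)
  then have "r \<in> PR V"
    unfolding r_def by (intro PR_sum PR_single) auto
  moreover have "var x * r = p"
  proof -
    have "var x * r = (\<Sum>m\<in>mons p. Poly_Mapping.single m (cf p m))"
      unfolding r_def var_def
      by (simp add: sum_distrib_left mult_single dv del: One_nat_def)
    then show ?thesis unfolding poly_mapping_sum_single[of p, symmetric] .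
  qed
  ultimately show ?thesis by blast
qed

text \<open>
  The squarefree ideal generated by \<open>F\<close>, described by the monomials of its elements, so that
  membership and colon ideals become statements about supports of monomials.
\<close>

definition mon_ideal :: "'v set \<Rightarrow> 'v set set \<Rightarrow> ('v, 'k::field) mpoly set" where
  "mon_ideal V F = {p \<in> PR V. \<forall>m\<in>mons p. \<exists>A\<in>F. A \<subseteq> mons m}"

lemma mon_ideal_PR: "p \<in> mon_ideal V F \<Longrightarrow> p \<in> PR V"
  by (simp add: mon_ideal_def)

lemma mon_ideal_zero: "0 \<in> mon_ideal V F"
  by (simp add: mon_ideal_def)

lemma mon_ideal_add:
  fixes p q :: "('v, 'k::field) mpoly"
  assumes "p \<in> mon_ideal V F" "q \<in> mon_ideal V F"
  shows "p + q \<in> mon_ideal V F"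
proof -
  have "\<exists>A\<in>F. A \<subseteq> mons m" if "m \<in> mons (p + q)" for m
  proof -
    have "m \<in> mons p \<or> m \<in> mons q" using that keys_add[of p q] by blast
    then show ?thesis using assms by (auto simp: mon_ideal_def)
  qed
  then show ?thesis using assms by (simp add: mon_ideal_def)
qed

lemma mon_ideal_mult:
  fixes p q :: "('v, 'k::field) mpoly"
  assumes "p \<in> mon_ideal V F" "q \<in> PR V"
  shows "q * p \<in> mon_ideal V F"
proof -
  have "\<exists>A\<in>F. A \<subseteq> mons m" if m: "m \<in> mons (q * p)" for m
  proof -
    obtain a b where b: "b \<in> mons p" and ab: "m = a + b"
      using m by (rule keys_mult_obtain)
    have "mons b \<subseteq> mons m" unfolding ab keys_add_nat by blast
    moreover obtain A where "A \<in> F" "A \<subseteq> mons b"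
      using b assms(1) unfolding mon_ideal_def by blast
    ultimately show ?thesis by blast
  qed
  then show "q * p \<in> mon_ideal V F"
    using assms by (simp add: mon_ideal_def)
qed

lemma ideal_mon_ideal: "ideal (mon_ideal V F :: ('v, 'k::field) mpoly set) (poly_ring V)"
  by (rule ideal_poly_ringI)
     (auto intro: mon_ideal_PR mon_ideal_zero mon_ideal_add mon_ideal_mult)

lemma mon_ideal_cong:
  assumes "\<And>A. A \<in> F \<Longrightarrow> \<exists>A'\<in>F'. A' \<subseteq> A" "\<And>A. A \<in> F' \<Longrightarrow> \<exists>A'\<in>F. A' \<subseteq> A"
  shows "mon_ideal V F = mon_ideal V F'"
proof -
  have "(\<exists>A\<in>F. A \<subseteq> S) \<longleftrightarrow> (\<exists>A\<in>F'. A \<subseteq> S)" for S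
    using assms by (meson subset_trans)
  then show ?thesis by (simp add: mon_ideal_def)
qed

definition sq_mon :: "'v set \<Rightarrow> ('v \<Rightarrow>\<^sub>0 nat)" where
  "sq_mon A = (\<Sum>v\<in>A. Poly_Mapping.single v 1)"

lemma prod_var_eq_single:
  assumes "finite A"
  shows "(\<Prod>v\<in>A. var v :: ('v, 'k::field) mpoly) =
    Poly_Mapping.single (sq_mon A) 1"
  using assms by (induction A) (auto simp: sq_mon_def var_def mult_single)

lemma lookup_sq_mon: "finite A \<Longrightarrow> cf (sq_mon A) v = (if v \<in> A then 1 else 0)"
  by (auto simp: sq_mon_def lookup_sum lookup_single when_def)

lemma mons_sq_mon: "finite A \<Longrightarrow> mons (sq_mon A) = A"
  by (auto simp: in_keys_iff lookup_sq_mon split: if_splits)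

lemma mon_degree_sq_mon: "finite A \<Longrightarrow> mon_degree (sq_mon A) = card A"
  by (simp add: mon_degree_def mons_sq_mon lookup_sq_mon)

lemma sq_mon_divide:
  assumes "finite A" "A \<subseteq> mons m"
  shows "m = sq_mon A + (m - sq_mon A)"
proof (rule monomial_divide)
  fix v
  have "v \<in> A \<Longrightarrow> 0 < cf m v"
    using assms(2) by (metis gr0I lookup_not_eq_zero_eq_in_keys subsetD)
  then show "cf (sq_mon A) v \<le> cf m v"
    using lookup_sq_mon[OF assms(1), of v] by (simp add: Suc_le_eq)
qed

text \<open>
  The right-hand side is an ideal that contains the generators. Conversely, each term of an element
  of it is a multiple of a generator \<open>sq_mon A\<close>.
\<close>

lemma sqfree_ideal_eq_mon_ideal:
  assumes "finite V" "F \<subseteq> Pow V"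
  shows "(sqfree_ideal V F :: ('v, 'k::field) mpoly set) = mon_ideal V F"
proof
  interpret cring "poly_ring V :: ('v, 'k) mpoly ring" by (rule poly_ring_cring)
  let ?G = "{\<Prod>v\<in>A. var v :: ('v, 'k) mpoly | A. A \<in> F}"
  have fin: "finite A" if "A \<in> F" for A using that assms by (auto intro: finite_subset)
  have G: "?G \<subseteq> mon_ideal V F"
    using assms(2) fin by (force simp: mon_ideal_def prod_var_eq_single mons_sq_mon)
  then show "sqfree_ideal V F \<subseteq> (mon_ideal V F :: ('v, 'k) mpoly set)"
    unfolding sqfree_ideal_def by (intro genideal_minimal ideal_mon_ideal)
  have "?G \<subseteq> carrier (poly_ring V)" using G by (auto simp: mon_ideal_def)
  then interpret J: ideal "sqfree_ideal V F :: ('v, 'k) mpoly set" "poly_ring V"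
    unfolding sqfree_ideal_def by (rule genideal_ideal)
  have GJ: "?G \<subseteq> sqfree_ideal V F"
    unfolding sqfree_ideal_def genideal_def by auto
  have add: "p + q \<in> sqfree_ideal V F" if "p \<in> sqfree_ideal V F" "q \<in> sqfree_ideal V F" for p q :: "('v,'k) mpoly"
    using J.a_closed[OF that] by simp
  have zero: "(0 :: ('v,'k) mpoly) \<in> sqfree_ideal V F"
    using J.zero_closed by simp
  have mult: "p * q \<in> sqfree_ideal V F" if "q \<in> sqfree_ideal V F" "p \<in> PR V" for p q :: "('v,'k) mpoly"
    using J.I_l_closed[OF that] by simp
  show "(mon_ideal V F :: ('v, 'k) mpoly set) \<subseteq> sqfree_ideal V F"
  proof
    fix p :: "('v, 'k) mpoly" assume p: "p \<in> mon_ideal V F"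
    have sing: "Poly_Mapping.single m (cf p m) \<in> sqfree_ideal V F" if m: "m \<in> mons p" for m
    proof -
      from p m obtain A where A: "A \<in> F" "A \<subseteq> mons m" by (auto simp: mon_ideal_def)
      have mV: "mons m \<subseteq> V" using p m by (auto simp: mon_ideal_def poly_ring_carrier)
      have d: "m = sq_mon A + (m - sq_mon A)"
        by (rule sq_mon_divide[OF fin[OF A(1)] A(2)])
      have "mons (m - sq_mon A) \<subseteq> mons (sq_mon A + (m - sq_mon A))"
        unfolding keys_add_nat by blast
      then have "mons (m - sq_mon A) \<subseteq> V"
        using mV unfolding d[symmetric] by blast
      then have "Poly_Mapping.single (m - sq_mon A) (cf p m) * (\<Prod>v\<in>A. var v) \<in> sqfree_ideal V F"
        using GJ A(1) by (intro mult PR_single) blast+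
      moreover have "(m - sq_mon A) + sq_mon A = m"
        by (subst add.commute) (rule d[symmetric])
      ultimately show ?thesis
        unfolding prod_var_eq_single[OF fin[OF A(1)]] mult_single by simp
    qed
    have "(\<Sum>m\<in>S. Poly_Mapping.single m (cf p m)) \<in> sqfree_ideal V F" if "finite S" "S \<subseteq> mons p" for S
      using that
    proof (induction S)
      case empty
      then show ?case using zero by simp
    next
      case (insert m S)
      then have "Poly_Mapping.single m (cf p m) \<in> sqfree_ideal V F" by (intro sing) simp
      moreover have "(\<Sum>m\<in>S. Poly_Mapping.single m (cf p m)) \<in> sqfree_ideal V F"
        using insert by simp
      ultimately show ?case
        unfolding sum.insert[OF insert.hyps] by (rule add)
    qed
    from this[of "mons p"] show "p \<in> sqfree_ideal V F"
      unfolding poly_mapping_sum_single[of p, symmetric] by simp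
  qed
qed

lemma Idl_vars:
  assumes "finite V" "A \<subseteq> V"
  shows "(Idl\<^bsub>poly_ring V\<^esub> (var ` A) :: ('v, 'k::field) mpoly set) = mon_ideal V ((\<lambda>v. {v}) ` A)"
proof -
  have "var ` A = {\<Prod>v\<in>B. var v :: ('v, 'k) mpoly | B. B \<in> (\<lambda>v. {v}) ` A}"
    (is "?L = ?R")
  proof (intro equalityI subsetI)
    fix p assume "p \<in> ?L"
    then obtain a where "a \<in> A" "p = (\<Prod>v\<in>{a}. var v)" by auto
    then show "p \<in> ?R" by blast
  next
    fix p assume "p \<in> ?R"
    then show "p \<in> ?L" by auto
  qed
  then have "Idl\<^bsub>poly_ring V\<^esub> (var ` A) = (sqfree_ideal V ((\<lambda>v. {v}) ` A) :: ('v, 'k) mpoly set)"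
    by (simp add: sqfree_ideal_def)
  then show ?thesis using sqfree_ideal_eq_mon_ideal[of V "(\<lambda>v. {v}) ` A"] assms by auto
qed

definition hitting_sets :: "'v set \<Rightarrow> 'v set set \<Rightarrow> 'v set set" where
  "hitting_sets V F = {A. A \<subseteq> V \<and> (\<forall>e\<in>F. A \<inter> e \<noteq> {})}"

text \<open>
  A monomial lies in \<open>(x\<^sub>v : v \<in> A)\<close> if and only if its support meets \<open>A\<close>. So the Alexander dual
  is generated by the squarefree monomials whose support meets every member of \<open>F\<close>.
\<close>

lemma var_ideal_Inter_eq_mon_ideal:
  assumes "finite V" "F \<subseteq> Pow V"
  shows "(var_ideal_Inter V F :: ('v, 'k::field) mpoly set) = mon_ideal V (hitting_sets V F)"
proof (rule Set.set_eqI)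
  fix p :: "('v, 'k) mpoly"
  have "p \<in> Idl\<^bsub>poly_ring V\<^esub> (var ` A) \<longleftrightarrow> p \<in> PR V \<and> (\<forall>m\<in>mons p. mons m \<inter> A \<noteq> {})"
    if "A \<in> F" for A
  proof -
    have "(Idl\<^bsub>poly_ring V\<^esub> (var ` A) :: ('v, 'k) mpoly set) = mon_ideal V ((\<lambda>v. {v}) ` A)"
      using that assms by (intro Idl_vars) auto
    moreover have "(\<exists>B\<in>(\<lambda>v. {v}) ` A. B \<subseteq> M) \<longleftrightarrow> M \<inter> A \<noteq> {}" for M by auto
    ultimately show ?thesis by (simp add: mon_ideal_def)
  qed
  then have "p \<in> var_ideal_Inter V F \<longleftrightarrow> p \<in> PR V \<and> (\<forall>m\<in>mons p. \<forall>A\<in>F. mons m \<inter> A \<noteq> {})"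
    unfolding var_ideal_Inter_def by auto
  also have "\<dots> \<longleftrightarrow> p \<in> PR V \<and> (\<forall>m\<in>mons p. mons m \<in> hitting_sets V F)"
    unfolding hitting_sets_def poly_ring_carrier by auto
  also have "\<dots> \<longleftrightarrow> p \<in> mon_ideal V (hitting_sets V F)"
  proof -
    have "mons m \<in> hitting_sets V F"
      if "p \<in> PR V" "m \<in> mons p" "A \<in> hitting_sets V F" "A \<subseteq> mons m" for m A
      using that unfolding hitting_sets_def poly_ring_carrier by blast
    then show ?thesis unfolding mon_ideal_def by blast
  qed
  finally show "p \<in> var_ideal_Inter V F \<longleftrightarrow> p \<in> mon_ideal V (hitting_sets V F)" .
qed

section \<open>Linear maps between free modules\<close>

definition smul :: "('v, 'k::field) mpoly \<Rightarrow> ('b \<Rightarrow> ('v, 'k) mpoly) \<Rightarrow> 'b \<Rightarrow> ('v, 'k) mpoly" where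
  "smul p u = (\<lambda>b. p * u b)"

definition unitv :: "'b \<Rightarrow> 'b \<Rightarrow> ('v, 'k::field) mpoly" where
  "unitv b = (\<lambda>a. if a = b then 1 else 0)"

text \<open>
  The free module with basis \<open>B\<close> over the polynomial ring. Its elements vanish outside
  \<open>B\<close>, so that equality of vectors is equality of functions, and modules with bases in the same type
  can be compared directly.
\<close>

definition fmod :: "'v set \<Rightarrow> 'b set \<Rightarrow> ('b \<Rightarrow> ('v, 'k::field) mpoly) set" where
  "fmod V B = {u. (\<forall>b\<in>B. u b \<in> PR V) \<and> (\<forall>b. b \<notin> B \<longrightarrow> u b = 0)}"

text \<open>
  Linearity is required on all functions, not only on those in a free module. Maps then compose
  without side conditions, and by \<open>exists_rlinear\<close> every choice of images of the basis vectors extends.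
\<close>

definition rlinear :: "(('b \<Rightarrow> ('v, 'k::field) mpoly) \<Rightarrow> ('c \<Rightarrow> ('v, 'k) mpoly)) \<Rightarrow> bool" where
  "rlinear f \<longleftrightarrow> (\<forall>u v. f (u + v) = f u + f v) \<and> (\<forall>p u. f (smul p u) = smul p (f u))"

lemma smul_apply [simp]: "smul p u b = p * u b"
  by (simp add: smul_def)

lemma smul_simps [simp]:
  "smul 0 u = 0" "smul 1 u = u" "smul p 0 = 0" "smul p (smul q u) = smul (p * q) u"
  "smul (- p) u = - smul p u" "smul p (- u) = - smul p u"
  by (auto simp: fun_eq_iff mult.assoc)

lemma smul_add: "smul p (u + v) = smul p u + smul p v" "smul (p + q) u = smul p u + smul q u"
  "smul p (u - v) = smul p u - smul p v" "smul (p - q) u = smul p u - smul q u"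
  by (auto simp: fun_eq_iff algebra_simps)

lemma sum_fun_apply: "(\<Sum>x\<in>A. f x) b = (\<Sum>x\<in>A. f x b)"
  for f :: "'a \<Rightarrow> 'b \<Rightarrow> 'c::comm_monoid_add"
  by (induction A rule: infinite_finite_induct) auto

lemma unitv_apply: "unitv b a = (if a = b then 1 else 0)"
  by (simp add: unitv_def)

lemma rlinearI:
  assumes "\<And>u v. f (u + v) = f u + f v" "\<And>p u. f (smul p u) = smul p (f u)"
  shows "rlinear f"
  using assms by (simp add: rlinear_def)

context
  fixes f :: "('b \<Rightarrow> ('v, 'k::field) mpoly) \<Rightarrow> ('c \<Rightarrow> ('v, 'k) mpoly)"
  assumes f: "rlinear f"
begin

lemma rlinear_add: "f (u + v) = f u + f v"
  and rlinear_smul: "f (smul p u) = smul p (f u)"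
  using f by (simp_all add: rlinear_def)

lemma rlinear_zero: "f 0 = 0"
  using rlinear_smul[of 0 0] by simp

lemma rlinear_uminus: "f (- u) = - f u"
  using rlinear_smul[of "- 1" u] by simp

lemma rlinear_diff: "f (u - v) = f u - f v"
  using rlinear_add[of u "- v"] by (simp add: rlinear_uminus)

lemma rlinear_sum: "f (\<Sum>x\<in>A. g x) = (\<Sum>x\<in>A. f (g x))"
  by (induction A rule: infinite_finite_induct)
     (simp_all only: sum.infinite sum.empty sum.insert rlinear_zero rlinear_add not_False_eq_True)

end

lemma rlinear_comp: "rlinear f \<Longrightarrow> rlinear g \<Longrightarrow> rlinear (\<lambda>u. f (g u))"
  by (simp add: rlinear_def)

lemma rlinear_minus: "rlinear f \<Longrightarrow> rlinear g \<Longrightarrow> rlinear (\<lambda>u. f u - g u)"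
  by (simp add: rlinear_def smul_add algebra_simps)

lemma rlinear_id: "rlinear (\<lambda>u. u)"
  by (simp add: rlinear_def)

lemma rlinear_const_zero: "rlinear (\<lambda>u. 0)"
  by (simp add: rlinear_def)

lemma rlinear_fun_upd: "rlinear f \<Longrightarrow> rlinear (\<lambda>u. (f u)(b := 0))"
  by (auto simp: rlinear_def fun_eq_iff)

lemma fmod_coord: "u \<in> fmod V B \<Longrightarrow> b \<in> B \<Longrightarrow> u b \<in> PR V"
  and fmod_outside: "u \<in> fmod V B \<Longrightarrow> b \<notin> B \<Longrightarrow> u b = 0"
  by (auto simp: fmod_def)

lemma fmod_coord_PR: "u \<in> fmod V B \<Longrightarrow> u b \<in> PR V"
  by (cases "b \<in> B") (auto simp: fmod_def)

lemma fmodI: "(\<And>b. b \<in> B \<Longrightarrow> u b \<in> PR V) \<Longrightarrow> (\<And>b. b \<notin> B \<Longrightarrow> u b = 0) \<Longrightarrow> u \<in> fmod V B"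
  by (auto simp: fmod_def)

lemma fmod_zero [simp]: "0 \<in> fmod V B"
  by (auto simp: fmod_def)

lemma fmod_add [simp]: "u \<in> fmod V B \<Longrightarrow> v \<in> fmod V B \<Longrightarrow> u + v \<in> fmod V B"
  by (auto simp: fmod_def)

lemma fmod_diff [simp]: "u \<in> fmod V B \<Longrightarrow> v \<in> fmod V B \<Longrightarrow> u - v \<in> fmod V B"
  by (auto simp: fmod_def)

lemma fmod_uminus [simp]: "u \<in> fmod V B \<Longrightarrow> - u \<in> fmod V B"
  by (auto simp: fmod_def)

lemma fmod_smul [simp]: "p \<in> PR V \<Longrightarrow> u \<in> fmod V B \<Longrightarrow> smul p u \<in> fmod V B"
  by (auto simp: fmod_def)

lemma fmod_unitv [simp]: "b \<in> B \<Longrightarrow> unitv b \<in> fmod V B"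
  by (auto simp: fmod_def unitv_def)

lemma fmod_sum [simp]: "(\<And>x. x \<in> A \<Longrightarrow> g x \<in> fmod V B) \<Longrightarrow> (\<Sum>x\<in>A. g x) \<in> fmod V B"
  by (auto simp: fmod_def sum_fun_apply)

lemma fmod_expand:
  assumes "u \<in> fmod V B" "finite B"
  shows "u = (\<Sum>b\<in>B. smul (u b) (unitv b))"
  using assms by (auto simp: fun_eq_iff sum_fun_apply unitv_def fmod_outside if_distrib[of "(*) _"] cong: if_cong)

lemma rlinear_expand:
  assumes "rlinear f" "u \<in> fmod V B" "finite B"
  shows "f u = (\<Sum>b\<in>B. smul (u b) (f (unitv b)))"
proof -
  have "f u = f (\<Sum>b\<in>B. smul (u b) (unitv b))"
    using arg_cong[OF fmod_expand[OF assms(2,3)], of f] .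
  then show ?thesis
    by (simp only: rlinear_sum[OF assms(1)] rlinear_smul[OF assms(1)])
qed

lemma rlinear_coord_expand:
  assumes "rlinear f" "u \<in> fmod V B" "finite B"
  shows "f u a = (\<Sum>b\<in>B. u b * f (unitv b) a)"
  by (subst rlinear_expand[OF assms]) (simp add: sum_fun_apply)

lemma rlinear_ext:
  assumes "rlinear f" "rlinear g" "u \<in> fmod V B" "finite B"
    and "\<And>b. b \<in> B \<Longrightarrow> f (unitv b) = g (unitv b)"
  shows "f u = g u"
  using assms(5) unfolding rlinear_expand[OF assms(1,3,4)] rlinear_expand[OF assms(2,3,4)]
  by (simp cong: sum.cong)

lemma rlinear_fmod:
  assumes "rlinear f" "u \<in> fmod V B" "finite B"
    and "\<And>b. b \<in> B \<Longrightarrow> f (unitv b) \<in> fmod V A"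
  shows "f u \<in> fmod V A"
  unfolding rlinear_expand[OF assms(1-3)]
  using assms(2,4) by (intro fmod_sum fmod_smul) (auto intro: fmod_coord)

lemma exists_rlinear:
  assumes "finite B"
  shows "\<exists>f. rlinear f \<and> (\<forall>b\<in>B. f (unitv b) = w b)"
proof (intro exI conjI ballI)
  let ?f = "\<lambda>u. \<Sum>b\<in>B. smul (u b) (w b)"
  show "rlinear ?f"
    by (rule rlinearI)
       (auto simp: fun_eq_iff sum_fun_apply algebra_simps sum.distrib sum_distrib_left)
  fix b assume "b \<in> B"
  then show "?f (unitv b) = w b"
    using assms by (simp add: fun_eq_iff sum_fun_apply unitv_def if_distrib[of "\<lambda>x. x * _"] cong: if_cong)
qed

text \<open>
  Homogeneity of degree \<open>e\<close> in the free module whose basis vector \<open>b\<close> has degree \<open>d b\<close>.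
\<close>

definition homog :: "('b \<Rightarrow> nat) \<Rightarrow> nat \<Rightarrow> ('b \<Rightarrow> ('v, 'k::field) mpoly) \<Rightarrow> bool" where
  "homog d e u \<longleftrightarrow> (\<forall>b. \<forall>m\<in>mons (u b). mon_degree m + d b = e)"

lemma homog_add:
  assumes "homog d e u" "homog d e v"
  shows "homog d e (u + v)"
  unfolding homog_def plus_fun_apply
proof (intro allI ballI)
  fix b m assume "m \<in> mons (u b + v b)"
  then have "m \<in> mons (u b) \<or> m \<in> mons (v b)"
    using keys_add[of "u b" "v b"] by blast
  then show "mon_degree m + d b = e"
    using assms unfolding homog_def by blast
qed

lemma homog_uminus: "homog d e u \<Longrightarrow> homog d e (- u)"
  unfolding homog_def by simp

lemma homog_diff: "homog d e u \<Longrightarrow> homog d e v \<Longrightarrow> homog d e (u - v)"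
  using homog_add[OF _ homog_uminus, of d e u v] by simp

lemma homog_zero: "homog d e 0"
  by (simp add: homog_def)

lemma homog_unitv: "homog d (d b) (unitv b)"
  by (auto simp: homog_def unitv_def)

text \<open>
  Homogeneous maps of degree 0 between free modules, in terms of the columns \<open>f (unitv b)\<close> of
  their matrices.
\<close>

definition gmap :: "'v set \<Rightarrow> 'b set \<Rightarrow> ('b \<Rightarrow> nat) \<Rightarrow> 'c set \<Rightarrow> ('c \<Rightarrow> nat) \<Rightarrow>
    (('b \<Rightarrow> ('v, 'k::field) mpoly) \<Rightarrow> ('c \<Rightarrow> ('v, 'k) mpoly)) \<Rightarrow> bool" where
  "gmap V B d B' d' f \<longleftrightarrow> rlinear f \<and>
     (\<forall>b\<in>B. f (unitv b) \<in> fmod V B' \<and> homog d' (d b) (f (unitv b)))"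

lemma gmapD:
  assumes "gmap V B d B' d' f"
  shows "rlinear f" "b \<in> B \<Longrightarrow> f (unitv b) \<in> fmod V B'"
    "b \<in> B \<Longrightarrow> homog d' (d b) (f (unitv b))"
  using assms by (auto simp: gmap_def)

lemma gmap_fmod: "gmap V B d B' d' f \<Longrightarrow> finite B \<Longrightarrow> u \<in> fmod V B \<Longrightarrow> f u \<in> fmod V B'"
  by (auto simp: gmap_def intro: rlinear_fmod)

lemma mons_sum: "m \<in> mons (\<Sum>a\<in>A. f a) \<Longrightarrow> \<exists>a\<in>A. m \<in> mons (f a)"
proof (induction A rule: infinite_finite_induct)
  case (insert x F)
  have "m \<in> mons (f x + sum f F)"
    using insert.prems unfolding sum.insert[OF insert.hyps] .
  then have "m \<in> mons (f x) \<or> m \<in> mons (sum f F)"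
    using keys_add[of "f x" "sum f F"] by blast
  then show ?case using insert.IH by blast
qed simp_all

lemma gmap_homog:
  assumes f: "gmap V B d B' d' f" and u: "u \<in> fmod V B" "finite B" "homog d e u"
  shows "homog d' e (f u)"
  unfolding homog_def
proof (intro allI ballI)
  fix a m assume "m \<in> mons (f u a)"
  then have "m \<in> mons (\<Sum>b\<in>B. u b * f (unitv b) a)"
    by (simp only: rlinear_coord_expand[OF gmapD(1)[OF f] u(1,2)])
  from mons_sum[OF this] obtain b where b: "b \<in> B" "m \<in> mons (u b * f (unitv b) a)"
    by (elim bexE)
  from b(2) obtain m1 m2 where m: "m1 \<in> mons (u b)" "m2 \<in> mons (f (unitv b) a)" "m = m1 + m2"
    by (rule keys_mult_obtain)
  have "mon_degree m1 + d b = e" using u(3) m(1) by (simp add: homog_def)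
  moreover have "mon_degree m2 + d' a = d b"
    using gmapD(3)[OF f b(1)] m(2) by (simp add: homog_def)
  ultimately show "mon_degree m + d' a = e" using m(3) by simp
qed

lemma gmap_comp:
  assumes "gmap V B d B' d' f" "gmap V B' d' B'' d'' g" "finite B'"
  shows "gmap V B d B'' d'' (\<lambda>u. g (f u))"
  using assms gmap_fmod[OF assms(2,3)] gmap_homog[OF assms(2) _ assms(3)]
  unfolding gmap_def by (simp add: rlinear_comp)

text \<open>
  The component of degree \<open>e\<close> of any preimage is again a preimage, since \<open>f\<close> has degree 0.
\<close>

lemma homogeneous_preimage:
  assumes f: "gmap V B d B' d' f" and u: "u \<in> fmod V B" "finite B" and e: "homog d' e (f u)"
  shows "\<exists>u'\<in>fmod V B. homog d e u' \<and> f u' = f u"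
proof (intro bexI conjI)
  define u' where "u' = (\<lambda>b. mon_part (\<lambda>m. mon_degree m + d b = e) (u b))"
  show u': "u' \<in> fmod V B"
    using u(1) by (auto simp: u'_def fmod_def)
  show "homog d e u'"
    by (auto simp: u'_def homog_def)
  show "f u' = f u"
  proof
    fix a
    let ?Q = "\<lambda>m. mon_degree m + d' a = e"
    have "f u' a = (\<Sum>b\<in>B. f (unitv b) a * mon_part (\<lambda>m. mon_degree m + d b = e) (u b))"
      unfolding rlinear_coord_expand[OF gmapD(1)[OF f] u' u(2)]
      by (simp add: u'_def mult.commute)
    also have "\<dots> = (\<Sum>b\<in>B. mon_part ?Q (f (unitv b) a * u b))"
    proof (rule sum.cong[OF refl], rule mon_part_mult[symmetric])
      fix b m m' assume "b \<in> B" "m \<in> mons (f (unitv b) a)"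
      then have "mon_degree m + d' a = d b"
        using gmapD(3)[OF f] by (simp add: homog_def)
      then show "?Q (m + m') \<longleftrightarrow> mon_degree m' + d b = e" by auto
    qed
    also have "\<dots> = mon_part ?Q (f u a)"
      unfolding rlinear_coord_expand[OF gmapD(1)[OF f] u(1,2)]
      by (simp add: mon_part_sum mult.commute)
    also have "\<dots> = f u a"
      using e by (intro mon_part_id) (auto simp: homog_def)
    finally show "f u' a = f u a" .
  qed
qed

section \<open>Graded free resolutions and their comparison\<close>

text \<open>
  A graded free resolution of \<open>R/I\<close>. The module in position 0 is \<open>R\<close> itself, with basis
  \<open>{o0}\<close>, so the module in position \<open>Suc i\<close> is the \<open>i\<close>-th module of a resolution of \<open>I\<close>.
  With this shift the augmentation is an ordinary differential \<open>\<Delta> 0\<close>, and the statements about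
  chain maps and exactness have no separate case for it.
\<close>

locale graded_resolution =
  fixes V :: "'v set" and I :: "('v, 'k::field) mpoly set" and o0 :: 'b
    and B :: "nat \<Rightarrow> 'b set" and d :: "nat \<Rightarrow> 'b \<Rightarrow> nat"
    and \<Delta> :: "nat \<Rightarrow> ('b \<Rightarrow> ('v, 'k) mpoly) \<Rightarrow> 'b \<Rightarrow> ('v, 'k) mpoly"
  assumes finite_B: "finite (B i)"
    and B_0: "B 0 = {o0}" and d_0: "d 0 o0 = 0"
    and gmap: "gmap V (B (Suc i)) (d (Suc i)) (B i) (d i) (\<Delta> i)"
    and image: "(\<lambda>u. \<Delta> 0 u o0) ` fmod V (B (Suc 0)) = I"
    and exact: "u \<in> fmod V (B (Suc i)) \<Longrightarrow>
      \<Delta> i u = 0 \<longleftrightarrow> (\<exists>w\<in>fmod V (B (Suc (Suc i))). u = \<Delta> (Suc i) w)"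
begin

lemma lin: "rlinear (\<Delta> i)"
  using gmap by (rule gmapD)

lemma differential_fmod: "u \<in> fmod V (B (Suc i)) \<Longrightarrow> \<Delta> i u \<in> fmod V (B i)"
  using gmap finite_B by (rule gmap_fmod)

lemma complex: "w \<in> fmod V (B (Suc (Suc i))) \<Longrightarrow> \<Delta> i (\<Delta> (Suc i) w) = 0"
  using exact[of "\<Delta> (Suc i) w" i] differential_fmod by auto

lemma exactE:
  assumes "u \<in> fmod V (B (Suc i))" "\<Delta> i u = 0"
  obtains w where "w \<in> fmod V (B (Suc (Suc i)))" "u = \<Delta> (Suc i) w"
  using assms exact by auto

lemma fmod_B_0: "u \<in> fmod V (B 0) \<Longrightarrow> u = smul (u o0) (unitv o0)"
  by (auto simp: B_0 fmod_def unitv_def fun_eq_iff)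

lemma differential_0: "u \<in> fmod V (B (Suc 0)) \<Longrightarrow> \<Delta> 0 u = smul (\<Delta> 0 u o0) (unitv o0)"
  using fmod_B_0[OF differential_fmod] .

lemma lift_through_differential:
  assumes C: "finite C"
    and t: "\<And>c. c \<in> C \<Longrightarrow> \<exists>w\<in>fmod V (B (Suc i)). t c = \<Delta> i w"
    and e: "\<And>c. c \<in> C \<Longrightarrow> homog (d i) (e c) (t c)"
  shows "\<exists>f. gmap V C e (B (Suc i)) (d (Suc i)) f \<and> (\<forall>c\<in>C. \<Delta> i (f (unitv c)) = t c)"
proof -
  have "\<exists>w\<in>fmod V (B (Suc i)). homog (d (Suc i)) (e c) w \<and> \<Delta> i w = t c" if "c \<in> C" for c
  proof -
    from t[OF that] obtain w where "w \<in> fmod V (B (Suc i))" "t c = \<Delta> i w" by blast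
    then show ?thesis
      using homogeneous_preimage[OF gmap _ finite_B, of w i "e c"] e[OF that] by simp
  qed
  then obtain w where w: "\<And>c. c \<in> C \<Longrightarrow> w c \<in> fmod V (B (Suc i)) \<and>
      homog (d (Suc i)) (e c) (w c) \<and> \<Delta> i (w c) = t c" by metis
  obtain f where "rlinear f" "\<And>c. c \<in> C \<Longrightarrow> f (unitv c) = w c"
    using exists_rlinear[OF C, of w] by blast
  with w show ?thesis by (intro exI[of _ f]) (auto simp: gmap_def)
qed

end

definition chain_map where
  "chain_map V B d \<Delta> B' d' \<Delta>' f \<longleftrightarrow>
     (\<forall>i. gmap V (B i) (d i) (B' i) (d' i) (f i)) \<and>
     (\<forall>i. \<forall>u\<in>fmod V (B (Suc i)). f i (\<Delta> i u) = \<Delta>' i (f (Suc i) u))"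

text \<open>
  Free modules are projective, so the identity of \<open>R\<close> lifts degree by degree to a map of
  resolutions as soon as it maps \<open>I\<close> into \<open>I'\<close>. For the recursion, \<open>good n f\<close> records that the
  composite with the next differential has its columns in the image of \<open>\<Delta>' n\<close>, which is what allows
  the next step.
\<close>

lemma chain_map_lifting:
  fixes I I' :: "('v, 'k::field) mpoly set" and o0 :: 'b and o0' :: 'c
  assumes P: "graded_resolution V I o0 B d \<Delta>" and Q: "graded_resolution V I' o0' B' d' \<Delta>'"
    and sub: "I \<subseteq> I'"
  shows "\<exists>f. chain_map V B d \<Delta> B' d' \<Delta>' f \<and> f 0 (unitv o0) = unitv o0'"
proof -
  interpret P: graded_resolution V I o0 B d \<Delta> by (rule P)
  interpret Q: graded_resolution V I' o0' B' d' \<Delta>' by (rule Q)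
  define good where "good n f \<longleftrightarrow> gmap V (B n) (d n) (B' n) (d' n) f \<and>
    (\<forall>b\<in>B (Suc n). \<exists>w\<in>fmod V (B' (Suc n)). f (\<Delta> n (unitv b)) = \<Delta>' n w) \<and>
    (n = 0 \<longrightarrow> f (unitv o0) = unitv o0')"
    for n and f :: "('b \<Rightarrow> ('v, 'k) mpoly) \<Rightarrow> 'c \<Rightarrow> ('v, 'k) mpoly"
  define next' where "next' n f g \<longleftrightarrow> (\<forall>b\<in>B (Suc n). f (\<Delta> n (unitv b)) = \<Delta>' n (g (unitv b)))"
    for n and f g :: "('b \<Rightarrow> ('v, 'k) mpoly) \<Rightarrow> 'c \<Rightarrow> ('v, 'k) mpoly"
  have comm: "f (\<Delta> n u) = \<Delta>' n (g u)"
    if "good n f" "gmap V (B (Suc n)) (d (Suc n)) (B' (Suc n)) (d' (Suc n)) g" "next' n f g" "u \<in> fmod V (B (Suc n))" for n f g u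
  proof (rule rlinear_ext[OF _ _ that(4) P.finite_B])
    show "rlinear (\<lambda>u. f (\<Delta> n u))"
      using that(1) by (intro rlinear_comp[OF _ P.lin]) (simp add: good_def gmap_def)
    show "rlinear (\<lambda>u. \<Delta>' n (g u))"
      using that(2) by (intro rlinear_comp[OF Q.lin]) (simp add: gmap_def)
    show "f (\<Delta> n (unitv b)) = \<Delta>' n (g (unitv b))" if "b \<in> B (Suc n)" for b
      using \<open>next' n f g\<close> that by (simp add: next'_def)
  qed
  have "\<exists>f. \<forall>n. good n (f n) \<and> next' n (f n) (f (Suc n))"
  proof (rule dependent_nat_choice)
    obtain f :: "('b \<Rightarrow> ('v, 'k) mpoly) \<Rightarrow> 'c \<Rightarrow> ('v, 'k) mpoly" where f: "rlinear f" "f (unitv o0) = unitv o0'"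
      using exists_rlinear[of "{o0}" "\<lambda>_. unitv o0'"] by auto
    have "\<exists>w\<in>fmod V (B' (Suc 0)). f (\<Delta> 0 (unitv b)) = \<Delta>' 0 w" if b: "b \<in> B (Suc 0)" for b
    proof -
      have "\<Delta> 0 (unitv b) o0 \<in> (\<lambda>u. \<Delta> 0 u o0) ` fmod V (B (Suc 0))"
        using fmod_unitv[OF b] by (rule imageI)
      then have "\<Delta> 0 (unitv b) o0 \<in> I'" using P.image sub by blast
      then obtain w where w: "w \<in> fmod V (B' (Suc 0))" "\<Delta> 0 (unitv b) o0 = \<Delta>' 0 w o0'"
        unfolding Q.image[symmetric] by blast
      have "f (\<Delta> 0 (unitv b)) = f (smul (\<Delta> 0 (unitv b) o0) (unitv o0))"
        using arg_cong[OF P.differential_0[OF fmod_unitv[OF b]], of f] .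
      also have "\<dots> = \<Delta>' 0 w"
        using Q.differential_0[OF w(1)] w(2) by (simp add: rlinear_smul[OF f(1)] f(2))
      finally show ?thesis using w(1) by blast
    qed
    then have "good 0 f"
      unfolding good_def gmap_def
      using f homog_unitv[of "d' 0" o0'] by (auto simp: P.B_0 Q.B_0 P.d_0 Q.d_0)
    then show "\<exists>f. good 0 f" by blast
  next
    fix f n assume f: "good n f"
    have "\<exists>g. gmap V (B (Suc n)) (d (Suc n)) (B' (Suc n)) (d' (Suc n)) g \<and>
        (\<forall>b\<in>B (Suc n). \<Delta>' n (g (unitv b)) = f (\<Delta> n (unitv b)))"
    proof (rule Q.lift_through_differential[OF P.finite_B])
      fix b assume b: "b \<in> B (Suc n)"
      show "\<exists>w\<in>fmod V (B' (Suc n)). f (\<Delta> n (unitv b)) = \<Delta>' n w"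
        using f b by (auto simp: good_def)
      show "homog (d' n) (d (Suc n) b) (f (\<Delta> n (unitv b)))"
        using f b by (intro gmap_homog[of V "B n" "d n" "B' n"] P.differential_fmod P.finite_B
            gmapD(3)[OF P.gmap]) (auto simp: good_def)
    qed
    then obtain g where g: "gmap V (B (Suc n)) (d (Suc n)) (B' (Suc n)) (d' (Suc n)) g"
      "next' n f g" by (auto simp: next'_def)
    note cm = comm[OF f g]
    have "\<exists>w\<in>fmod V (B' (Suc (Suc n))). g (\<Delta> (Suc n) (unitv b)) = \<Delta>' (Suc n) w"
      if b: "b \<in> B (Suc (Suc n))" for b
    proof -
      have db: "\<Delta> (Suc n) (unitv b) \<in> fmod V (B (Suc n))"
        using b by (intro P.differential_fmod) simp
      have "\<Delta>' n (g (\<Delta> (Suc n) (unitv b))) = f (\<Delta> n (\<Delta> (Suc n) (unitv b)))"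
        using cm[OF db] by simp
      also have "\<dots> = 0"
        unfolding P.complex[OF fmod_unitv[OF b]]
        using f by (intro rlinear_zero) (simp add: good_def gmap_def)
      finally show ?thesis
        using Q.exact[OF gmap_fmod[OF g(1) P.finite_B db]] by blast
    qed
    with g have "good (Suc n) g" by (simp add: good_def)
    with g(2) show "\<exists>g. good (Suc n) g \<and> next' n f g" by blast
  qed
  then obtain f where f: "\<And>n. good n (f n)" "\<And>n. next' n (f n) (f (Suc n))" by blast
  then show ?thesis
    unfolding chain_map_def using comm[OF f(1) _ f(2)]
    by (intro exI[of _ f]) (simp add: good_def)
qed

text \<open>
  The augmentation \<open>\<Delta> 0\<close> is exempt: for the unit ideal its entry is a unit.
\<close>

definition minimal_differentials where
  "minimal_differentials B \<Delta> \<longleftrightarrow>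
     (\<forall>i. \<forall>b\<in>B (Suc (Suc i)). \<forall>a. cf (\<Delta> (Suc i) (unitv b) a) 0 = 0)"

text \<open>
  The homotopy is built as the chain map was. In each step the map \<open>f (Suc n) - s \<circ> \<Delta> n\<close> has its image
  in the kernel of \<open>\<Delta> n\<close>, hence factors through \<open>\<Delta> (Suc n)\<close>. The step at position 0 succeeds with
  \<open>s 0 = 0\<close>, and this vanishing is needed later because \<open>\<Delta> 0\<close> may have a unit entry.
\<close>

lemma chain_endomorphism_nullhomotopic:
  fixes I :: "('v, 'k::field) mpoly set" and o0 :: 'b
  assumes P: "graded_resolution V I o0 B d \<Delta>"
    and f: "chain_map V B d \<Delta> B d \<Delta> f" "f 0 (unitv o0) = 0"
  shows "\<exists>s. (\<forall>i. gmap V (B i) (d i) (B (Suc i)) (d (Suc i)) (s i)) \<and> s 0 = (\<lambda>u. 0) \<and>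
    (\<forall>i. \<forall>u\<in>fmod V (B (Suc i)). f (Suc i) u = s i (\<Delta> i u) + \<Delta> (Suc i) (s (Suc i) u))"
proof -
  interpret P: graded_resolution V I o0 B d \<Delta> by (rule P)
  have fg: "gmap V (B i) (d i) (B i) (d i) (f i)" for i
    using f(1) by (simp add: chain_map_def)
  have fc: "u \<in> fmod V (B (Suc i)) \<Longrightarrow> f i (\<Delta> i u) = \<Delta> i (f (Suc i) u)" for u i
    using f(1) by (simp add: chain_map_def)
  define good where "good n s \<longleftrightarrow> gmap V (B n) (d n) (B (Suc n)) (d (Suc n)) s \<and>
    (\<forall>u\<in>fmod V (B (Suc n)). \<Delta> n (f (Suc n) u - s (\<Delta> n u)) = 0) \<and>
    (n = 0 \<longrightarrow> s = (\<lambda>u. 0))"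
    for n and s :: "('b \<Rightarrow> ('v, 'k) mpoly) \<Rightarrow> 'b \<Rightarrow> ('v, 'k) mpoly"
  define next' where "next' n s s' \<longleftrightarrow> (\<forall>u\<in>fmod V (B (Suc n)).
    f (Suc n) u = s (\<Delta> n u) + \<Delta> (Suc n) (s' u))"
    for n and s s' :: "('b \<Rightarrow> ('v, 'k) mpoly) \<Rightarrow> 'b \<Rightarrow> ('v, 'k) mpoly"
  have "\<exists>s. \<forall>n. good n (s n) \<and> next' n (s n) (s (Suc n))"
  proof (rule dependent_nat_choice)
    have "\<Delta> 0 (f (Suc 0) u) = 0" if u: "u \<in> fmod V (B (Suc 0))" for u
    proof -
      have "f 0 (\<Delta> 0 u) = f 0 (smul (\<Delta> 0 u o0) (unitv o0))"
        using arg_cong[OF P.differential_0[OF u], of "f 0"] .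
      then show ?thesis
        using fc[OF u] f(2) by (simp add: rlinear_smul[OF gmapD(1)[OF fg]])
    qed
    then have "good 0 (\<lambda>u. 0)"
      by (simp add: good_def gmap_def rlinear_const_zero homog_zero)
    then show "\<exists>s. good 0 s" by blast
  next
    fix s n assume s: "good n s"
    then have sg: "gmap V (B n) (d n) (B (Suc n)) (d (Suc n)) s" by (simp add: good_def)
    let ?t = "\<lambda>u. f (Suc n) u - s (\<Delta> n u)"
    have sz: "\<Delta> n (?t u) = 0" if "u \<in> fmod V (B (Suc n))" for u
      using s that by (simp add: good_def)
    have sdg: "gmap V (B (Suc n)) (d (Suc n)) (B (Suc n)) (d (Suc n)) (\<lambda>u. s (\<Delta> n u))"
      by (rule gmap_comp[OF P.gmap sg P.finite_B])
    have tg: "gmap V (B (Suc n)) (d (Suc n)) (B (Suc n)) (d (Suc n)) ?t"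
      using fg[of "Suc n"] sdg by (auto simp: gmap_def rlinear_minus homog_diff)
    have "\<exists>s'. gmap V (B (Suc n)) (d (Suc n)) (B (Suc (Suc n))) (d (Suc (Suc n))) s' \<and>
        (\<forall>b\<in>B (Suc n). \<Delta> (Suc n) (s' (unitv b)) = ?t (unitv b))"
    proof (rule P.lift_through_differential[OF P.finite_B])
      fix b assume b: "b \<in> B (Suc n)"
      have "?t (unitv b) \<in> fmod V (B (Suc n))" using gmapD(2)[OF tg b] .
      moreover have "\<Delta> n (?t (unitv b)) = 0" by (rule sz[OF fmod_unitv[OF b]])
      ultimately show "\<exists>w\<in>fmod V (B (Suc (Suc n))). ?t (unitv b) = \<Delta> (Suc n) w"
        using P.exact by blast
      show "homog (d (Suc n)) (d (Suc n) b) (?t (unitv b))" using gmapD(3)[OF tg b] .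
    qed
    then obtain s' where s': "gmap V (B (Suc n)) (d (Suc n)) (B (Suc (Suc n))) (d (Suc (Suc n))) s'"
      "\<And>b. b \<in> B (Suc n) \<Longrightarrow> \<Delta> (Suc n) (s' (unitv b)) = ?t (unitv b)" by blast
    have eq: "\<Delta> (Suc n) (s' u) = ?t u" if "u \<in> fmod V (B (Suc n))" for u
    proof (rule rlinear_ext[OF _ gmapD(1)[OF tg] that P.finite_B])
      show "rlinear (\<lambda>u. \<Delta> (Suc n) (s' u))"
        by (rule rlinear_comp[OF P.lin gmapD(1)[OF s'(1)]])
    qed (rule s'(2))
    have n: "next' n s s'" using eq by (auto simp: next'_def)
    have "\<Delta> (Suc n) (f (Suc (Suc n)) u - s' (\<Delta> (Suc n) u)) = 0"
      if u: "u \<in> fmod V (B (Suc (Suc n)))" for u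
    proof -
      have du: "\<Delta> (Suc n) u \<in> fmod V (B (Suc n))" using P.differential_fmod[OF u] .
      have "\<Delta> (Suc n) (f (Suc (Suc n)) u - s' (\<Delta> (Suc n) u)) =
          f (Suc n) (\<Delta> (Suc n) u) - \<Delta> (Suc n) (s' (\<Delta> (Suc n) u))"
        using fc[OF u] by (simp add: rlinear_diff[OF P.lin])
      also have "\<dots> = s (\<Delta> n (\<Delta> (Suc n) u))" using eq[OF du] by simp
      also have "\<dots> = 0"
        unfolding P.complex[OF u] by (rule rlinear_zero[OF gmapD(1)[OF sg]])
      finally show ?thesis .
    qed
    with s'(1) have "good (Suc n) s'" by (simp add: good_def)
    with n show "\<exists>s'. good (Suc n) s' \<and> next' n s s'" by blast
  qed
  then obtain s where "\<And>n. good n (s n)" "\<And>n. next' n (s n) (s (Suc n))" by blast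
  then show ?thesis
    by (intro exI[of _ s]) (auto simp: good_def next'_def)
qed

lemma lookup_zero_rlinear:
  assumes "rlinear f" "u \<in> fmod V B" "finite B" "\<And>b. b \<in> B \<Longrightarrow> cf (u b) 0 = 0 \<or> cf (f (unitv b) a) 0 = 0"
  shows "cf (f u a) 0 = 0"
  unfolding rlinear_coord_expand[OF assms(1-3)] lookup_sum lookup_mult_zero
  using assms(4) by (auto intro!: sum.neutral)

text \<open>
  A minimal resolution is a direct summand of every other one. Only the following trace of this is
  used: every degree of a generator of the minimal resolution occurs in the same position of the
  other one. Lift the identity to chain maps \<open>f\<close> and \<open>g\<close> in both directions. Then \<open>g \<circ> f\<close> is
  homotopic to the identity, and the homotopy terms have zero constant terms by minimality. So the
  constant term of the diagonal entry of \<open>g \<circ> f\<close> at \<open>b\<close> is 1, and some entry of \<open>f\<close> in the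
  column \<open>b\<close> has a nonzero constant term. By homogeneity its row has the degree of \<open>b\<close>.
\<close>

theorem minimal_resolution_le:
  fixes I :: "('v, 'k::field) mpoly set" and o0 :: 'b and o0' :: 'c
  assumes P: "graded_resolution V I o0 B d \<Delta>" and Q: "graded_resolution V I o0' B' d' \<Delta>'"
    and min: "minimal_differentials B \<Delta>" and b: "b \<in> B (Suc n)"
  shows "\<exists>c\<in>B' (Suc n). d' (Suc n) c = d (Suc n) b"
proof -
  interpret P: graded_resolution V I o0 B d \<Delta> by (rule P)
  interpret Q: graded_resolution V I o0' B' d' \<Delta>' by (rule Q)
  obtain f where f: "chain_map V B d \<Delta> B' d' \<Delta>' f" "f 0 (unitv o0) = unitv o0'"
    using chain_map_lifting[OF P Q] by blast
  obtain g where g: "chain_map V B' d' \<Delta>' B d \<Delta> g" "g 0 (unitv o0') = unitv o0"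
    using chain_map_lifting[OF Q P] by blast
  have fg: "gmap V (B i) (d i) (B' i) (d' i) (f i)" for i
    using f(1) by (simp add: chain_map_def)
  have gg: "gmap V (B' i) (d' i) (B i) (d i) (g i)" for i
    using g(1) by (simp add: chain_map_def)
  have fc: "u \<in> fmod V (B (Suc i)) \<Longrightarrow> f i (\<Delta> i u) = \<Delta>' i (f (Suc i) u)" for u i
    using f(1) by (simp add: chain_map_def)
  have gc: "u \<in> fmod V (B' (Suc i)) \<Longrightarrow> g i (\<Delta>' i u) = \<Delta> i (g (Suc i) u)" for u i
    using g(1) by (simp add: chain_map_def)
  define h where "h i = (\<lambda>u. u - g i (f i u))" for i
  have gf: "gmap V (B i) (d i) (B i) (d i) (\<lambda>u. g i (f i u))" for i
    by (rule gmap_comp[OF fg gg Q.finite_B])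
  have "gmap V (B i) (d i) (B i) (d i) (h i)" for i
    using gf[of i] by (auto simp: gmap_def h_def rlinear_minus rlinear_id homog_diff homog_unitv)
  moreover have "h i (\<Delta> i u) = \<Delta> i (h (Suc i) u)" if u: "u \<in> fmod V (B (Suc i))" for i u
    using fc[OF u] gc[OF gmap_fmod[OF fg P.finite_B u]]
    by (simp add: h_def rlinear_diff[OF P.lin])
  ultimately have "chain_map V B d \<Delta> B d \<Delta> h" by (simp add: chain_map_def)
  moreover have "h 0 (unitv o0) = 0" by (simp add: h_def f(2) g(2))
  ultimately obtain s where
    s: "\<And>i. gmap V (B i) (d i) (B (Suc i)) (d (Suc i)) (s i)" "s 0 = (\<lambda>u. 0)" and
    hom: "\<And>i u. u \<in> fmod V (B (Suc i)) \<Longrightarrow> h (Suc i) u = s i (\<Delta> i u) + \<Delta> (Suc i) (s (Suc i) u)"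
    using chain_endomorphism_nullhomotopic[OF P] by metis
  have "cf (s n (\<Delta> n (unitv b)) b) 0 = 0"
  proof (cases n)
    case 0
    then show ?thesis by (simp add: s(2))
  next
    case (Suc k)
    have "cf (\<Delta> n (unitv b) a) 0 = 0" for a
      using min b Suc by (simp add: minimal_differentials_def)
    then show ?thesis
      using gmapD(1)[OF s(1)] P.finite_B P.differential_fmod[OF fmod_unitv[OF b]]
      by (intro lookup_zero_rlinear[of "s n" _ V "B n"]) auto
  qed
  moreover have "cf (\<Delta> (Suc n) (s (Suc n) (unitv b)) b) 0 = 0"
    using min P.finite_B gmapD(2)[OF s(1) b]
    by (intro lookup_zero_rlinear[OF P.lin]) (auto simp: minimal_differentials_def)
  ultimately have "cf (h (Suc n) (unitv b) b) 0 = 0"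
    using hom[OF fmod_unitv[OF b]] by (simp add: lookup_add)
  then have "cf (g (Suc n) (f (Suc n) (unitv b)) b) 0 = 1"
    by (simp add: h_def lookup_minus unitv_apply)
  then have "\<exists>c\<in>B' (Suc n). cf (f (Suc n) (unitv b) c) 0 \<noteq> 0"
    using lookup_zero_rlinear[OF gmapD(1)[OF gg] gmapD(2)[OF fg b] Q.finite_B, where a = b]
    by (metis zero_neq_one)
  then obtain c where c: "c \<in> B' (Suc n)" "0 \<in> mons (f (Suc n) (unitv b) c)"
    by (auto simp: in_keys_iff)
  then have "mon_degree (0 :: 'v \<Rightarrow>\<^sub>0 nat) + d' (Suc n) c = d (Suc n) b"
    using gmapD(3)[OF fg b] unfolding homog_def by blast
  with c(1) show ?thesis by auto
qed

section \<open>A lower bound for the length of a resolution\<close>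

definition var_multiples :: "'v set \<Rightarrow> ('b \<Rightarrow> ('v, 'k::field) mpoly) set" where
  "var_multiples A = {u. \<forall>b. \<forall>m\<in>mons (u b). mons m \<inter> A \<noteq> {}}"

lemma var_multiples_zero: "0 \<in> var_multiples A"
  by (simp add: var_multiples_def)

lemma var_multiples_add:
  assumes "u \<in> var_multiples A" "v \<in> var_multiples A"
  shows "u + v \<in> var_multiples A"
proof -
  have "mons m \<inter> A \<noteq> {}" if "m \<in> mons (u b + v b)" for b m
  proof -
    have "m \<in> mons (u b) \<or> m \<in> mons (v b)"
      using that keys_add[of "u b" "v b"] by blast
    then show ?thesis using assms unfolding var_multiples_def by blast
  qed
  then show ?thesis by (simp add: var_multiples_def)
qed

lemma var_multiples_smul:
  assumes "u \<in> var_multiples A"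
  shows "smul p u \<in> var_multiples A"
proof -
  have "mons m \<inter> A \<noteq> {}" if m: "m \<in> mons (p * u b)" for b m
  proof -
    obtain m1 m2 where "m2 \<in> mons (u b)" "m = m1 + m2"
      using m by (rule keys_mult_obtain)
    moreover from this have "mons m2 \<inter> A \<noteq> {}"
      using assms unfolding var_multiples_def by blast
    ultimately show ?thesis by (auto simp: keys_add_nat)
  qed
  then show ?thesis by (simp add: var_multiples_def)
qed

lemma var_multiples_uminus: "u \<in> var_multiples A \<Longrightarrow> - u \<in> var_multiples A"
  using var_multiples_smul[of u A "- 1"] by simp

lemma var_multiples_diff: "u \<in> var_multiples A \<Longrightarrow> v \<in> var_multiples A \<Longrightarrow> u - v \<in> var_multiples A"
  using var_multiples_add[of u A "- v"] var_multiples_uminus[of v A] by simp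

lemma var_multiples_mono: "A \<subseteq> A' \<Longrightarrow> u \<in> var_multiples A \<Longrightarrow> u \<in> var_multiples A'"
  unfolding var_multiples_def by blast

lemma var_multiples_var: "v \<in> A \<Longrightarrow> smul (var v) u \<in> var_multiples A"
  by (auto simp: var_multiples_def mons_var_mult keys_add_nat)

lemma var_multiples_empty: "u \<in> var_multiples {} \<Longrightarrow> u = 0"
  by (auto simp: var_multiples_def fun_eq_iff)

lemma var_multiples_cancel:
  assumes "smul (var v) u \<in> var_multiples A" "v \<notin> A"
  shows "u \<in> var_multiples A"
  using assms by (auto simp: var_multiples_def mons_var_mult keys_add_nat)

lemma var_multiples_split:
  assumes u: "u \<in> fmod V B" "u \<in> var_multiples (insert v A)"
  shows "\<exists>w\<in>fmod V B. \<exists>t\<in>fmod V B \<inter> var_multiples A. u = smul (var v) w + t"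
proof -
  define t where "t = (\<lambda>b. mon_part (\<lambda>m. mons m \<inter> A \<noteq> {}) (u b))"
  have "\<exists>r\<in>PR V. mon_part (\<lambda>m. \<not> mons m \<inter> A \<noteq> {}) (u b) = var v * r" for b
  proof (rule divide_var)
    show "mon_part (\<lambda>m. \<not> mons m \<inter> A \<noteq> {}) (u b) \<in> PR V"
      by (intro mon_part_PR fmod_coord_PR[OF u(1)])
    show "v \<in> mons m" if "m \<in> mons (mon_part (\<lambda>m. \<not> mons m \<inter> A \<noteq> {}) (u b))" for m
      using that u(2) by (auto simp: var_multiples_def)
  qed
  then obtain r where r: "\<And>b. r b \<in> PR V"
    "\<And>b. mon_part (\<lambda>m. \<not> mons m \<inter> A \<noteq> {}) (u b) = var v * r b" by metis
  define w where "w b = (if b \<in> B then r b else 0)" for b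
  have ut: "u b = var v * w b + t b" for b
  proof (cases "b \<in> B")
    case True
    have "u b = t b + mon_part (\<lambda>m. \<not> mons m \<inter> A \<noteq> {}) (u b)"
      unfolding t_def by (rule mon_part_split)
    then show ?thesis unfolding r(2) using True by (simp add: w_def add.commute)
  next
    case False
    then show ?thesis using fmod_outside[OF u(1)] by (simp add: t_def w_def)
  qed
  have "w \<in> fmod V B" using r(1) by (auto simp: w_def fmod_def)
  moreover have "t \<in> fmod V B" using u(1) by (auto simp: t_def fmod_def)
  moreover have "t \<in> var_multiples A" by (auto simp: t_def var_multiples_def)
  moreover have "u = smul (var v) w + t" using ut by (simp add: fun_eq_iff)
  ultimately show ?thesis by blast
qed

lemma rlinear_var_multiples:
  assumes "rlinear f" "u \<in> fmod V B" "finite B" "u \<in> var_multiples A"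
  shows "f u \<in> var_multiples A"
proof -
  have "smul (u b) (f (unitv b)) \<in> var_multiples A" for b
  proof -
    have "mons m \<inter> A \<noteq> {}" if m: "m \<in> mons (u b * f (unitv b) a)" for m a
    proof -
      obtain m1 m2 where "m1 \<in> mons (u b)" "m = m1 + m2"
        using m by (rule keys_mult_obtain)
      moreover from this have "mons m1 \<inter> A \<noteq> {}"
        using assms(4) unfolding var_multiples_def by blast
      ultimately show ?thesis by (auto simp: keys_add_nat)
    qed
    then show ?thesis by (simp add: var_multiples_def)
  qed
  note sm = this
  have "(\<Sum>b\<in>S. smul (u b) (f (unitv b))) \<in> var_multiples A" if "finite S" for S
    using that
  proof (induction S)
    case empty
    then show ?case by (simp only: sum.empty var_multiples_zero)
  next
    case (insert b S)
    then show ?case by (simp only: sum.insert not_False_eq_True var_multiples_add sm)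
  qed
  then show ?thesis
    unfolding rlinear_expand[OF assms(1-3)] using assms(3) by blast
qed

context graded_resolution
begin

text \<open>
  This is \<open>Tor\<^sub>i\<^sub>+\<^sub>1(R/I, R/(x\<^sub>v : v \<in> A)) = 0\<close> for \<open>card A \<le> i\<close>. The induction adds one
  variable at a time; each variable is a nonzerodivisor modulo the previous ones
  (\<open>var_multiples_cancel\<close>).
\<close>

lemma tor_vanishing:
  assumes "finite A" "A \<subseteq> V" "card A \<le> i" "u \<in> fmod V (B (Suc i))" "\<Delta> i u \<in> var_multiples A"
  shows "\<exists>w\<in>fmod V (B (Suc (Suc i))). u - \<Delta> (Suc i) w \<in> var_multiples A"
  using assms
proof (induction A arbitrary: i u rule: finite_induct)
  case empty
  then obtain w where "w \<in> fmod V (B (Suc (Suc i)))" "u = \<Delta> (Suc i) w"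
    using exactE[OF empty(3) var_multiples_empty[OF empty(4)]] by blast
  moreover from this have "u - \<Delta> (Suc i) w \<in> var_multiples {}"
    by (simp add: var_multiples_zero)
  ultimately show ?case by blast
next
  case (insert v A)
  from insert.prems insert.hyps obtain j where j: "i = Suc j" "card A \<le> j"
    by (cases i) auto
  have v: "v \<in> V" "A \<subseteq> V" using insert.prems by auto
  let ?x = "var v :: ('v, 'k) mpoly"
  have x: "?x \<in> PR V" using v(1) by simp
  obtain w t where wt: "w \<in> fmod V (B i)" "t \<in> fmod V (B i)" "t \<in> var_multiples A"
      "\<Delta> i u = smul ?x w + t"
    using var_multiples_split[OF differential_fmod[OF insert.prems(3)] insert.prems(4)] by blast
  have "smul ?x (\<Delta> j w) + \<Delta> j t = 0"
    using complex[of u j] insert.prems(3) wt(4)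
    by (simp add: j rlinear_add[OF lin, symmetric] rlinear_smul[OF lin, symmetric])
  then have "smul ?x (\<Delta> j w) = - \<Delta> j t" by (rule eq_neg_iff_add_eq_0[THEN iffD2])
  moreover have "\<Delta> j t \<in> var_multiples A"
    by (rule rlinear_var_multiples[OF lin wt(2)[unfolded j(1)] finite_B wt(3)])
  ultimately have "smul ?x (\<Delta> j w) \<in> var_multiples A"
    by (simp only: var_multiples_uminus)
  then have dw: "\<Delta> j w \<in> var_multiples A"
    by (rule var_multiples_cancel[OF _ insert.hyps(2)])
  \<comment> \<open>The coefficient of the new variable is a cycle modulo the old ones, hence a boundary modulo them.\<close>
  obtain s where s: "s \<in> fmod V (B (Suc i))" "w - \<Delta> i s \<in> var_multiples A"
    using insert.IH[OF v(2) j(2) wt(1)[unfolded j(1)] dw] unfolding j(1) by blast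
  let ?u = "u - smul ?x s"
  have u': "?u \<in> fmod V (B (Suc i))" using insert.prems(3) s(1) x by simp
  have "\<Delta> i ?u = smul ?x (w - \<Delta> i s) + t"
    by (simp add: rlinear_diff[OF lin] rlinear_smul[OF lin] wt(4) smul_add)
  then have du: "\<Delta> i ?u \<in> var_multiples A"
    by (simp only: var_multiples_add[OF var_multiples_smul[OF s(2)] wt(3)])
  have "card A \<le> i" using j by simp
  then obtain w' where w': "w' \<in> fmod V (B (Suc (Suc i)))" "?u - \<Delta> (Suc i) w' \<in> var_multiples A"
    using insert.IH[OF v(2) _ u' du] by blast
  have "?u - \<Delta> (Suc i) w' + smul ?x s \<in> var_multiples (insert v A)"
    by (intro var_multiples_add var_multiples_var var_multiples_mono[OF _ w'(2)]) auto
  moreover have "?u - \<Delta> (Suc i) w' + smul ?x s = u - \<Delta> (Suc i) w'" by simp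
  ultimately have "u - \<Delta> (Suc i) w' \<in> var_multiples (insert v A)" by (simp only:)
  then show ?case using w'(1) by blast
qed

text \<open>
  An element \<open>y \<notin> I\<close> that is annihilated by the variables in \<open>C\<close> modulo \<open>I\<close> yields a nonzero
  class in \<open>Tor\<^sub>a(R/I, R/(x\<^sub>v : v \<in> A))\<close> for \<open>a = card A\<close> and every \<open>A \<subseteq> C\<close>. The class for
  \<open>insert v A\<close> is obtained from the class \<open>z\<close> for \<open>A\<close> through the connecting map: as
  \<open>x\<^sub>v z\<close> bounds modulo the variables in \<open>A\<close>, say \<open>x\<^sub>v z = \<Delta> w\<close>, the new class is that of \<open>w\<close>.
  To repeat the step, the class has to be annihilated by all variables in \<open>C\<close> as well; this
  is the second half of the statement.
\<close>

lemma socle_element_propagates: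
  assumes y: "y \<in> PR V" "y \<notin> I" "\<And>v. v \<in> C \<Longrightarrow> var v * y \<in> I" and C: "C \<subseteq> V"
    and A: "finite A" "A \<subseteq> C"
  shows "\<exists>z\<in>fmod V (B (card A)).
    \<not> (\<exists>w\<in>fmod V (B (Suc (card A))). z - \<Delta> (card A) w \<in> var_multiples A) \<and>
    (\<forall>v\<in>C. \<exists>w\<in>fmod V (B (Suc (card A))). smul (var v) z - \<Delta> (card A) w \<in> var_multiples A)"
  using A
proof (induction A rule: finite_induct)
  case empty
  let ?z = "smul y (unitv o0)"
  have z: "?z \<in> fmod V (B 0)" using y(1) by (simp add: B_0)
  have "\<not> (\<exists>w\<in>fmod V (B (Suc 0)). ?z - \<Delta> 0 w \<in> var_multiples {})"
  proof
    assume "\<exists>w\<in>fmod V (B (Suc 0)). ?z - \<Delta> 0 w \<in> var_multiples {}"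
    then obtain w where w: "w \<in> fmod V (B (Suc 0))" "?z - \<Delta> 0 w = 0"
      using var_multiples_empty by blast
    have "y = ?z o0" by (simp add: unitv_apply)
    also have "\<dots> = \<Delta> 0 w o0" using w(2) by simp
    finally show False using w(1) y(2) image by blast
  qed
  moreover have "\<exists>w\<in>fmod V (B (Suc 0)). smul (var v) ?z - \<Delta> 0 w \<in> var_multiples {}" if v: "v \<in> C" for v
  proof -
    obtain w where w: "w \<in> fmod V (B (Suc 0))" "var v * y = \<Delta> 0 w o0"
      using y(3)[OF v] unfolding image[symmetric] by blast
    have "\<Delta> 0 w = smul (var v * y) (unitv o0)"
      using differential_0[OF w(1)] unfolding w(2)[symmetric] .
    then have "smul (var v) ?z - \<Delta> 0 w = 0" by simp
    then have "smul (var v) ?z - \<Delta> 0 w \<in> var_multiples {}"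
      by (simp only: var_multiples_zero)
    then show ?thesis using w(1) by blast
  qed
  ultimately show ?case unfolding card.empty using z by blast
next
  case (insert v A)
  let ?n = "card A" and ?x = "var v :: ('v, 'k) mpoly"
  have n: "card (insert v A) = Suc ?n" using insert.hyps by simp
  have v: "v \<in> C" "v \<in> V" "A \<subseteq> V" using insert.prems C by auto
  have x: "?x \<in> PR V" using v(2) by simp
  have mono: "u \<in> var_multiples (insert v A)" if "u \<in> var_multiples A"
    for u :: "'b \<Rightarrow> ('v, 'k) mpoly"
    using that by (rule var_multiples_mono[rotated]) auto
  have "A \<subseteq> C" using insert.prems by blast
  from insert.IH[OF this] obtain z where z: "z \<in> fmod V (B ?n)"
    and nz: "\<And>w. w \<in> fmod V (B (Suc ?n)) \<Longrightarrow> z - \<Delta> ?n w \<notin> var_multiples A"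
    and cz: "\<And>v. v \<in> C \<Longrightarrow> \<exists>w\<in>fmod V (B (Suc ?n)). smul (var v) z - \<Delta> ?n w \<in> var_multiples A"
    by blast
  obtain w where w: "w \<in> fmod V (B (Suc ?n))" and t: "smul ?x z - \<Delta> ?n w \<in> var_multiples A"
    using cz[OF v(1)] by blast
  have 1: "w - \<Delta> (Suc ?n) s \<notin> var_multiples (insert v A)" if s: "s \<in> fmod V (B (Suc (Suc ?n)))" for s
  proof
    assume "w - \<Delta> (Suc ?n) s \<in> var_multiples (insert v A)"
    from var_multiples_split[OF fmod_diff[OF w differential_fmod[OF s]] this]
    obtain w' t' where w': "w' \<in> fmod V (B (Suc ?n))" "t' \<in> fmod V (B (Suc ?n))"
        "t' \<in> var_multiples A" "w - \<Delta> (Suc ?n) s = smul ?x w' + t'"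
      by blast
    have "\<Delta> ?n w = \<Delta> ?n (w - \<Delta> (Suc ?n) s)"
      by (simp add: rlinear_diff[OF lin] complex[OF s])
    also have "\<dots> = smul ?x (\<Delta> ?n w') + \<Delta> ?n t'"
      unfolding w'(4) by (simp add: rlinear_add[OF lin] rlinear_smul[OF lin])
    finally have "smul ?x (z - \<Delta> ?n w') = (smul ?x z - \<Delta> ?n w) + \<Delta> ?n t'"
      by (simp add: smul_add)
    moreover have "\<Delta> ?n t' \<in> var_multiples A"
      by (rule rlinear_var_multiples[OF lin w'(2) finite_B w'(3)])
    ultimately have "smul ?x (z - \<Delta> ?n w') \<in> var_multiples A"
      by (simp only: var_multiples_add[OF t])
    then show False
      using var_multiples_cancel[OF _ insert.hyps(2)] nz[OF w'(1)] by blast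
  qed
  have 2: "\<exists>s\<in>fmod V (B (Suc (Suc ?n))). smul (var v') w - \<Delta> (Suc ?n) s \<in> var_multiples (insert v A)"
    if v': "v' \<in> C" for v'
  proof -
    let ?y = "var v' :: ('v, 'k) mpoly"
    have y: "?y \<in> PR V" using v' C by auto
    obtain r where r: "r \<in> fmod V (B (Suc ?n))" "smul ?y z - \<Delta> ?n r \<in> var_multiples A"
      using cz[OF v'] by blast
    let ?u = "smul ?y w - smul ?x r"
    have u: "?u \<in> fmod V (B (Suc ?n))" using w r(1) x y by simp
    have "\<Delta> ?n ?u = smul ?x (smul ?y z - \<Delta> ?n r) - smul ?y (smul ?x z - \<Delta> ?n w)"
      by (simp add: rlinear_diff[OF lin] rlinear_smul[OF lin] smul_add mult.commute)
    then have "\<Delta> ?n ?u \<in> var_multiples A"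
      by (simp only: var_multiples_diff[OF var_multiples_smul[OF r(2)] var_multiples_smul[OF t]])
    then obtain s where s: "s \<in> fmod V (B (Suc (Suc ?n)))" "?u - \<Delta> (Suc ?n) s \<in> var_multiples A"
      using tor_vanishing[OF insert.hyps(1) v(3) order_refl u] by blast
    have "(?u - \<Delta> (Suc ?n) s) + smul ?x r \<in> var_multiples (insert v A)"
      by (intro var_multiples_add mono[OF s(2)] var_multiples_var) simp
    moreover have "(?u - \<Delta> (Suc ?n) s) + smul ?x r = smul ?y w - \<Delta> (Suc ?n) s" by simp
    ultimately have "smul ?y w - \<Delta> (Suc ?n) s \<in> var_multiples (insert v A)" by (simp only:)
    then show ?thesis using s(1) by blast
  qed
  show ?case
    unfolding n using w 1 2 by (intro bexI[of _ w]) blast+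
qed

text \<open>
  Classes in Tor are represented in the modules of the resolution, so a nonzero class in degree
  \<open>card C\<close> forces the module in that position to be nonzero.
\<close>

lemma length_ge_card_annihilator:
  assumes "y \<in> PR V" "y \<notin> I" "\<And>v. v \<in> C \<Longrightarrow> var v * y \<in> I" "C \<subseteq> V" "finite C"
  shows "B (card C) \<noteq> {}"
proof
  assume e: "B (card C) = {}"
  obtain z where z: "z \<in> fmod V (B (card C))"
    "\<And>w. w \<in> fmod V (B (Suc (card C))) \<Longrightarrow> z - \<Delta> (card C) w \<notin> var_multiples C"
    using socle_element_propagates[OF assms(1-4) assms(5) order_refl] by blast
  have "z = 0" using z(1) by (auto simp: e fmod_def fun_eq_iff)
  then have "z - \<Delta> (card C) 0 = 0" by (simp add: rlinear_zero[OF lin])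
  then show False using z(2)[OF fmod_zero] by (simp add: var_multiples_zero)
qed

text \<open>
  A minimal generator cannot be a combination of elements of \<open>I\<close> unless the generator itself
  occurs among their terms.
\<close>

lemma minimal_generator_degree:
  assumes I: "I = mon_ideal V F" and A: "A \<in> F" "finite A" "A \<subseteq> V"
    and min: "\<And>A'. A' \<in> F \<Longrightarrow> A' \<subseteq> A \<Longrightarrow> A' = A"
  shows "\<exists>b\<in>B (Suc 0). d (Suc 0) b = card A"
proof -
  let ?p = "Poly_Mapping.single (sq_mon A) 1 :: ('v, 'k) mpoly"
  have "?p \<in> I"
    using A by (auto simp: I mon_ideal_def mons_sq_mon)
  then obtain u where u: "u \<in> fmod V (B (Suc 0))" "?p = \<Delta> 0 u o0"
    unfolding image[symmetric] by blast
  have "sq_mon A \<in> mons ?p" by simp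
  then have "sq_mon A \<in> mons (\<Sum>b\<in>B (Suc 0). u b * \<Delta> 0 (unitv b) o0)"
    unfolding u(2) rlinear_coord_expand[OF lin u(1) finite_B] .
  from mons_sum[OF this] obtain b where b: "b \<in> B (Suc 0)" "sq_mon A \<in> mons (u b * \<Delta> 0 (unitv b) o0)"
    by (elim bexE)
  from b(2) obtain m1 m2 where m: "m2 \<in> mons (\<Delta> 0 (unitv b) o0)" "sq_mon A = m1 + m2"
    by (rule keys_mult_obtain)
  have "\<Delta> 0 (unitv b) o0 \<in> I"
    unfolding image[symmetric] using fmod_unitv[OF b(1)] by (rule imageI)
  then obtain A' where A': "A' \<in> F" "A' \<subseteq> mons m2"
    using m(1) unfolding I mon_ideal_def by blast
  have m2A: "mons m2 \<subseteq> A"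
    using mons_sq_mon[OF A(2)] unfolding m(2) keys_add_nat by blast
  then have "A \<subseteq> mons m2" using min[OF A'(1)] A'(2) by blast
  then have "(\<Sum>v\<in>A. 1) \<le> (\<Sum>v\<in>A. cf m2 v)"
    by (intro sum_mono) (auto simp: in_keys_iff Suc_le_eq)
  then have "card A \<le> mon_degree m2"
    using mon_degree_superset[OF A(2) m2A] by simp
  moreover have "card A = mon_degree m1 + mon_degree m2"
    using mon_degree_sq_mon[OF A(2)] unfolding m(2) by simp
  moreover have "mon_degree m2 + d 0 o0 = d (Suc 0) b"
    using gmapD(3)[OF gmap b(1)] m(1) unfolding homog_def by blast
  ultimately show ?thesis using b(1) d_0 by auto
qed

end

section \<open>The mapping cone of a splitting\<close>

definition cone_vec :: "('b \<Rightarrow> 'a) \<Rightarrow> ('c \<Rightarrow> 'a) \<Rightarrow> ('b \<Rightarrow> 'a) \<Rightarrow> 'b + 'c + 'b \<Rightarrow> 'a" where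
  "cone_vec p q r = case_sum p (case_sum q r)"

definition cone_fst where "cone_fst u = (\<lambda>b. u (Inl b))"
definition cone_mid where "cone_mid u = (\<lambda>c. u (Inr (Inl c)))"
definition cone_lst where "cone_lst u = (\<lambda>b. u (Inr (Inr b)))"

lemma cone_proj [simp]:
  "cone_fst (cone_vec p q r) = p" "cone_mid (cone_vec p q r) = q" "cone_lst (cone_vec p q r) = r"
  by (simp_all add: cone_fst_def cone_mid_def cone_lst_def cone_vec_def)

lemma cone_vec_eta: "u = cone_vec (cone_fst u) (cone_mid u) (cone_lst u)"
  unfolding cone_fst_def cone_mid_def cone_lst_def cone_vec_def
  by (auto simp: fun_eq_iff split: sum.split)

lemma cone_vec_eq_iff: "cone_vec p q r = cone_vec p' q' r' \<longleftrightarrow> p = p' \<and> q = q' \<and> r = r'"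
  using cone_proj by metis

lemma cone_vec_zero: "cone_vec 0 0 0 = 0"
  by (auto simp: cone_vec_def fun_eq_iff split: sum.split)

lemma cone_vec_add: "cone_vec p q r + cone_vec p' q' r' = cone_vec (p + p') (q + q') (r + r')"
  by (auto simp: cone_vec_def fun_eq_iff split: sum.split)

lemma cone_vec_smul: "smul c (cone_vec p q r) = cone_vec (smul c p) (smul c q) (smul c r)"
  by (auto simp: cone_vec_def fun_eq_iff split: sum.split)

lemma cone_proj_add:
  "cone_fst (u + v) = cone_fst u + cone_fst v" "cone_mid (u + v) = cone_mid u + cone_mid v"
  "cone_lst (u + v) = cone_lst u + cone_lst v"
  by (simp_all add: cone_fst_def cone_mid_def cone_lst_def fun_eq_iff)

lemma cone_proj_smul:
  "cone_fst (smul c u) = smul c (cone_fst u)" "cone_mid (smul c u) = smul c (cone_mid u)"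
  "cone_lst (smul c u) = smul c (cone_lst u)"
  by (simp_all add: cone_fst_def cone_mid_def cone_lst_def fun_eq_iff)

lemma fmod_iff: "u \<in> fmod V B \<longleftrightarrow> (\<forall>b. (b \<in> B \<longrightarrow> u b \<in> PR V) \<and> (b \<notin> B \<longrightarrow> u b = 0))"
  by (auto simp: fmod_def)

lemma fmod_empty: "u \<in> fmod V {} \<longleftrightarrow> u = 0"
  by (auto simp: fmod_def fun_eq_iff)

lemma cone_vec_fmod:
  "cone_vec p q r \<in> fmod V (A <+> (B <+> C)) \<longleftrightarrow> p \<in> fmod V A \<and> q \<in> fmod V B \<and> r \<in> fmod V C"
  unfolding fmod_iff split_sum_all
  by (simp add: cone_vec_def Plus_def image_iff)

lemma cone_proj_fmod:
  fixes u :: "'b + 'c + 'b \<Rightarrow> ('v, 'k::field) mpoly"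
  assumes "u \<in> fmod V (A <+> (B <+> C))"
  shows "cone_fst u \<in> fmod V A" "cone_mid u \<in> fmod V B" "cone_lst u \<in> fmod V C"
  using assms cone_vec_fmod[of "cone_fst u" "cone_mid u" "cone_lst u" V A B C]
  unfolding cone_vec_eta[symmetric] by blast+

lemma cone_vec_homog:
  "homog (case_sum d (case_sum d' d'')) e (cone_vec p q r) \<longleftrightarrow>
     homog d e p \<and> homog d' e q \<and> homog d'' e r"
  unfolding homog_def split_sum_all by (simp add: cone_vec_def)

lemma unitv_cone:
  "unitv (Inl b) = cone_vec (unitv b) 0 0" "unitv (Inr (Inl c)) = cone_vec 0 (unitv c) 0"
  "unitv (Inr (Inr b)) = cone_vec 0 0 (unitv b)"
  by (auto simp: cone_vec_def unitv_def fun_eq_iff split: sum.split)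

lemma homog_shift: "homog (\<lambda>b. Suc (d b)) (Suc e) u \<longleftrightarrow> homog d e u"
  by (simp add: homog_def)

lemma homog_smul_var:
  assumes "homog d e u" shows "homog d (Suc e) (smul (var x) u)"
  using assms by (auto simp: homog_def mons_var_mult mon_degree_single[unfolded One_nat_def])

text \<open>
  Let \<open>K \<subseteq> L\<close> with \<open>K : x = K\<close>. Then \<open>K \<inter> x L = x K\<close>, so there is an exact sequence
  \<open>0 \<rightarrow> x K \<rightarrow> K \<oplus> x L \<rightarrow> K + x L \<rightarrow> 0\<close>. The inclusion of \<open>x K\<close> into \<open>K\<close> lifts to multiplication by
  \<open>x\<close> on the resolution of \<open>K\<close>, and the inclusion into \<open>x L\<close> lifts to a map \<open>\<phi>\<close> between the
  resolutions of \<open>K\<close> and \<open>L\<close>. The mapping cone resolves \<open>K + x L\<close>.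
\<close>

locale splitting_cone =
  P: graded_resolution V K o1 B d \<Delta> + Q: graded_resolution V L o2 B' d' \<Delta>'
  for V :: "'v set" and K L :: "('v, 'k::field) mpoly set" and o1 :: 'b and o2 :: 'c
    and B d \<Delta> B' d' \<Delta>' +
  fixes x :: 'v and \<phi> :: "nat \<Rightarrow> ('b \<Rightarrow> ('v, 'k) mpoly) \<Rightarrow> 'c \<Rightarrow> ('v, 'k) mpoly"
  assumes x: "x \<in> V" and cancel: "\<And>p. p \<in> PR V \<Longrightarrow> var x * p \<in> K \<Longrightarrow> p \<in> K"
    and \<phi>: "chain_map V B d \<Delta> B' d' \<Delta>' \<phi>" and \<phi>0: "\<phi> 0 (unitv o1) = unitv o2"
begin

lemma \<phi>_gmap: "gmap V (B i) (d i) (B' i) (d' i) (\<phi> i)"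
  using \<phi> by (simp add: chain_map_def)

lemma \<phi>_comm: "u \<in> fmod V (B (Suc i)) \<Longrightarrow> \<phi> i (\<Delta> i u) = \<Delta>' i (\<phi> (Suc i) u)"
  using \<phi> by (simp add: chain_map_def)

lemma \<phi>_fmod: "u \<in> fmod V (B i) \<Longrightarrow> \<phi> i u \<in> fmod V (B' i)"
  by (rule gmap_fmod[OF \<phi>_gmap P.finite_B])

lemma augmentation_\<phi>: "u \<in> fmod V (B (Suc 0)) \<Longrightarrow> \<Delta>' 0 (\<phi> (Suc 0) u) o2 = \<Delta> 0 u o1"
proof -
  assume u: "u \<in> fmod V (B (Suc 0))"
  have "\<Delta>' 0 (\<phi> (Suc 0) u) = \<phi> 0 (smul (\<Delta> 0 u o1) (unitv o1))"
    by (rule trans[OF \<phi>_comm[OF u, symmetric] arg_cong[OF P.differential_0[OF u], of "\<phi> 0"]])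
  also have "\<dots> = smul (\<Delta> 0 u o1) (unitv o2)"
    by (simp add: rlinear_smul[OF gmapD(1)[OF \<phi>_gmap]] \<phi>0)
  finally show ?thesis by (simp add: unitv_apply)
qed

abbreviation X :: "('v, 'k) mpoly" where "X \<equiv> var x"

lemma X_PR: "X \<in> PR V" using x by simp

text \<open>
  Position \<open>n\<close> is \<open>P\<^sub>n \<oplus> Q\<^sub>n(-1) \<oplus> P\<^sub>n\<^sub>-\<^sub>1(-1)\<close> for resolutions \<open>P\<close>, \<open>Q\<close> of \<open>R/K\<close> and
  \<open>R/L\<close>. The copies of \<open>R\<close> in position 0 of the resolutions of \<open>x L\<close> and \<open>x K\<close> are not part of
  resolutions of these ideals, so the last two summands start with \<open>Q\<^sub>1\<close> and \<open>P\<^sub>1\<close>.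
\<close>

definition cone_basis :: "nat \<Rightarrow> ('b + 'c + 'b) set" where
  "cone_basis n = B n <+> ((if n = 0 then {} else B' n) <+> (if n \<le> 1 then {} else B (n - 1)))"

definition cone_deg :: "nat \<Rightarrow> 'b + 'c + 'b \<Rightarrow> nat" where
  "cone_deg n = case_sum (d n) (case_sum (\<lambda>c. Suc (d' n c)) (\<lambda>b. Suc (d (n - 1) b)))"

fun cone_diff :: "nat \<Rightarrow> ('b + 'c + 'b \<Rightarrow> ('v, 'k) mpoly) \<Rightarrow> 'b + 'c + 'b \<Rightarrow> ('v, 'k) mpoly" where
  "cone_diff 0 u = cone_vec (\<Delta> 0 (cone_fst u) + smul (X * \<Delta>' 0 (cone_mid u) o2) (unitv o1)) 0 0"
| "cone_diff (Suc j) u = cone_vec (\<Delta> (Suc j) (cone_fst u) - smul X (cone_lst u))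
     (\<Delta>' (Suc j) (cone_mid u) + \<phi> (Suc j) (cone_lst u)) (if j = 0 then 0 else - \<Delta> j (cone_lst u))"

lemma cone_diff_linear: "rlinear (cone_diff i)"
proof (cases i)
  case 0
  show ?thesis
    unfolding 0
    by (rule rlinearI)
       (simp_all only: cone_diff.simps cone_proj_add cone_proj_smul rlinear_add[OF P.lin] rlinear_add[OF Q.lin]
        rlinear_smul[OF P.lin] rlinear_smul[OF Q.lin] cone_vec_add cone_vec_smul cone_vec_eq_iff
        smul_add plus_fun_apply smul_apply smul_simps add.assoc add.left_commute add_0 distrib_left mult.left_commute
        add_0_right simp_thms)
next
  case (Suc j)
  note lins = rlinear_add[OF P.lin] rlinear_add[OF Q.lin] rlinear_smul[OF P.lin] rlinear_smul[OF Q.lin]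
    rlinear_add[OF gmapD(1)[OF \<phi>_gmap]] rlinear_smul[OF gmapD(1)[OF \<phi>_gmap]]
  show ?thesis
    unfolding Suc
  proof (rule rlinearI)
    fix u v :: "'b + 'c + 'b \<Rightarrow> ('v, 'k) mpoly" and c :: "('v, 'k) mpoly"
    show "cone_diff (Suc j) (u + v) = cone_diff (Suc j) u + cone_diff (Suc j) v"
      by (simp add: cone_proj_add lins cone_vec_add cone_vec_eq_iff smul_add)
    show "cone_diff (Suc j) (smul c u) = smul c (cone_diff (Suc j) u)"
      by (simp add: cone_proj_smul lins cone_vec_smul cone_vec_eq_iff smul_add mult.commute)
  qed
qed

lemma cone_basis_simps:
  "cone_basis 0 = B 0 <+> ({} <+> {})"
  "cone_basis (Suc 0) = B (Suc 0) <+> (B' (Suc 0) <+> {})"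
  "cone_basis (Suc (Suc j)) = B (Suc (Suc j)) <+> (B' (Suc (Suc j)) <+> B (Suc j))"
  by (simp_all add: cone_basis_def)

lemma cone_augmentation_homog:
  assumes "c \<in> B' (Suc 0)"
  shows "homog (d 0) (Suc (d' (Suc 0) c)) (smul (X * \<Delta>' 0 (unitv c) o2) (unitv o1))"
proof -
  have "mon_degree m = d' (Suc 0) c" if "m \<in> mons (\<Delta>' 0 (unitv c) o2)" for m
    using gmapD(3)[OF Q.gmap assms] that unfolding homog_def by (metis Q.d_0 add.right_neutral)
  then have "homog (d 0) (d' (Suc 0) c) (smul (\<Delta>' 0 (unitv c) o2) (unitv o1))"
    by (auto simp: homog_def unitv_apply P.d_0)
  from homog_smul_var[OF this] show ?thesis by simp
qed

lemma cone_diff_gmap: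
  "gmap V (cone_basis (Suc i)) (cone_deg (Suc i)) (cone_basis i) (cone_deg i) (cone_diff i)"
proof (cases i)
  case 0
  have "cone_diff 0 (unitv b) \<in> fmod V (cone_basis 0) \<and>
      homog (cone_deg 0) (cone_deg (Suc 0) b) (cone_diff 0 (unitv b))"
    if b: "b \<in> cone_basis (Suc 0)" for b
  proof -
    consider b' where "b = Inl b'" "b' \<in> B (Suc 0)" | c where "b = Inr (Inl c)" "c \<in> B' (Suc 0)"
      using b unfolding cone_basis_simps Plus_def by blast
    then show ?thesis
    proof cases
      case 1
      then show ?thesis
        using gmapD(2,3)[OF P.gmap 1(2)]
        by (simp add: unitv_cone rlinear_zero[OF Q.lin] cone_basis_simps cone_vec_fmod cone_deg_def
            cone_vec_homog homog_zero)
    next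
      case 2
      have "\<Delta>' 0 (unitv c) o2 \<in> PR V"
        by (rule fmod_coord_PR[OF gmapD(2)[OF Q.gmap 2(2)]])
      then show ?thesis
        using 2 cone_augmentation_homog[OF 2(2)] X_PR
        by (simp add: unitv_cone rlinear_zero[OF P.lin] cone_basis_simps cone_vec_fmod cone_deg_def
            cone_vec_homog homog_zero P.B_0)
    qed
  qed
  then show ?thesis using cone_diff_linear unfolding gmap_def 0 by blast
next
  case (Suc j)
  have "cone_diff (Suc j) (unitv b) \<in> fmod V (cone_basis (Suc j)) \<and>
      homog (cone_deg (Suc j)) (cone_deg (Suc (Suc j)) b) (cone_diff (Suc j) (unitv b))"
    if b: "b \<in> cone_basis (Suc (Suc j))" for b
  proof -
    have base: "cone_basis (Suc j) = B (Suc j) <+> (B' (Suc j) <+> (if j = 0 then {} else B j))"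
      by (simp add: cone_basis_def)
    consider b' where "b = Inl b'" "b' \<in> B (Suc (Suc j))" | c where "b = Inr (Inl c)" "c \<in> B' (Suc (Suc j))"
      | b' where "b = Inr (Inr b')" "b' \<in> B (Suc j)"
      using b unfolding cone_basis_simps Plus_def by blast
    then show ?thesis
    proof cases
      case 1
      then show ?thesis
        using gmapD(2,3)[OF P.gmap 1(2)]
        by (simp add: unitv_cone rlinear_zero[OF Q.lin] rlinear_zero[OF P.lin]
            rlinear_zero[OF gmapD(1)[OF \<phi>_gmap]] base cone_vec_fmod cone_deg_def cone_vec_homog homog_zero)
    next
      case 2
      then show ?thesis
        using gmapD(2,3)[OF Q.gmap 2(2)]
        by (simp add: unitv_cone rlinear_zero[OF Q.lin] rlinear_zero[OF P.lin]
            rlinear_zero[OF gmapD(1)[OF \<phi>_gmap]] base cone_vec_fmod cone_deg_def cone_vec_homog homog_zero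
            homog_shift)
    next
      case 3
      have "homog (d (Suc j)) (Suc (d (Suc j) b')) (- smul X (unitv b'))"
        by (intro homog_uminus homog_smul_var homog_unitv)
      moreover have "homog (d j) (d (Suc j) b') (- \<Delta> j (unitv b'))"
        by (intro homog_uminus gmapD(3)[OF P.gmap 3(2)])
      moreover have "smul X (unitv b') \<in> fmod V (B (Suc j))"
        using 3(2) X_PR by simp
      ultimately show ?thesis
        using 3 gmapD(2,3)[OF P.gmap 3(2)] gmapD(2,3)[OF \<phi>_gmap 3(2)]
        by (simp add: unitv_cone rlinear_zero[OF Q.lin] rlinear_zero[OF P.lin]
            base cone_vec_fmod cone_deg_def cone_vec_homog homog_zero homog_shift)
    qed
  qed
  then show ?thesis using cone_diff_linear unfolding gmap_def Suc by blast
qed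

lemma cone_complex:
  assumes w: "w \<in> fmod V (cone_basis (Suc (Suc i)))"
  shows "cone_diff i (cone_diff (Suc i) w) = 0"
proof -
  let ?p = "cone_fst w" and ?q = "cone_mid w" and ?r = "cone_lst w"
  note w' = cone_proj_fmod[OF w[unfolded cone_basis_simps]]
  show ?thesis
  proof (cases i)
    case 0
    have r: "?r \<in> fmod V (B (Suc 0))" using w'(3) 0 by simp
    have "\<Delta> 0 (\<Delta> (Suc 0) ?p - smul X ?r) = - smul X (\<Delta> 0 ?r)"
      using P.complex[of ?p 0] w'(1) 0 by (simp add: rlinear_diff[OF P.lin] rlinear_smul[OF P.lin])
    moreover have "\<Delta>' 0 (\<Delta>' (Suc 0) ?q + \<phi> (Suc 0) ?r) o2 = \<Delta> 0 ?r o1"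
      using Q.complex[of ?q 0] w'(2) 0 augmentation_\<phi>[OF r]
      by (simp add: rlinear_add[OF Q.lin])
    moreover have "smul (X * \<Delta> 0 ?r o1) (unitv o1) = smul X (\<Delta> 0 ?r)"
      using arg_cong[OF P.differential_0[OF r], of "smul X"] by simp
    ultimately show ?thesis unfolding 0 by (simp add: cone_vec_zero)
  next
    case (Suc j)
    have r: "?r \<in> fmod V (B (Suc (Suc j)))" using w'(3) Suc by simp
    have 1: "\<Delta> (Suc j) (\<Delta> (Suc (Suc j)) ?p - smul X ?r) - smul X (- \<Delta> (Suc j) ?r) = 0"
      using P.complex[of ?p "Suc j"] w'(1) Suc
      by (simp add: rlinear_diff[OF P.lin] rlinear_smul[OF P.lin])
    have 2: "\<Delta>' (Suc j) (\<Delta>' (Suc (Suc j)) ?q + \<phi> (Suc (Suc j)) ?r) + \<phi> (Suc j) (- \<Delta> (Suc j) ?r) = 0"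
      using Q.complex[of ?q "Suc j"] w'(2) Suc \<phi>_comm[OF r]
      by (simp add: rlinear_add[OF Q.lin] rlinear_uminus[OF gmapD(1)[OF \<phi>_gmap]])
    have 3: "\<Delta> j (- \<Delta> (Suc j) ?r) = 0"
      using P.complex[OF r] by (simp add: rlinear_uminus[OF P.lin])
    show ?thesis unfolding Suc by (simp add: 1[simplified] 2[simplified] 3 cone_vec_zero)
  qed
qed

text \<open>
  A cycle \<open>(p, q, r)\<close> has \<open>\<Delta> p = x r\<close>, so \<open>x\<close> times \<open>\<Delta> r\<close> vanishes and \<open>r\<close> is a cycle of the
  resolution of \<open>K\<close>. Subtracting the boundary of a vector with last component \<open>s\<close>, where
  \<open>\<Delta> s = r\<close> up to sign, leaves a cycle with \<open>r = 0\<close>, whose other components are cycles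
  separately. In the lowest position, where no component \<open>r\<close> exists, \<open>K : x = K\<close> provides \<open>s\<close>.
\<close>

lemma cone_exact:
  assumes u: "u \<in> fmod V (cone_basis (Suc i))" and z: "cone_diff i u = 0"
  shows "\<exists>w\<in>fmod V (cone_basis (Suc (Suc i))). u = cone_diff (Suc i) w"
proof (cases i)
  case 0
  let ?p = "cone_fst u" and ?q = "cone_mid u"
  note u' = cone_proj_fmod[OF u[unfolded 0 cone_basis_simps]]
  have r0: "cone_lst u = 0" using u'(3) by (simp add: fmod_empty)
  have "\<Delta> 0 ?p + smul (X * \<Delta>' 0 ?q o2) (unitv o1) = 0"
    using z unfolding 0 by (simp add: cone_vec_zero[symmetric] cone_vec_eq_iff)
  from fun_cong[OF this, of o1] have e: "\<Delta> 0 ?p o1 + X * \<Delta>' 0 ?q o2 = 0"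
    by (simp add: unitv_apply)
  have "X * \<Delta>' 0 ?q o2 = \<Delta> 0 (- ?p) o1"
  proof -
    have "X * \<Delta>' 0 ?q o2 = - \<Delta> 0 ?p o1"
      using e by (subst eq_neg_iff_add_eq_0) (simp only: add.commute)
    then show ?thesis by (simp add: rlinear_uminus[OF P.lin])
  qed
  then have "X * \<Delta>' 0 ?q o2 \<in> K"
    unfolding P.image[symmetric] by (rule image_eqI[OF _ fmod_uminus[OF u'(1)]])
  then have "\<Delta>' 0 ?q o2 \<in> K"
    by (rule cancel[OF fmod_coord_PR[OF Q.differential_fmod[OF u'(2)]]])
  then obtain s where s: "s \<in> fmod V (B (Suc 0))" "\<Delta>' 0 ?q o2 = \<Delta> 0 s o1"
    unfolding P.image[symmetric] by blast
  have qs: "?q - \<phi> (Suc 0) s \<in> fmod V (B' (Suc 0))" using u'(2) \<phi>_fmod[OF s(1)] by simp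
  have "\<Delta>' 0 (?q - \<phi> (Suc 0) s) o2 = 0"
    using s(2) augmentation_\<phi>[OF s(1)] by (simp add: rlinear_diff[OF Q.lin])
  with Q.differential_0[OF qs] have "\<Delta>' 0 (?q - \<phi> (Suc 0) s) = 0" by simp
  then obtain q' where q': "q' \<in> fmod V (B' (Suc (Suc 0)))" "?q - \<phi> (Suc 0) s = \<Delta>' (Suc 0) q'"
    using Q.exactE[OF qs] by blast
  have ps: "?p + smul X s \<in> fmod V (B (Suc 0))" using u'(1) s(1) X_PR by simp
  have "\<Delta> 0 (?p + smul X s) o1 = 0"
    using e s(2) by (simp add: rlinear_add[OF P.lin] rlinear_smul[OF P.lin])
  with P.differential_0[OF ps] have "\<Delta> 0 (?p + smul X s) = 0" by simp
  then obtain p' where p': "p' \<in> fmod V (B (Suc (Suc 0)))" "?p + smul X s = \<Delta> (Suc 0) p'"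
    using P.exactE[OF ps] by blast
  have "cone_vec p' q' s \<in> fmod V (cone_basis (Suc (Suc 0)))"
    using p'(1) q'(1) s(1) by (simp add: cone_basis_simps cone_vec_fmod)
  moreover have "u = cone_diff (Suc 0) (cone_vec p' q' s)"
    by (subst cone_vec_eta[of u])
       (simp add: cone_vec_eq_iff r0 p'(2)[symmetric] q'(2)[symmetric])
  ultimately show ?thesis unfolding 0 by blast
next
  case (Suc j)
  let ?p = "cone_fst u" and ?q = "cone_mid u" and ?r = "cone_lst u"
  note u' = cone_proj_fmod[OF u[unfolded Suc cone_basis_simps]]
  have 1: "\<Delta> (Suc j) ?p = smul X ?r" and 2: "\<Delta>' (Suc j) ?q = - \<phi> (Suc j) ?r"
    using z unfolding Suc
    by (simp_all add: cone_vec_zero[symmetric] cone_vec_eq_iff eq_neg_iff_add_eq_0)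
  have Xr: "smul X (\<Delta> j ?r) = 0"
    using P.complex[OF u'(1)] unfolding 1 by (simp add: rlinear_smul[OF P.lin])
  have "X * \<Delta> j ?r b = X * 0" for b
    using fun_cong[OF Xr, of b] by simp
  then have "\<Delta> j ?r b = 0" for b by (rule var_mult_cancel)
  then have "\<Delta> j ?r = 0" by (simp add: fun_eq_iff)
  then obtain s where s: "s \<in> fmod V (B (Suc (Suc j)))" "?r = \<Delta> (Suc j) s"
    using P.exactE[OF u'(3)] by blast
  have pz: "\<Delta> (Suc j) (?p - smul X s) = 0"
    by (simp add: rlinear_diff[OF P.lin] rlinear_smul[OF P.lin] 1 s(2))
  have "?p - smul X s \<in> fmod V (B (Suc (Suc j)))" using u'(1) s(1) X_PR by simp
  from P.exactE[OF this pz]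
  obtain p' where p': "p' \<in> fmod V (B (Suc (Suc (Suc j))))" "?p - smul X s = \<Delta> (Suc (Suc j)) p'"
    by blast
  have qz: "\<Delta>' (Suc j) (?q + \<phi> (Suc (Suc j)) s) = 0"
    using \<phi>_comm[OF s(1)] by (simp add: rlinear_add[OF Q.lin] 2 s(2))
  have "?q + \<phi> (Suc (Suc j)) s \<in> fmod V (B' (Suc (Suc j)))" using u'(2) \<phi>_fmod[OF s(1)] by simp
  from Q.exactE[OF this qz]
  obtain q' where q': "q' \<in> fmod V (B' (Suc (Suc (Suc j))))"
      "?q + \<phi> (Suc (Suc j)) s = \<Delta>' (Suc (Suc j)) q'"
    by blast
  have "cone_vec p' q' (- s) \<in> fmod V (cone_basis (Suc (Suc (Suc j))))"
    using p'(1) q'(1) s(1) by (simp add: cone_basis_simps cone_vec_fmod)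
  moreover have "u = cone_diff (Suc (Suc j)) (cone_vec p' q' (- s))"
    by (subst cone_vec_eta[of u])
       (simp add: cone_vec_eq_iff p'(2)[symmetric] q'(2)[symmetric] s(2)
        rlinear_uminus[OF P.lin] rlinear_uminus[OF gmapD(1)[OF \<phi>_gmap]])
  ultimately show ?thesis unfolding Suc by blast
qed

lemma cone_image:
  "(\<lambda>u. cone_diff 0 u (Inl o1)) ` fmod V (cone_basis (Suc 0)) = {a + X * b | a b. a \<in> K \<and> b \<in> L}"
  (is "?L = ?R")
proof (intro equalityI subsetI)
  have val: "cone_diff 0 u (Inl o1) = \<Delta> 0 (cone_fst u) o1 + X * \<Delta>' 0 (cone_mid u) o2" for u
    by (simp add: cone_vec_def unitv_apply)
  {
    fix y assume "y \<in> ?L"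
    then obtain u where u: "u \<in> fmod V (cone_basis (Suc 0))" "y = cone_diff 0 u (Inl o1)" by blast
    note u' = cone_proj_fmod[OF u(1)[unfolded cone_basis_simps]]
    have "\<Delta> 0 (cone_fst u) o1 \<in> K" "\<Delta>' 0 (cone_mid u) o2 \<in> L"
      unfolding P.image[symmetric] Q.image[symmetric] using u' by blast+
    then show "y \<in> ?R" unfolding u(2) val by blast
  next
    fix y assume "y \<in> ?R"
    then obtain a b where ab: "a \<in> K" "b \<in> L" "y = a + X * b" by blast
    obtain p where p: "p \<in> fmod V (B (Suc 0))" "a = \<Delta> 0 p o1"
      using ab(1) unfolding P.image[symmetric] by blast
    obtain q where q: "q \<in> fmod V (B' (Suc 0))" "b = \<Delta>' 0 q o2"
      using ab(2) unfolding Q.image[symmetric] by blast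
    have "cone_vec p q 0 \<in> fmod V (cone_basis (Suc 0))"
      using p q by (simp add: cone_basis_simps cone_vec_fmod)
    moreover have "y = cone_diff 0 (cone_vec p q 0) (Inl o1)"
      unfolding val ab(3) by (simp add: p(2) q(2))
    ultimately show "y \<in> ?L" by blast
  }
qed

lemma cone_resolution:
  "graded_resolution V {a + X * b | a b. a \<in> K \<and> b \<in> L} (Inl o1) cone_basis cone_deg cone_diff"
proof
  show "finite (cone_basis i)" for i
    by (auto simp: cone_basis_def P.finite_B Q.finite_B)
  show "cone_basis 0 = {Inl o1}"
    by (auto simp: cone_basis_def P.B_0)
  show "cone_deg 0 (Inl o1) = 0"
    by (simp add: cone_deg_def P.d_0)
  show "u \<in> fmod V (cone_basis (Suc i)) \<Longrightarrow>
      cone_diff i u = 0 \<longleftrightarrow> (\<exists>w\<in>fmod V (cone_basis (Suc (Suc i))). u = cone_diff (Suc i) w)" for u i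
    using cone_exact cone_complex by blast
qed (rule cone_diff_gmap cone_image)+

end

section \<open>Cancellation of unit entries\<close>

text \<open>
  An entry with nonzero constant term has degree 0 by homogeneity, hence is a scalar.
\<close>

lemma (in graded_resolution) unit_entry_scalar:
  assumes b: "b \<in> B (Suc n)" and u: "cf (\<Delta> n (unitv b) a) 0 \<noteq> 0"
  shows "d n a = d (Suc n) b" "\<Delta> n (unitv b) a = Poly_Mapping.single 0 (cf (\<Delta> n (unitv b) a) 0)"
proof -
  let ?c = "\<Delta> n (unitv b) a"
  have deg: "mon_degree m + d n a = d (Suc n) b" if "m \<in> mons ?c" for m
    using gmapD(3)[OF gmap b] that unfolding homog_def by blast
  have 0: "0 \<in> mons ?c" using u by (simp add: in_keys_iff)
  show eq: "d n a = d (Suc n) b" using deg[OF 0] by simp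
  have "m = 0" if "m \<in> mons ?c" for m
    using deg[OF that] eq by (simp add: mon_degree_eq_0_iff)
  then show "?c = Poly_Mapping.single 0 (cf ?c 0)"
    by (intro poly_mapping_eqI) (metis in_keys_iff lookup_single_eq lookup_single_not_eq)
qed

text \<open>
  A unit entry of a differential in row \<open>a\<close> and column \<open>b\<close> splits off a trivial complex
  \<open>0 \<rightarrow> R \<rightarrow> R \<rightarrow> 0\<close>. The remaining complex has the bases with \<open>a\<close> and \<open>b\<close> removed.
\<close>

locale cancellation = graded_resolution V I o0 B d \<Delta>
  for V :: "'v set" and I :: "('v, 'k::field) mpoly set" and o0 :: 'b and B d \<Delta> +
  fixes k :: nat and a b :: 'b
  assumes a: "a \<in> B (Suc k)" and b: "b \<in> B (Suc (Suc k))"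
    and pivot: "cf (\<Delta> (Suc k) (unitv b) a) 0 \<noteq> 0"
begin

abbreviation n :: nat where "n \<equiv> Suc k"

definition pivot_inv :: "('v, 'k) mpoly" where
  "pivot_inv = Poly_Mapping.single 0 (inverse (cf (\<Delta> n (unitv b) a) 0))"

lemma pivot_inv_mult: "pivot_inv * \<Delta> n (unitv b) a = 1"
proof -
  have "pivot_inv * \<Delta> n (unitv b) a = pivot_inv * Poly_Mapping.single 0 (cf (\<Delta> n (unitv b) a) 0)"
    using unit_entry_scalar(2)[OF b pivot] by (rule arg_cong)
  then show ?thesis using pivot by (simp add: pivot_inv_def mult_single)
qed

lemma pivot_inv_PR: "pivot_inv \<in> PR V"
  by (simp add: pivot_inv_def)

text \<open>
  For \<open>u\<close> with \<open>u b = 0\<close> this is the unique vector that agrees with \<open>u\<close> outside \<open>b\<close> and whose image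
  has coordinate 0 at \<open>a\<close>. So vectors on the smaller basis correspond to such vectors on the
  larger one (\<open>extend_upd\<close>, \<open>extend_unique\<close>).
\<close>

definition extend :: "('b \<Rightarrow> ('v, 'k) mpoly) \<Rightarrow> 'b \<Rightarrow> ('v, 'k) mpoly" where
  "extend u = u - smul (pivot_inv * \<Delta> n u a) (unitv b)"

lemma extend_linear: "rlinear extend"
proof (rule rlinearI)
  fix u v :: "'b \<Rightarrow> ('v, 'k) mpoly" and p :: "('v, 'k) mpoly"
  show "extend (u + v) = extend u + extend v"
    by (simp add: extend_def rlinear_add[OF lin] distrib_left smul_add)
  show "extend (smul p u) = smul p (extend u)"
    by (simp add: extend_def rlinear_smul[OF lin] smul_add mult.left_commute)
qed

lemma extend_fmod:
  assumes "u \<in> fmod V (B (Suc n))" shows "extend u \<in> fmod V (B (Suc n))"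
  unfolding extend_def
  using assms b fmod_coord_PR[OF differential_fmod[OF assms]] pivot_inv_PR by simp

lemma differential_extend_pivot: "\<Delta> n (extend u) a = 0"
proof -
  have "\<Delta> n (extend u) a = \<Delta> n u a - \<Delta> n u a * (pivot_inv * \<Delta> n (unitv b) a)"
    by (simp add: extend_def rlinear_diff[OF lin] rlinear_smul[OF lin] mult_ac)
  then show ?thesis by (simp add: pivot_inv_mult)
qed

lemma extend_upd: "u b = 0 \<Longrightarrow> (extend u)(b := 0) = u"
  by (auto simp: extend_def fun_eq_iff unitv_apply)

lemma extend_unique:
  assumes w: "\<Delta> n w a = 0"
  shows "extend (w(b := 0)) = w"
proof -
  have eq: "w(b := 0) = w - smul (w b) (unitv b)"
    by (auto simp: fun_eq_iff unitv_apply)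
  have "pivot_inv * \<Delta> n (w(b := 0)) a = - (w b * (pivot_inv * \<Delta> n (unitv b) a))"
    unfolding eq by (simp add: rlinear_diff[OF lin] rlinear_smul[OF lin] w mult.left_commute)
  then have "pivot_inv * \<Delta> n (w(b := 0)) a = - w b"
    by (simp add: pivot_inv_mult)
  then show ?thesis
    unfolding extend_def by (simp add: eq)
qed

definition clear :: "('b \<Rightarrow> ('v, 'k) mpoly) \<Rightarrow> 'b \<Rightarrow> ('v, 'k) mpoly" where
  "clear u = u - smul (pivot_inv * u a) (\<Delta> n (unitv b))"

lemma clear:
  assumes "u \<in> fmod V (B n)"
  shows "clear u \<in> fmod V (B n - {a})" "\<Delta> k (clear u) = \<Delta> k u"
proof -
  have "clear u a = u a - u a * (pivot_inv * \<Delta> n (unitv b) a)"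
    by (simp add: clear_def mult_ac)
  then have 0: "clear u a = 0" by (simp add: pivot_inv_mult)
  have "clear u \<in> fmod V (B n)"
    unfolding clear_def
    using assms differential_fmod[OF fmod_unitv[OF b]] fmod_coord_PR[OF assms] pivot_inv_PR by simp
  with 0 show "clear u \<in> fmod V (B n - {a})" by (auto simp: fmod_def)
  show "\<Delta> k (clear u) = \<Delta> k u"
    unfolding clear_def using complex[OF fmod_unitv[OF b]]
    by (simp add: rlinear_diff[OF lin] rlinear_smul[OF lin])
qed

definition B' :: "nat \<Rightarrow> 'b set" where
  "B' = B(n := B n - {a}, Suc n := B (Suc n) - {b})"

definition \<Delta>' :: "nat \<Rightarrow> ('b \<Rightarrow> ('v, 'k) mpoly) \<Rightarrow> 'b \<Rightarrow> ('v, 'k) mpoly" where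
  "\<Delta>' = \<Delta>(n := (\<lambda>u. \<Delta> n (extend u)), Suc n := (\<lambda>u. (\<Delta> (Suc n) u)(b := 0)))"

lemma fmod_remove: "u \<in> fmod V (A - {x}) \<longleftrightarrow> u \<in> fmod V A \<and> u x = 0"
  unfolding fmod_iff by (metis PR_zero Diff_iff singletonD singletonI)

lemma fmod_upd: "u \<in> fmod V A \<Longrightarrow> u(x := 0) \<in> fmod V (A - {x})"
  unfolding fmod_iff by simp

lemma extend_homog:
  assumes b': "b' \<in> B (Suc n)"
  shows "homog (d (Suc n)) (d (Suc n) b') (extend (unitv b'))"
proof -
  have "mon_degree m + d (Suc n) b = d (Suc n) b'" if m: "m \<in> mons (pivot_inv * \<Delta> n (unitv b') a)" for m
  proof -
    obtain m1 m2 where m: "m1 \<in> mons pivot_inv" "m2 \<in> mons (\<Delta> n (unitv b') a)" "m = m1 + m2"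
      using m by (rule keys_mult_obtain)
    have "m1 = 0" using m(1) by (simp add: pivot_inv_def split: if_splits)
    moreover have "mon_degree m2 + d n a = d (Suc n) b'"
      using gmapD(3)[OF gmap b'] m(2) unfolding homog_def by blast
    ultimately show ?thesis using m(3) unit_entry_scalar(1)[OF b pivot] by simp
  qed
  then have "homog (d (Suc n)) (d (Suc n) b') (smul (pivot_inv * \<Delta> n (unitv b') a) (unitv b))"
    unfolding homog_def by (simp add: unitv_apply)
  then show ?thesis unfolding extend_def by (intro homog_diff homog_unitv)
qed

lemma \<Delta>'_gmap: "gmap V (B' (Suc i)) (d (Suc i)) (B' i) (d i) (\<Delta>' i)"
proof -
  consider "i = n" | "i = Suc n" | "Suc i = n" | "i \<noteq> n" "i \<noteq> Suc n" "Suc i \<noteq> n"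
    by blast
  then show ?thesis
  proof cases
    case 1
    have "\<Delta> n (extend (unitv b')) \<in> fmod V (B n - {a}) \<and>
        homog (d n) (d (Suc n) b') (\<Delta> n (extend (unitv b')))" if b': "b' \<in> B (Suc n)" for b'
      unfolding fmod_remove
      using differential_fmod[OF extend_fmod[OF fmod_unitv[OF b']]] differential_extend_pivot
        gmap_homog[OF gmap extend_fmod[OF fmod_unitv[OF b']] finite_B extend_homog[OF b']] by blast
    moreover have "rlinear (\<lambda>u. \<Delta> n (extend u))" by (rule rlinear_comp[OF lin extend_linear])
    ultimately show ?thesis unfolding gmap_def 1 by (simp add: B'_def \<Delta>'_def)
  next
    case 2
    have "(\<Delta> (Suc n) (unitv b'))(b := 0) \<in> fmod V (B (Suc n) - {b}) \<and>
        homog (d (Suc n)) (d (Suc (Suc n)) b') ((\<Delta> (Suc n) (unitv b'))(b := 0))"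
      if b': "b' \<in> B (Suc (Suc n))" for b'
      using fmod_upd[OF gmapD(2)[OF gmap b']] gmapD(3)[OF gmap b'] by (simp add: homog_def)
    moreover have "rlinear (\<lambda>u. (\<Delta> (Suc n) u)(b := 0))" by (rule rlinear_fun_upd[OF lin])
    ultimately show ?thesis unfolding gmap_def 2 by (simp add: B'_def \<Delta>'_def)
  next
    case 3
    then show ?thesis using gmap[of i] by (simp add: gmap_def B'_def \<Delta>'_def)
  next
    case 4
    then have "B' (Suc i) = B (Suc i) \<or> B' (Suc i) = B (Suc i) - {b}" "B' i = B i" "\<Delta>' i = \<Delta> i"
      by (auto simp: B'_def \<Delta>'_def)
    then show ?thesis using gmap[of i] by (auto simp: gmap_def)
  qed
qed

text \<open>
  Only the positions next to the cancelled pair change. In each of them, cycles and boundaries of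
  the two complexes correspond under \<open>extend\<close>, restriction to the complement of \<open>b\<close>, and \<open>clear\<close>.
\<close>

lemma \<Delta>'_exact:
  assumes u: "u \<in> fmod V (B' (Suc m))"
  shows "\<Delta>' m u = 0 \<longleftrightarrow> (\<exists>w\<in>fmod V (B' (Suc (Suc m))). u = \<Delta>' (Suc m) w)"
proof -
  consider "Suc (Suc m) = n" | "m = k" | "m = n" | "m = Suc n"
    | "Suc (Suc m) \<noteq> n" "m \<noteq> k" "m \<noteq> n" "m \<noteq> Suc n" by blast
  then show ?thesis
  proof cases
    case 1
    then have k: "Suc m = k" by simp
    then have e: "B' k = B k" "B' n = B n - {a}" "\<Delta>' m = \<Delta> m" "\<Delta>' k = \<Delta> k"
      by (auto simp: B'_def \<Delta>'_def)
    have "(\<exists>w\<in>fmod V (B n). u = \<Delta> k w) \<longleftrightarrow> (\<exists>w\<in>fmod V (B n - {a}). u = \<Delta> k w)"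
      using clear fmod_remove by metis
    then show ?thesis using exact[of u m] u unfolding k e by simp
  next
    case 2
    have e: "B' (Suc m) = B n - {a}" "B' (Suc (Suc m)) = B (Suc n) - {b}" "\<Delta>' m = \<Delta> k"
      "\<Delta>' (Suc m) = (\<lambda>u. \<Delta> n (extend u))"
      by (auto simp: B'_def \<Delta>'_def 2)
    have u': "u \<in> fmod V (B n)" "u a = 0" using u unfolding e fmod_remove by blast+
    show ?thesis
      unfolding e
    proof
      assume "\<Delta> k u = 0"
      then obtain w where w: "w \<in> fmod V (B (Suc n))" "u = \<Delta> n w" using exactE[OF u'(1)] by blast
      have "extend (w(b := 0)) = w" using u'(2) w(2) by (intro extend_unique) simp
      then show "\<exists>w\<in>fmod V (B (Suc n) - {b}). u = \<Delta> n (extend w)"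
        using fmod_upd[OF w(1), of b] w(2) by metis
    next
      assume "\<exists>w\<in>fmod V (B (Suc n) - {b}). u = \<Delta> n (extend w)"
      then obtain w where w: "w \<in> fmod V (B (Suc n) - {b})" "u = \<Delta> n (extend w)" by blast
      have "w \<in> fmod V (B (Suc n))" using w(1) unfolding fmod_remove by blast
      then show "\<Delta> k u = 0" unfolding w(2) by (rule complex[OF extend_fmod])
    qed
  next
    case 3
    have e: "B' (Suc m) = B (Suc n) - {b}" "B' (Suc (Suc m)) = B (Suc (Suc n))"
      "\<Delta>' m = (\<lambda>u. \<Delta> n (extend u))" "\<Delta>' (Suc m) = (\<lambda>u. (\<Delta> (Suc n) u)(b := 0))"
      by (auto simp: B'_def \<Delta>'_def 3)
    have u': "u \<in> fmod V (B (Suc n))" "u b = 0" using u unfolding e fmod_remove by blast+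
    show ?thesis
      unfolding e
    proof
      assume "\<Delta> n (extend u) = 0"
      then obtain w where "w \<in> fmod V (B (Suc (Suc n)))" "extend u = \<Delta> (Suc n) w"
        using exactE[OF extend_fmod[OF u'(1)]] by blast
      then show "\<exists>w\<in>fmod V (B (Suc (Suc n))). u = (\<Delta> (Suc n) w)(b := 0)"
        using extend_upd[of u, OF u'(2)] by metis
    next
      assume "\<exists>w\<in>fmod V (B (Suc (Suc n))). u = (\<Delta> (Suc n) w)(b := 0)"
      then obtain w where w: "w \<in> fmod V (B (Suc (Suc n)))" "u = (\<Delta> (Suc n) w)(b := 0)" by blast
      have c: "\<Delta> n (\<Delta> (Suc n) w) = 0" by (rule complex[OF w(1)])
      then have "extend u = \<Delta> (Suc n) w" unfolding w(2) by (intro extend_unique) simp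
      then show "\<Delta> n (extend u) = 0" using c by simp
    qed
  next
    case 4
    have e: "B' (Suc m) = B (Suc (Suc n))" "B' (Suc (Suc m)) = B (Suc (Suc (Suc n)))"
      "\<Delta>' m = (\<lambda>u. (\<Delta> (Suc n) u)(b := 0))" "\<Delta>' (Suc m) = \<Delta> (Suc (Suc n))"
      by (auto simp: B'_def \<Delta>'_def 4)
    have u': "u \<in> fmod V (B (Suc (Suc n)))" using u unfolding e .
    have "(\<Delta> (Suc n) u)(b := 0) = 0 \<longleftrightarrow> \<Delta> (Suc n) u = 0"
    proof
      assume z: "(\<Delta> (Suc n) u)(b := 0) = 0"
      have "extend ((\<Delta> (Suc n) u)(b := 0)) = \<Delta> (Suc n) u"
        using complex[OF u'] by (intro extend_unique) simp
      then show "\<Delta> (Suc n) u = 0" unfolding z by (simp add: rlinear_zero[OF extend_linear])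
    qed (simp add: fun_eq_iff)
    then show ?thesis unfolding e using exact[OF u'] by simp
  next
    case 5
    then have "B' (Suc m) = B (Suc m)" "B' (Suc (Suc m)) = B (Suc (Suc m))"
      "\<Delta>' m = \<Delta> m" "\<Delta>' (Suc m) = \<Delta> (Suc m)"
      by (auto simp: B'_def \<Delta>'_def)
    then show ?thesis using exact[of u m] u by simp
  qed
qed

lemma cancelled_resolution: "graded_resolution V I o0 B' d \<Delta>'"
proof
  show "finite (B' i)" for i using finite_B by (simp add: B'_def)
  show "B' 0 = {o0}" using B_0 by (simp add: B'_def)
  show "d 0 o0 = 0" by (rule d_0)
  show "(\<lambda>u. \<Delta>' 0 u o0) ` fmod V (B' (Suc 0)) = I"
  proof -
    have e: "\<Delta>' 0 = \<Delta> 0" by (simp add: \<Delta>'_def)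
    show ?thesis
    proof (cases "k = 0")
      case True
      have "(\<lambda>u. \<Delta> 0 u o0) ` fmod V (B (Suc 0) - {a}) = (\<lambda>u. \<Delta> 0 u o0) ` fmod V (B (Suc 0))"
      proof (intro equalityI subsetI)
        fix y assume "y \<in> (\<lambda>u. \<Delta> 0 u o0) ` fmod V (B (Suc 0))"
        then obtain u where u: "u \<in> fmod V (B n)" "y = \<Delta> k u o0" using True by auto
        have "y = \<Delta> k (clear u) o0" using clear(2)[OF u(1)] u(2) by simp
        then show "y \<in> (\<lambda>u. \<Delta> 0 u o0) ` fmod V (B (Suc 0) - {a})"
          using clear(1)[OF u(1)] True by auto
      qed (auto simp: fmod_remove)
      moreover have "B' (Suc 0) = B (Suc 0) - {a}" using True unfolding B'_def by simp
      ultimately show ?thesis using image unfolding e by (simp only:)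
    next
      case False
      then have "B' (Suc 0) = B (Suc 0)" unfolding B'_def by simp
      then show ?thesis using image unfolding e by (simp only:)
    qed
  qed
  show "u \<in> fmod V (B' (Suc i)) \<Longrightarrow>
      \<Delta>' i u = 0 \<longleftrightarrow> (\<exists>w\<in>fmod V (B' (Suc (Suc i))). u = \<Delta>' (Suc i) w)" for u i
    by (rule \<Delta>'_exact)
qed (rule \<Delta>'_gmap)

end

text \<open>
  Each cancellation lowers the total rank, so it stops, and then no unit entry is left.
\<close>

lemma exists_minimal_subresolution:
  fixes I :: "('v, 'k::field) mpoly set" and o0 :: 'b
  assumes "graded_resolution V I o0 B d \<Delta>" "\<And>i. i \<ge> N \<Longrightarrow> B i = {}"
  shows "\<exists>B' \<Delta>'. graded_resolution V I o0 B' d \<Delta>' \<and> minimal_differentials B' \<Delta>' \<and> (\<forall>i. B' i \<subseteq> B i)"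
  using assms
proof (induction "\<Sum>i<N. card (B i)" arbitrary: B \<Delta> rule: less_induct)
  case less
  interpret graded_resolution V I o0 B d \<Delta> by (rule less.prems(1))
  show ?case
  proof (cases "minimal_differentials B \<Delta>")
    case True
    then show ?thesis using less.prems(1) by blast
  next
    case False
    then obtain k b a where kb: "b \<in> B (Suc (Suc k))" "cf (\<Delta> (Suc k) (unitv b) a) 0 \<noteq> 0"
      unfolding minimal_differentials_def by blast
    have a: "a \<in> B (Suc k)"
    proof (rule ccontr)
      assume "a \<notin> B (Suc k)"
      then show False using fmod_outside[OF gmapD(2)[OF gmap kb(1)]] kb(2) by simp
    qed
    interpret C: cancellation V I o0 B d \<Delta> k a b
      by unfold_locales (rule a kb)+
    have sub: "C.B' i \<subseteq> B i" for i by (auto simp: C.B'_def)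
    have "C.B' (Suc k) \<subset> B (Suc k)" using a by (auto simp: C.B'_def)
    then have "card (C.B' (Suc k)) < card (B (Suc k))" by (rule psubset_card_mono[OF finite_B])
    moreover have "Suc k < N" using less.prems(2)[of "Suc k"] a by (metis empty_iff not_le)
    moreover have "card (C.B' i) \<le> card (B i)" for i by (rule card_mono[OF finite_B sub])
    ultimately have "(\<Sum>i<N. card (C.B' i)) < (\<Sum>i<N. card (B i))"
      by (intro sum_strict_mono_ex1) auto
    moreover have "C.B' i = {}" if "i \<ge> N" for i using sub[of i] less.prems(2)[OF that] by blast
    ultimately obtain B' \<Delta>' where "graded_resolution V I o0 B' d \<Delta>'"
      "minimal_differentials B' \<Delta>'" "\<And>i. B' i \<subseteq> C.B' i"
      using less.hyps[OF _ C.cancelled_resolution] by blast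
    then show ?thesis using sub by (meson order_trans)
  qed
qed

section \<open>Matrices and Betti numbers\<close>

text \<open>
  A finite minimal resolution exists, and all pairs \<open>(i, j)\<close> for which \<open>R(-j)\<close> occurs in it
  in position \<open>i\<close> belong to \<open>T\<close>. The bounds on regularity and projective dimension are statements
  of this form.
\<close>

definition resolved_within :: "'v set \<Rightarrow> ('v, 'k::field) mpoly set \<Rightarrow> (nat \<times> nat) set \<Rightarrow> bool" where
  "resolved_within V I T \<longleftrightarrow> (\<exists>D d. min_graded_resolution V I D d \<and> (\<exists>N. \<forall>i\<ge>N. dim_col (D i) = 0) \<and>
     (\<forall>i. \<forall>b<dim_col (D i). (i, d i b) \<in> T))"

definition mat_diff :: "('v, 'k::field) mpoly mat \<Rightarrow> (nat \<Rightarrow> ('v, 'k) mpoly) \<Rightarrow> nat \<Rightarrow> ('v, 'k) mpoly" where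
  "mat_diff A u = (\<lambda>a. if a < dim_row A then \<Sum>b<dim_col A. A $$ (a, b) * u b else 0)"

lemma mat_diff_unitv: "b < dim_col A \<Longrightarrow> mat_diff A (unitv b) = (\<lambda>a. if a < dim_row A then A $$ (a, b) else 0)"
  by (auto simp: mat_diff_def unitv_def fun_eq_iff if_distrib[of "(*) _"] sum.delta cong: if_cong)

lemma mat_diff_linear: "rlinear (mat_diff A)"
  by (rule rlinearI)
     (auto simp: mat_diff_def fun_eq_iff distrib_left sum.distrib sum_distrib_left mult.left_commute)

lemma mat_diff_vec: "vec (dim_row A) (mat_diff A u) = A *\<^sub>v vec (dim_col A) u"
  by (rule eq_vecI) (auto simp: mat_diff_def scalar_prod_def lessThan_atLeast0 intro!: sum.cong)

lemma vec_fmod: "u \<in> fmod V {..<n} \<Longrightarrow> vec n u \<in> free_module V n"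
  by (auto simp: free_module_def fmod_def)

lemma free_module_vec:
  assumes "w \<in> free_module V n"
  shows "\<exists>u\<in>fmod V {..<n}. w = vec n u"
proof (rule bexI[of _ "\<lambda>a. if a < n then w $ a else 0"])
  show "w = vec n (\<lambda>a. if a < n then w $ a else 0)"
    using assms by (intro eq_vecI) (auto simp: free_module_def)
  show "(\<lambda>a. if a < n then w $ a else 0) \<in> fmod V {..<n}"
    using assms by (auto simp: free_module_def fmod_def)
qed

lemma vec_inject: "u \<in> fmod V {..<n} \<Longrightarrow> v \<in> fmod V {..<n} \<Longrightarrow> vec n u = vec n v \<longleftrightarrow> u = v"
proof
  assume u: "u \<in> fmod V {..<n}" and v: "v \<in> fmod V {..<n}" and e: "vec n u = vec n v"
  show "u = v"
  proof
    fix a show "u a = v a"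
    proof (cases "a < n")
      case True
      have "vec n u $ a = vec n v $ a" unfolding e ..
      then show ?thesis unfolding index_vec[OF True] .
    next
      case False
      then show ?thesis using fmod_outside[OF u] fmod_outside[OF v] by simp
    qed
  qed
qed (erule arg_cong)

lemma matrix_to_graded_resolution:
  fixes I :: "('v, 'k::field) mpoly set"
  assumes D: "min_graded_resolution V I D d"
  shows "graded_resolution V I 0 (\<lambda>i. {..<dim_row (D i)}) (case_nat (\<lambda>_. 0) d) (\<lambda>i. mat_diff (D i))"
    and "minimal_differentials (\<lambda>i. {..<dim_row (D i)}) (\<lambda>i. mat_diff (D i))"
proof -
  note D1 = D[unfolded min_graded_resolution_def]
  note D2 = conjunct2[OF D1] note D3 = conjunct2[OF D2] note D4 = conjunct2[OF D3]
  note D5 = conjunct2[OF D4] note D6 = conjunct2[OF D5] note D7 = conjunct2[OF D6]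
  note D8 = conjunct2[OF D7]
  note row0 = conjunct1[OF D1] and row = conjunct1[OF D2, rule_format]
    and el = conjunct1[OF D3, rule_format] and deg0 = conjunct1[OF D4, rule_format]
    and deg = conjunct1[OF D5, rule_format] and img = conjunct1[OF D6]
    and ex = conjunct1[OF D7, rule_format] and min = D8[rule_format]
  have entry: "a < dim_row (D i) \<Longrightarrow> b < dim_col (D i) \<Longrightarrow> D i $$ (a, b) \<in> elements_mat (D i)" for i a b
    by (rule elements_matI[of _ "dim_row (D i)" "dim_col (D i)"]) auto
  have fm: "mat_diff (D i) u \<in> fmod V {..<dim_row (D i)}" if "u \<in> fmod V {..<dim_col (D i)}" for i u
  proof (rule fmodI)
    fix a assume "a \<in> {..<dim_row (D i)}"
    then have a: "a < dim_row (D i)" by simp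
    have "(\<Sum>b<dim_col (D i). D i $$ (a, b) * u b) \<in> PR V"
    proof (rule PR_sum)
      fix b assume "b \<in> {..<dim_col (D i)}"
      then have "D i $$ (a, b) \<in> PR V" using entry[OF a] el by blast
      then show "D i $$ (a, b) * u b \<in> PR V" using fmod_coord_PR[OF that] by (rule PR_mult)
    qed
    then show "mat_diff (D i) u a \<in> PR V" using a by (simp add: mat_diff_def)
  qed (simp add: mat_diff_def)
  show "graded_resolution V I 0 (\<lambda>i. {..<dim_row (D i)}) (case_nat (\<lambda>_. 0) d) (\<lambda>i. mat_diff (D i))"
  proof
    show "finite {..<dim_row (D i)}" for i by simp
    show "{..<dim_row (D 0)} = {0}" using row0 by auto
    show "gmap V {..<dim_row (D (Suc i))} (case_nat (\<lambda>_. 0) d (Suc i)) {..<dim_row (D i)}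
        (case_nat (\<lambda>_. 0) d i) (mat_diff (D i))" for i
      unfolding gmap_def
    proof (intro conjI ballI mat_diff_linear)
      fix b assume b: "b \<in> {..<dim_row (D (Suc i))}"
      then have b': "b < dim_col (D i)" by (simp add: row)
      show "mat_diff (D i) (unitv b) \<in> fmod V {..<dim_row (D i)}"
        using b' by (intro fm fmod_unitv) simp
      show "homog (case_nat (\<lambda>_. 0) d i) (case_nat (\<lambda>_. 0) d (Suc i) b) (mat_diff (D i) (unitv b))"
      proof (cases i)
        case 0
        then show ?thesis using b' deg0 row0 unfolding homog_def mat_diff_unitv[OF b'] by auto
      next
        case (Suc j)
        then show ?thesis using b' deg unfolding homog_def mat_diff_unitv[OF b'] by auto
      qed
    qed
    show "(\<lambda>u. mat_diff (D 0) u 0) ` fmod V {..<dim_row (D (Suc 0))} = I"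
    proof -
      have val: "mat_diff (D 0) u 0 = (D 0 *\<^sub>v vec (dim_col (D 0)) u) $ 0" for u
        using arg_cong[OF mat_diff_vec[of "D 0" u], of "\<lambda>w. w $ 0"] row0 by simp
      show ?thesis
        unfolding img[symmetric] row
      proof (intro equalityI subsetI)
        fix y assume "y \<in> (\<lambda>u. mat_diff (D 0) u 0) ` fmod V {..<dim_col (D 0)}"
        then show "y \<in> {(D 0 *\<^sub>v u) $ 0 | u. u \<in> free_module V (dim_col (D 0))}"
          using val vec_fmod by blast
      next
        fix y assume "y \<in> {(D 0 *\<^sub>v u) $ 0 | u. u \<in> free_module V (dim_col (D 0))}"
        then obtain w where w: "w \<in> free_module V (dim_col (D 0))" "y = (D 0 *\<^sub>v w) $ 0" by blast
        obtain u where u: "u \<in> fmod V {..<dim_col (D 0)}" "w = vec (dim_col (D 0)) u"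
          using free_module_vec[OF w(1)] by blast
        have "y = mat_diff (D 0) u 0" unfolding val w(2) u(2) ..
        then show "y \<in> (\<lambda>u. mat_diff (D 0) u 0) ` fmod V {..<dim_col (D 0)}"
          using u(1) by (rule image_eqI)
      qed
    qed
    fix u :: "nat \<Rightarrow> ('v, 'k) mpoly" and i assume u: "u \<in> fmod V {..<dim_row (D (Suc i))}"
    then have u': "u \<in> fmod V {..<dim_col (D i)}" by (simp add: row)
    have "mat_diff (D i) u = 0 \<longleftrightarrow> vec (dim_row (D i)) (mat_diff (D i) u) = vec (dim_row (D i)) 0"
      using vec_inject[OF fm[OF u'] fmod_zero] by simp
    also have "vec (dim_row (D i)) 0 = 0\<^sub>v (dim_row (D i))" by (rule eq_vecI) auto
    also have "vec (dim_row (D i)) (mat_diff (D i) u) = D i *\<^sub>v vec (dim_col (D i)) u"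
      by (rule mat_diff_vec)
    also have "D i *\<^sub>v vec (dim_col (D i)) u = 0\<^sub>v (dim_row (D i)) \<longleftrightarrow>
        vec (dim_col (D i)) u \<in> {D (Suc i) *\<^sub>v w | w. w \<in> free_module V (dim_col (D (Suc i)))}"
      unfolding ex using vec_fmod[OF u'] by blast
    also have "\<dots> \<longleftrightarrow> (\<exists>w\<in>fmod V {..<dim_col (D (Suc i))}. u = mat_diff (D (Suc i)) w)"
    proof -
      have "vec (dim_col (D i)) u = D (Suc i) *\<^sub>v vec (dim_col (D (Suc i))) w \<longleftrightarrow> u = mat_diff (D (Suc i)) w"
        if "w \<in> fmod V {..<dim_col (D (Suc i))}" for w
        using vec_inject[OF u' fm[OF that, unfolded row]] mat_diff_vec[of "D (Suc i)" w, unfolded row] by simp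
      then show ?thesis using vec_fmod free_module_vec by blast
    qed
    finally show "mat_diff (D i) u = 0 \<longleftrightarrow>
        (\<exists>w\<in>fmod V {..<dim_row (D (Suc (Suc i)))}. u = mat_diff (D (Suc i)) w)"
      unfolding row .
  qed simp
  show "minimal_differentials (\<lambda>i. {..<dim_row (D i)}) (\<lambda>i. mat_diff (D i))"
    unfolding minimal_differentials_def
  proof (intro allI ballI)
    fix i b a assume "b \<in> {..<dim_row (D (Suc (Suc i)))}"
    then have b: "b < dim_col (D (Suc i))" by (simp add: row)
    show "cf (mat_diff (D (Suc i)) (unitv b) a) 0 = 0"
      using min[OF entry[OF _ b]] by (simp add: mat_diff_unitv[OF b])
  qed
qed

text \<open>
  Enumerating the finite bases turns the differentials into matrices. The map \<open>tv i\<close> identifies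
  vectors on the basis \<open>B i\<close> with column vectors.
\<close>

lemma graded_to_matrix_resolution:
  fixes I :: "('v, 'k::field) mpoly set" and o0 :: 'b
  assumes res: "graded_resolution V I o0 B d \<Delta>" and min: "minimal_differentials B \<Delta>"
    and bound: "\<And>i. i \<ge> N \<Longrightarrow> B i = {}"
    and T: "\<And>i b. b \<in> B (Suc i) \<Longrightarrow> (i, d (Suc i) b) \<in> T"
  shows "resolved_within V I T"
proof -
  interpret graded_resolution V I o0 B d \<Delta> by (rule res)
  have "\<exists>f. bij_betw f {..<card (B i)} (B i)" for i
    using ex_bij_betw_nat_finite[OF finite_B[of i]] by (simp add: atLeast0LessThan)
  then obtain e where e: "\<And>i. bij_betw (e i) {..<card (B i)} (B i)" by metis
  have eB: "e i a \<in> B i" if "a < card (B i)" for i a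
    using bij_betwE[OF e[of i]] that by blast
  define D where "D i = mat (card (B i)) (card (B (Suc i))) (\<lambda>(a, b). \<Delta> i (unitv (e (Suc i) b)) (e i a))" for i
  define d' where "d' i b = d (Suc i) (e (Suc i) b)" for i b
  have dims: "dim_row (D i) = card (B i)" "dim_col (D i) = card (B (Suc i))" for i
    by (simp_all add: D_def)
  define tv where "tv i u = vec (card (B i)) (\<lambda>a. u (e i a))" for i and u :: "'b \<Rightarrow> ('v, 'k) mpoly"
  have tv_fm: "tv i u \<in> free_module V (card (B i))" if "u \<in> fmod V (B i)" for i u
    using fmod_coord_PR[OF that] by (simp add: tv_def free_module_def)
  have tv_surj: "\<exists>u\<in>fmod V (B i). w = tv i u" if w: "w \<in> free_module V (card (B i))" for i w
  proof (rule bexI)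
    let ?u = "\<lambda>x. if x \<in> B i then w $ inv_into {..<card (B i)} (e i) x else 0"
    have inv: "inv_into {..<card (B i)} (e i) x < card (B i)" if "x \<in> B i" for x
      using bij_betw_inv_into[OF e[of i]] that bij_betwE by fastforce
    show "?u \<in> fmod V (B i)" using w inv by (auto simp: fmod_def free_module_def)
    show "w = tv i ?u"
      using w eB bij_betw_inv_into_left[OF e[of i]]
      by (intro eq_vecI) (auto simp: tv_def free_module_def)
  qed
  have tv_inj: "u = v" if u: "u \<in> fmod V (B i)" and v: "v \<in> fmod V (B i)" and eq: "tv i u = tv i v" for i u v
  proof
    fix x show "u x = v x"
    proof (cases "x \<in> B i")
      case True
      then obtain a where a: "a < card (B i)" "x = e i a"
        using e[of i] unfolding bij_betw_def by blast
      then show ?thesis using arg_cong[OF eq, of "\<lambda>w. w $ a"] by (simp add: tv_def)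
    next
      case False
      then show ?thesis using fmod_outside[OF u] fmod_outside[OF v] by simp
    qed
  qed
  have tv_zero: "tv i 0 = 0\<^sub>v (card (B i))" for i
    by (rule eq_vecI) (auto simp: tv_def)
  have tv_\<Delta>: "tv i (\<Delta> i u) = D i *\<^sub>v tv (Suc i) u" if u: "u \<in> fmod V (B (Suc i))" for i u
  proof (rule eq_vecI)
    fix a assume "a < dim_vec (D i *\<^sub>v tv (Suc i) u)"
    then have a: "a < card (B i)" by (simp add: dims)
    have "\<Delta> i u (e i a) = (\<Sum>x\<in>B (Suc i). u x * \<Delta> i (unitv x) (e i a))"
      by (rule rlinear_coord_expand[OF lin u finite_B])
    also have "\<dots> = (\<Sum>b<card (B (Suc i)). u (e (Suc i) b) * \<Delta> i (unitv (e (Suc i) b)) (e i a))"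
      by (rule sum.reindex_bij_betw[OF e, symmetric])
    finally show "tv i (\<Delta> i u) $ a = (D i *\<^sub>v tv (Suc i) u) $ a"
      using a by (simp add: tv_def D_def scalar_prod_def lessThan_atLeast0 mult.commute)
  qed (simp add: tv_def dims)
  have e0: "card (B 0) = 1" "e 0 0 = o0"
    using eB[of 0 0] by (simp_all add: B_0)
  have "min_graded_resolution V I D d'"
    unfolding min_graded_resolution_def
  proof (intro conjI allI impI ballI)
    show "dim_row (D 0) = 1" using e0 by (simp add: dims)
    show "dim_row (D (Suc i)) = dim_col (D i)" for i by (simp add: dims)
    show "elements_mat (D i) \<subseteq> PR V" for i
    proof
      fix p assume "p \<in> elements_mat (D i)"
      then obtain a b where "a < card (B i)" "b < card (B (Suc i))" "p = D i $$ (a, b)"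
        unfolding elements_mat_def by (auto simp: dims)
      then show "p \<in> PR V" using fmod_coord_PR[OF gmapD(2)[OF gmap eB]] by (simp add: D_def)
    qed
    show "mon_degree m = d' 0 b" if "b < dim_col (D 0)" "m \<in> mons (D 0 $$ (0, b))" for b m
    proof -
      have b: "b < card (B (Suc 0))" using that(1) by (simp add: dims)
      have "m \<in> mons (\<Delta> 0 (unitv (e (Suc 0) b)) o0)" using that(2) b e0 by (simp add: D_def)
      then have "mon_degree m + d 0 o0 = d (Suc 0) (e (Suc 0) b)"
        using gmapD(3)[OF gmap eB[OF b]] unfolding homog_def by blast
      then show ?thesis by (simp add: d_0 d'_def)
    qed
    show "mon_degree m + d' i a = d' (Suc i) b"
      if "a < dim_row (D (Suc i))" "b < dim_col (D (Suc i))" "m \<in> mons (D (Suc i) $$ (a, b))" for i a b m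
    proof -
      have ab: "a < card (B (Suc i))" "b < card (B (Suc (Suc i)))" using that(1,2) by (simp_all add: dims)
      have "m \<in> mons (\<Delta> (Suc i) (unitv (e (Suc (Suc i)) b)) (e (Suc i) a))"
        using that(3) ab by (simp add: D_def)
      then show ?thesis
        using gmapD(3)[OF gmap eB[OF ab(2)]] unfolding homog_def d'_def by blast
    qed
    show "{(D 0 *\<^sub>v u) $ 0 | u. u \<in> free_module V (dim_col (D 0))} = I"
    proof -
      have val: "(D 0 *\<^sub>v tv (Suc 0) u) $ 0 = \<Delta> 0 u o0" if "u \<in> fmod V (B (Suc 0))" for u
        unfolding tv_\<Delta>[OF that, symmetric] using e0 by (simp add: tv_def)
      have "{(D 0 *\<^sub>v u) $ 0 | u. u \<in> free_module V (dim_col (D 0))} =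
          {(D 0 *\<^sub>v tv (Suc 0) u) $ 0 | u. u \<in> fmod V (B (Suc 0))}"
        unfolding dims using tv_fm tv_surj by blast
      also have "\<dots> = (\<lambda>u. \<Delta> 0 u o0) ` fmod V (B (Suc 0))"
        using val by (auto simp: image_iff) (metis val)
      finally show ?thesis using image by simp
    qed
    show "{D (Suc i) *\<^sub>v u | u. u \<in> free_module V (dim_col (D (Suc i)))} =
          {u \<in> free_module V (dim_col (D i)). D i *\<^sub>v u = 0\<^sub>v (dim_row (D i))}" for i
      unfolding dims
    proof (intro equalityI subsetI)
      fix y assume "y \<in> {D (Suc i) *\<^sub>v u | u. u \<in> free_module V (card (B (Suc (Suc i))))}"
      then obtain w where w: "w \<in> fmod V (B (Suc (Suc i)))" "y = D (Suc i) *\<^sub>v tv (Suc (Suc i)) w"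
        using tv_surj by blast
      have y: "y = tv (Suc i) (\<Delta> (Suc i) w)" using tv_\<Delta>[OF w(1)] w(2) by simp
      have "D i *\<^sub>v y = tv i (\<Delta> i (\<Delta> (Suc i) w))"
        unfolding y using tv_\<Delta>[OF differential_fmod[OF w(1)]] by simp
      also have "\<dots> = 0\<^sub>v (card (B i))" unfolding complex[OF w(1)] by (rule tv_zero)
      finally show "y \<in> {u \<in> free_module V (card (B (Suc i))). D i *\<^sub>v u = 0\<^sub>v (card (B i))}"
        using tv_fm[OF differential_fmod[OF w(1)]] y by simp
    next
      fix y assume "y \<in> {u \<in> free_module V (card (B (Suc i))). D i *\<^sub>v u = 0\<^sub>v (card (B i))}"
      then obtain u where u: "u \<in> fmod V (B (Suc i))" "y = tv (Suc i) u" "D i *\<^sub>v y = 0\<^sub>v (card (B i))"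
        using tv_surj by blast
      have "tv i (\<Delta> i u) = tv i 0" unfolding tv_\<Delta>[OF u(1)] tv_zero using u(2,3) by simp
      then have "\<Delta> i u = 0" by (rule tv_inj[OF differential_fmod[OF u(1)] fmod_zero])
      then obtain w where w: "w \<in> fmod V (B (Suc (Suc i)))" "u = \<Delta> (Suc i) w"
        using exactE[OF u(1)] by blast
      have "y = D (Suc i) *\<^sub>v tv (Suc (Suc i)) w" using tv_\<Delta>[OF w(1)] u(2) w(2) by simp
      then show "y \<in> {D (Suc i) *\<^sub>v u | u. u \<in> free_module V (card (B (Suc (Suc i))))}"
        using tv_fm[OF w(1)] by blast
    qed
    show "cf p 0 = 0" if p: "p \<in> elements_mat (D (Suc i))" for i p
    proof -
      obtain a b where "a < card (B (Suc i))" "b < card (B (Suc (Suc i)))" "p = D (Suc i) $$ (a, b)"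
        using p unfolding elements_mat_def by (auto simp: dims)
      then show ?thesis using min eB unfolding minimal_differentials_def by (simp add: D_def)
    qed
  qed
  moreover have "dim_col (D i) = 0" if "i \<ge> N" for i using bound[of "Suc i"] that by (simp add: dims)
  moreover have "(i, d' i b) \<in> T" if "b < dim_col (D i)" for i b
    using T[OF eB] that by (simp add: dims d'_def)
  ultimately show ?thesis unfolding resolved_within_def by blast
qed

lemma bounded_resolution_resolved_within:
  fixes I :: "('v, 'k::field) mpoly set" and o0 :: 'b
  assumes res: "graded_resolution V I o0 B d \<Delta>" and bound: "\<And>i. i \<ge> N \<Longrightarrow> B i = {}"
    and T: "\<And>i b. b \<in> B (Suc i) \<Longrightarrow> (i, d (Suc i) b) \<in> T"
  shows "resolved_within V I T"
proof -
  obtain B' \<Delta>' where B': "graded_resolution V I o0 B' d \<Delta>'" "minimal_differentials B' \<Delta>'" "\<And>i. B' i \<subseteq> B i"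
    using exists_minimal_subresolution[OF res bound] by blast
  show ?thesis
  proof (rule graded_to_matrix_resolution[OF B'(1,2)])
    show "B' i = {}" if "i \<ge> N" for i using B'(3)[of i] bound[OF that] by blast
    show "(i, d (Suc i) b) \<in> T" if "b \<in> B' (Suc i)" for i b using B'(3)[of "Suc i"] T that by blast
  qed
qed

lemma resolved_withinD:
  fixes I :: "('v, 'k::field) mpoly set"
  assumes "resolved_within V I T"
  shows "\<exists>(B :: nat \<Rightarrow> nat set) d \<Delta> N. graded_resolution V I 0 B d \<Delta> \<and>
    (\<forall>i\<ge>N. B i = {}) \<and> (\<forall>i. \<forall>b\<in>B (Suc i). (i, d (Suc i) b) \<in> T)"
proof -
  obtain D d N where D: "min_graded_resolution V I D d" "\<And>i. i \<ge> N \<Longrightarrow> dim_col (D i) = 0"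
    "\<And>i b. b < dim_col (D i) \<Longrightarrow> (i, d i b) \<in> T"
    using assms unfolding resolved_within_def by blast
  have row: "dim_row (D (Suc i)) = dim_col (D i)" for i
    using D(1) unfolding min_graded_resolution_def by (elim conjE) simp
  have "{..<dim_row (D i)} = {}" if "i \<ge> Suc N" for i
    using that D(2)[of "i - 1"] row[of "i - 1"] by simp
  moreover have "(i, case_nat (\<lambda>_. 0) d (Suc i) b) \<in> T" if "b \<in> {..<dim_row (D (Suc i))}" for i b
    using D(3) that by (simp add: row)
  ultimately show ?thesis
    using matrix_to_graded_resolution(1)[OF D(1)] by blast
qed

text \<open>
  The Betti numbers are read off from an arbitrarily chosen minimal resolution. The first claim
  makes this resolution available, and comparing it with one that witnesses \<open>resolved_within V I T\<close>
  yields the other two.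
\<close>

theorem betti_from_resolution:
  fixes I :: "('v, 'k::field) mpoly set"
  assumes "resolved_within V I T"
  shows "\<exists>(B :: nat \<Rightarrow> nat set) d \<Delta>. graded_resolution V I 0 B d \<Delta> \<and>
    (\<forall>i j. betti V I i j \<noteq> 0 \<longleftrightarrow> (\<exists>b\<in>B (Suc i). d (Suc i) b = j))"
    and "betti V I i j \<noteq> 0 \<Longrightarrow> (i, j) \<in> T"
    and "finite {(i, j). betti V I i j \<noteq> 0}"
proof -
  obtain D d where "min_graded_resolution V I D d" using assms unfolding resolved_within_def by blast
  then have "\<exists>x. case x of (D, d) \<Rightarrow> min_graded_resolution V I D d" by (intro exI[of _ "(D, d)"]) simp
  then have "case (SOME (D, d). min_graded_resolution V I D d) of (D, d) \<Rightarrow> min_graded_resolution V I D d"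
    by (rule someI_ex)
  then obtain D d where D: "(SOME (D, d). min_graded_resolution V I D d) = (D, d)"
    "min_graded_resolution V I D d" by (cases "SOME (D, d). min_graded_resolution V I D d") simp
  have row: "dim_row (D (Suc i)) = dim_col (D i)" for i
    using D(2) unfolding min_graded_resolution_def by (elim conjE) simp
  let ?B = "\<lambda>i. {..<dim_row (D i)}" and ?d = "case_nat (\<lambda>_. 0) d"
  have betti: "betti V I i j \<noteq> 0 \<longleftrightarrow> (\<exists>b\<in>?B (Suc i). ?d (Suc i) b = j)" for i j
    unfolding betti_def D(1) by (auto simp: row)
  note R = matrix_to_graded_resolution[OF D(2)]
  obtain B' :: "nat \<Rightarrow> nat set" and d' \<Delta>' N where R': "graded_resolution V I 0 B' d' \<Delta>'"
    "\<forall>i\<ge>N. B' i = {}" "\<forall>i. \<forall>b\<in>B' (Suc i). (i, d' (Suc i) b) \<in> T"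
    using resolved_withinD[OF assms] by (elim exE conjE)
  interpret R': graded_resolution V I 0 B' d' \<Delta>' by (rule R'(1))
  have le: "\<exists>c\<in>B' (Suc i). d' (Suc i) c = j" if "betti V I i j \<noteq> 0" for i j
    using that minimal_resolution_le[OF R(1) R'(1) R(2)] unfolding betti by blast
  show "\<exists>(B :: nat \<Rightarrow> nat set) d \<Delta>. graded_resolution V I 0 B d \<Delta> \<and>
    (\<forall>i j. betti V I i j \<noteq> 0 \<longleftrightarrow> (\<exists>b\<in>B (Suc i). d (Suc i) b = j))"
    by (rule exI[of _ ?B], rule exI[of _ ?d], rule exI[of _ "\<lambda>i. mat_diff (D i)"])
       (intro conjI allI R(1) betti)
  show "(i, j) \<in> T" if "betti V I i j \<noteq> 0" for i j using le[OF that] R'(3) by blast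
  have "{(i, j). betti V I i j \<noteq> 0} \<subseteq> (\<Union>i<N. (\<lambda>c. (i, d' (Suc i) c)) ` B' (Suc i))"
  proof (clarify)
    fix i j assume "0 < betti V I i j"
    then obtain c where c: "c \<in> B' (Suc i)" "d' (Suc i) c = j" using le[of i j] by auto
    have "i < N" using R'(2)[rule_format, of "Suc i"] c(1) by (cases "i < N") auto
    then show "(i, j) \<in> (\<Union>i<N. (\<lambda>c. (i, d' (Suc i) c)) ` B' (Suc i))" using c by auto
  qed
  then show "finite {(i, j). betti V I i j \<noteq> 0}"
    by (rule finite_subset) (auto simp: R'.finite_B)
qed

section \<open>The height of a squarefree monomial ideal\<close>

text \<open>
  Finite sets \<open>S\<close> and \<open>T\<close> of monomials contain elements whose product arises in no other way.
  Take the elements of maximal degree in one variable of \<open>W\<close>, restrict to them, and continue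
  with the next variable; the hypotheses on variables outside \<open>W\<close> say that those are exhausted.
\<close>

lemma unique_sum_of_monomials:
  fixes S T :: "('v \<Rightarrow>\<^sub>0 nat) set"
  assumes "finite W" "finite S" "S \<noteq> {}" "finite T" "T \<noteq> {}"
    and "\<And>s s' v. s \<in> S \<Longrightarrow> s' \<in> S \<Longrightarrow> v \<notin> W \<Longrightarrow> cf s v = cf s' v"
    and "\<And>t t' v. t \<in> T \<Longrightarrow> t' \<in> T \<Longrightarrow> v \<notin> W \<Longrightarrow> cf t v = cf t' v"
  shows "\<exists>s\<in>S. \<exists>t\<in>T. \<forall>s'\<in>S. \<forall>t'\<in>T. s' + t' = s + t \<longrightarrow> s' = s \<and> t' = t"
  using assms
proof (induction W arbitrary: S T rule: finite_induct)
  case empty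
  obtain s t where st: "s \<in> S" "t \<in> T" using empty.prems(2,4) by blast
  have "s' = s" if "s' \<in> S" for s'
    by (rule poly_mapping_eqI) (use empty.prems(5)[OF that st(1)] in simp)
  moreover have "t' = t" if "t' \<in> T" for t'
    by (rule poly_mapping_eqI) (use empty.prems(6)[OF that st(2)] in simp)
  ultimately show ?case using st by blast
next
  case (insert v W)
  define a where "a = Max ((\<lambda>s. cf s v) ` S)"
  define b where "b = Max ((\<lambda>t. cf t v) ` T)"
  define S' where "S' = {s \<in> S. cf s v = a}"
  define T' where "T' = {t \<in> T. cf t v = b}"
  have "a \<in> (\<lambda>s. cf s v) ` S" unfolding a_def using insert.prems(1,2) by (intro Max_in) auto
  then have S'ne: "S' \<noteq> {}" unfolding S'_def by blast
  have "b \<in> (\<lambda>t. cf t v) ` T" unfolding b_def using insert.prems(3,4) by (intro Max_in) auto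
  then have T'ne: "T' \<noteq> {}" unfolding T'_def by blast
  have le_a: "cf s v \<le> a" if "s \<in> S" for s
    unfolding a_def using insert.prems(1) that by (intro Max_ge) auto
  have le_b: "cf t v \<le> b" if "t \<in> T" for t
    unfolding b_def using insert.prems(3) that by (intro Max_ge) auto
  have "\<exists>s\<in>S'. \<exists>t\<in>T'. \<forall>s'\<in>S'. \<forall>t'\<in>T'. s' + t' = s + t \<longrightarrow> s' = s \<and> t' = t"
  proof (rule insert.IH[OF _ S'ne _ T'ne])
    show "finite S'" "finite T'" using insert.prems(1,3) by (simp_all add: S'_def T'_def)
    show "cf s u = cf s' u" if "s \<in> S'" "s' \<in> S'" "u \<notin> W" for s s' u
      using that insert.prems(5)[of s s' u] by (cases "u = v") (auto simp: S'_def)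
    show "cf t u = cf t' u" if "t \<in> T'" "t' \<in> T'" "u \<notin> W" for t t' u
      using that insert.prems(6)[of t t' u] by (cases "u = v") (auto simp: T'_def)
  qed
  then obtain s t where st: "s \<in> S'" "t \<in> T'"
    "\<And>s' t'. s' \<in> S' \<Longrightarrow> t' \<in> T' \<Longrightarrow> s' + t' = s + t \<Longrightarrow> s' = s \<and> t' = t" by blast
  have "s' = s \<and> t' = t" if "s' \<in> S" "t' \<in> T" "s' + t' = s + t" for s' t'
  proof -
    have "cf s' v + cf t' v = cf s v + cf t v"
      using arg_cong[OF that(3), of "\<lambda>m. cf m v"] by (simp add: lookup_add)
    also have "\<dots> = a + b" using st(1,2) by (simp add: S'_def T'_def)
    finally have "cf s' v = a" "cf t' v = b"
      using le_a[OF that(1)] le_b[OF that(2)] by linarith+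
    then have "s' \<in> S'" "t' \<in> T'" using that(1,2) by (simp_all add: S'_def T'_def)
    then show ?thesis using st(3) that(3) by blast
  qed
  moreover have "s \<in> S" "t \<in> T" using st(1,2) by (auto simp: S'_def T'_def)
  ultimately show ?case by blast
qed

text \<open>
  The coefficient at a product of monomials that arises only once is a product of two nonzero
  coefficients.
\<close>

lemma poly_ring_domain:
  fixes p q :: "('v, 'k::field) mpoly"
  assumes "finite V" "p \<in> PR V" "q \<in> PR V" "p \<noteq> 0" "q \<noteq> 0"
  shows "p * q \<noteq> 0"
proof -
  have out: "cf s v = 0" if "r \<in> PR V" "s \<in> mons r" "v \<notin> V" for r :: "('v, 'k) mpoly" and s v
  proof -
    have "v \<notin> mons s" using that unfolding poly_ring_carrier by blast
    then show ?thesis by (simp add: in_keys_iff)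
  qed
  have ne: "mons p \<noteq> {}" "mons q \<noteq> {}" using assms(4,5) by auto
  have eq: "cf s v = cf s' v" if "r \<in> PR V" "s \<in> mons r" "s' \<in> mons r" "v \<notin> V"
    for r :: "('v, 'k) mpoly" and s s' v
    using out[OF that(1,2,4)] out[OF that(1,3,4)] by simp
  obtain s t where st: "s \<in> mons p" "t \<in> mons q"
    "\<And>s' t'. s' \<in> mons p \<Longrightarrow> t' \<in> mons q \<Longrightarrow> s' + t' = s + t \<Longrightarrow> s' = s \<and> t' = t"
    using unique_sum_of_monomials[OF assms(1) finite_keys ne(1) finite_keys ne(2)
        eq[OF assms(2)] eq[OF assms(3)]] by blast
  have "p * q = (\<Sum>a\<in>mons p. \<Sum>b\<in>mons q. Poly_Mapping.single (a + b) (cf p a * cf q b))"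
  proof -
    have "p * q = (\<Sum>a\<in>mons p. Poly_Mapping.single a (cf p a)) * (\<Sum>b\<in>mons q. Poly_Mapping.single b (cf q b))"
      by (rule arg_cong2[of _ _ _ _ "(*)"]; rule poly_mapping_sum_single)
    then show ?thesis by (simp add: sum_product mult_single)
  qed
  then have "cf (p * q) (s + t) = (\<Sum>a\<in>mons p. \<Sum>b\<in>mons q. if a + b = s + t then cf p a * cf q b else 0)"
    by (simp add: lookup_sum lookup_single when_def)
  also have "\<dots> = (\<Sum>a\<in>mons p. \<Sum>b\<in>mons q. if a = s \<and> b = t then cf p a * cf q b else 0)"
    using st(3) by (intro sum.cong refl) (auto split: if_splits)
  also have "\<dots> = (\<Sum>a\<in>mons p. if a = s then cf p s * cf q t else 0)"
    using st(2) by (intro sum.cong refl) (auto simp: sum.delta)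
  also have "\<dots> = cf p s * cf q t"
    using st(1) by (simp add: sum.delta)
  finally have "cf (p * q) (s + t) \<noteq> 0" using st(1,2) by (simp add: in_keys_iff)
  then show ?thesis by auto
qed

definition var_ideal :: "'v set \<Rightarrow> 'v set \<Rightarrow> ('v, 'k::field) mpoly set" where
  "var_ideal V A = mon_ideal V ((\<lambda>v. {v}) ` A)"

lemma var_ideal_iff: "p \<in> var_ideal V A \<longleftrightarrow> p \<in> PR V \<and> (\<forall>m\<in>mons p. mons m \<inter> A \<noteq> {})"
proof -
  have "(\<exists>B\<in>(\<lambda>v. {v}) ` A. B \<subseteq> M) \<longleftrightarrow> M \<inter> A \<noteq> {}" for M by auto
  then show ?thesis by (simp add: var_ideal_def mon_ideal_def)
qed

lemma var_ideal_mono: "A \<subseteq> A' \<Longrightarrow> var_ideal V A \<subseteq> var_ideal V A'"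
  unfolding subset_iff var_ideal_iff by blast

lemma var_in_var_ideal: "v \<in> V \<Longrightarrow> (var v :: ('v, 'k::field) mpoly) \<in> var_ideal V A \<longleftrightarrow> v \<in> A"
  by (simp add: var_ideal_iff) (simp add: var_def)

lemma primeideal_iff:
  fixes P :: "('v, 'k::field) mpoly set"
  shows "primeideal P (poly_ring V) \<longleftrightarrow> ideal P (poly_ring V) \<and> 1 \<notin> P \<and>
    (\<forall>a\<in>PR V. \<forall>b\<in>PR V. a * b \<in> P \<longrightarrow> a \<in> P \<or> b \<in> P)"
proof
  assume P: "primeideal P (poly_ring V)"
  then interpret primeideal P "poly_ring V" .
  have "1 \<notin> P" using I_notcarr one_imp_carrier by auto
  then show "ideal P (poly_ring V) \<and> 1 \<notin> P \<and>
    (\<forall>a\<in>PR V. \<forall>b\<in>PR V. a * b \<in> P \<longrightarrow> a \<in> P \<or> b \<in> P)"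
    using I_prime ideal_axioms by auto
next
  assume a: "ideal P (poly_ring V) \<and> 1 \<notin> P \<and>
    (\<forall>a\<in>PR V. \<forall>b\<in>PR V. a * b \<in> P \<longrightarrow> a \<in> P \<or> b \<in> P)"
  show "primeideal P (poly_ring V)"
    by (rule primeidealI) (use a poly_ring_cring PR_one in auto)
qed

context
  fixes P :: "('v, 'k::field) mpoly set" and V
  assumes P: "ideal P (poly_ring V)"
begin

lemma ideal_sub: "p \<in> P \<Longrightarrow> p \<in> PR V"
  using additive_subgroup.a_subset[OF ideal.axioms(1)[OF P]] by blast

lemma ideal_plus: "p \<in> P \<Longrightarrow> q \<in> P \<Longrightarrow> p + q \<in> P"
  using additive_subgroup.a_closed[OF ideal.axioms(1)[OF P]] by simp

lemma ideal_zero: "0 \<in> P"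
  using additive_subgroup.zero_closed[OF ideal.axioms(1)[OF P]] by simp

lemma ideal_times: "p \<in> P \<Longrightarrow> q \<in> PR V \<Longrightarrow> q * p \<in> P"
  using ideal.I_l_closed[OF P] by simp

lemma ideal_minus: "p \<in> P \<Longrightarrow> q \<in> P \<Longrightarrow> p - q \<in> P"
  using ideal_plus[of p "- 1 * q"] ideal_times[of q "- 1"] by simp

end

text \<open>
  Modulo the ideal every polynomial is represented by its terms that avoid the variables in
  \<open>A\<close>, and the product of two such representatives is nonzero unless one of them is 0.
\<close>

lemma primeideal_var_ideal:
  assumes "finite V" "A \<subseteq> V"
  shows "primeideal (var_ideal V A :: ('v, 'k::field) mpoly set) (poly_ring V)"
  unfolding primeideal_iff
proof (intro conjI ballI impI)
  show id: "ideal (var_ideal V A :: ('v, 'k) mpoly set) (poly_ring V)"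
    unfolding var_ideal_def by (rule ideal_mon_ideal)
  show "(1 :: ('v, 'k) mpoly) \<notin> var_ideal V A"
    by (simp add: var_ideal_iff)
  fix a b :: "('v, 'k) mpoly" assume ab: "a \<in> PR V" "b \<in> PR V" "a * b \<in> var_ideal V A"
  let ?Q = "\<lambda>m::'v \<Rightarrow>\<^sub>0 nat. mons m \<inter> A = {}"
  define a' where "a' = mon_part ?Q a"
  define b' where "b' = mon_part ?Q b"
  define a'' where "a'' = mon_part (\<lambda>m. \<not> ?Q m) a"
  define b'' where "b'' = mon_part (\<lambda>m. \<not> ?Q m) b"
  have a: "a = a' + a''" and b: "b = b' + b''"
    unfolding a'_def a''_def b'_def b''_def by (rule mon_part_split)+
  have PRs: "a' \<in> PR V" "b' \<in> PR V" using ab by (simp_all add: a'_def b'_def)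
  have I: "a'' \<in> var_ideal V A" "b'' \<in> var_ideal V A"
    using ab by (auto simp: a''_def b''_def var_ideal_iff)
  have "a' * b' = a * b - (b * a'' + a' * b'')"
    by (simp add: a b algebra_simps)
  also have "\<dots> \<in> var_ideal V A"
    by (rule ideal_minus[OF id ab(3) ideal_plus[OF id ideal_times[OF id I(1) ab(2)] ideal_times[OF id I(2) PRs(1)]]])
  finally have "a' * b' \<in> var_ideal V A" .
  moreover have "mons m \<inter> A = {}" if m: "m \<in> mons (a' * b')" for m
  proof -
    obtain m1 m2 where "m1 \<in> mons a'" "m2 \<in> mons b'" "m = m1 + m2"
      using m by (rule keys_mult_obtain)
    then show ?thesis by (auto simp: a'_def b'_def keys_add_nat)
  qed
  ultimately have "mons (a' * b') = {}" unfolding var_ideal_iff by blast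
  then have "a' * b' = 0" by simp
  then have "a' = 0 \<or> b' = 0" using poly_ring_domain[OF assms(1) PRs] by blast
  then show "a \<in> var_ideal V A \<or> b \<in> var_ideal V A"
    using a b I by auto
qed

abbreviation scalar :: "'k::field \<Rightarrow> ('v, 'k) mpoly" where
  "scalar c \<equiv> Poly_Mapping.single 0 c"

interpretation mpoly_space: vector_space "\<lambda>c (p :: ('v, 'k::field) mpoly). scalar c * p"
  by unfold_locales (simp_all add: algebra_simps single_add mult_single mult.assoc[symmetric])

definition lists_below :: "nat \<Rightarrow> nat \<Rightarrow> nat list set" where
  "lists_below n N = {\<alpha>. set \<alpha> \<subseteq> {..<N} \<and> length \<alpha> = n}"

lemma lists_below: "finite (lists_below n N)" "card (lists_below n N) = N ^ n"
  unfolding lists_below_def using finite_lists_length_eq[of "{..<N}" n] card_lists_length_eq[of "{..<N}" n]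
  by simp_all

definition power_product :: "'a::comm_monoid_mult list \<Rightarrow> nat list \<Rightarrow> 'a" where
  "power_product fs \<alpha> = prod_list (map2 (^) fs \<alpha>)"

definition exp_bounded :: "'v set \<Rightarrow> nat \<Rightarrow> ('v, 'k::field) mpoly \<Rightarrow> bool" where
  "exp_bounded V D p \<longleftrightarrow> (\<forall>m\<in>mons p. mons m \<subseteq> V \<and> (\<forall>v. cf m v \<le> D))"

lemma exp_bounded_mult:
  assumes "exp_bounded V D p" "exp_bounded V D' q"
  shows "exp_bounded V (D + D') (p * q)"
  unfolding exp_bounded_def
proof
  fix m assume "m \<in> mons (p * q)"
  then obtain a b where ab: "a \<in> mons p" "b \<in> mons q" "m = a + b" by (rule keys_mult_obtain)
  have 1: "mons a \<subseteq> V" "\<And>v. cf a v \<le> D" using assms(1) ab(1) unfolding exp_bounded_def by blast+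
  have 2: "mons b \<subseteq> V" "\<And>v. cf b v \<le> D'" using assms(2) ab(2) unfolding exp_bounded_def by blast+
  show "mons m \<subseteq> V \<and> (\<forall>v. cf m v \<le> D + D')"
    using 1 2 by (simp add: ab(3) keys_add_nat lookup_add add_mono)
qed

lemma exp_bounded_one: "exp_bounded V 0 1"
  by (simp add: exp_bounded_def)

lemma exp_bounded_power: "exp_bounded V D p \<Longrightarrow> exp_bounded V (n * D) (p ^ n)"
  by (induction n) (auto intro: exp_bounded_one exp_bounded_mult)

lemma exp_bounded_mono: "exp_bounded V D p \<Longrightarrow> D \<le> D' \<Longrightarrow> exp_bounded V D' p"
  unfolding exp_bounded_def using le_trans by blast

lemma exp_bounded_power_product:
  assumes "\<forall>f\<in>set fs. exp_bounded V D f" "length \<alpha> = length fs" "set \<alpha> \<subseteq> {..<N}"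
  shows "exp_bounded V (length fs * (N * D)) (power_product fs \<alpha>)"
  using assms
proof (induction fs arbitrary: \<alpha>)
  case Nil
  then show ?case by (simp add: power_product_def exp_bounded_one)
next
  case (Cons f fs)
  then obtain a \<beta> where \<alpha>: "\<alpha> = a # \<beta>" by (cases \<alpha>) auto
  have "exp_bounded V (a * D) (f ^ a)" using Cons.prems by (intro exp_bounded_power) simp
  moreover have "a * D \<le> N * D" using Cons.prems(3) \<alpha> by (intro mult_le_mono1) simp
  ultimately have 1: "exp_bounded V (N * D) (f ^ a)" by (rule exp_bounded_mono)
  have 2: "exp_bounded V (length fs * (N * D)) (power_product fs \<beta>)"
    using Cons.prems \<alpha> by (intro Cons.IH) auto
  have "power_product (f # fs) \<alpha> = f ^ a * power_product fs \<beta>"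
    by (simp add: power_product_def \<alpha>)
  then show ?case using exp_bounded_mult[OF 1 2] by simp
qed

lemma bounded_monomials:
  assumes "finite V"
  shows "finite {m :: 'v \<Rightarrow>\<^sub>0 nat. mons m \<subseteq> V \<and> (\<forall>v. cf m v \<le> D)}" (is "finite ?M")
    and "card {m :: 'v \<Rightarrow>\<^sub>0 nat. mons m \<subseteq> V \<and> (\<forall>v. cf m v \<le> D)} \<le> (D + 1) ^ card V"
proof -
  let ?f = "\<lambda>m::'v \<Rightarrow>\<^sub>0 nat. \<lambda>v\<in>V. cf m v"
  have inj: "inj_on ?f ?M"
  proof (rule inj_onI)
    fix m n assume mn: "m \<in> ?M" "n \<in> ?M" "?f m = ?f n"
    show "m = n"
    proof (rule poly_mapping_eqI)
      fix v show "cf m v = cf n v"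
      proof (cases "v \<in> V")
        case True
        then show ?thesis using fun_cong[OF mn(3), of v] by simp
      next
        case False
        then have "v \<notin> mons m" "v \<notin> mons n" using mn(1,2) by auto
        then show ?thesis by (simp add: in_keys_iff)
      qed
    qed
  qed
  have sub: "?f ` ?M \<subseteq> (\<Pi>\<^sub>E v\<in>V. {..D})" by auto
  have fin: "finite (\<Pi>\<^sub>E v\<in>V. {..D})" using assms by (intro finite_PiE) auto
  show "finite ?M" using finite_imageD[OF finite_subset[OF sub fin] inj] .
  have "card ?M = card (?f ` ?M)" using card_image[OF inj] by simp
  also have "\<dots> \<le> card (\<Pi>\<^sub>E v\<in>V. {..D})" by (rule card_mono[OF fin sub])
  also have "\<dots> = (D + 1) ^ card V" using assms by (simp add: card_PiE)
  finally show "card ?M \<le> (D + 1) ^ card V" .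
qed

text \<open>
  More polynomials than variables are algebraically dependent. This is a count: there are
  \<open>N ^ (n + 1)\<close> products of powers with exponents below \<open>N\<close> of \<open>n + 1\<close> polynomials, but the
  exponents of their monomials are bounded by a multiple of \<open>N\<close>, so they lie in a space whose
  dimension is at most a constant times \<open>N ^ n\<close>.
\<close>

lemma algebraic_dependence:
  fixes fs :: "('v, 'k::field) mpoly list"
  assumes V: "finite V" and fs: "set fs \<subseteq> PR V" and len: "length fs = Suc (card V)"
  shows "\<exists>S c. finite S \<and> S \<noteq> {} \<and> (\<forall>\<alpha>\<in>S. length \<alpha> = length fs \<and> c \<alpha> \<noteq> 0) \<and>
    (\<Sum>\<alpha>\<in>S. scalar (c \<alpha>) * power_product fs \<alpha>) = 0"
proof -
  have "\<exists>D. \<forall>f\<in>set fs. exp_bounded V D f"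
  proof -
    have "\<exists>D. exp_bounded V D f" if f: "f \<in> set fs" for f
    proof -
      let ?D = "Max (insert 0 ((\<lambda>(m, v). cf m v) ` (mons f \<times> V)))"
      have "cf m v \<le> ?D" if m: "m \<in> mons f" for m v
      proof (cases "v \<in> V")
        case True
        then show ?thesis using m V by (intro Max_ge) force+
      next
        case False
        moreover have "f \<in> PR V" using fs f by blast
        ultimately have "v \<notin> mons m" using m unfolding poly_ring_carrier by blast
        then show ?thesis by (simp add: in_keys_iff)
      qed
      moreover have "mons m \<subseteq> V" if "m \<in> mons f" for m
      proof -
        have "f \<in> PR V" using fs f by blast
        then show ?thesis using that unfolding poly_ring_carrier by blast
      qed
      ultimately show ?thesis unfolding exp_bounded_def by blast
    qed
    then obtain D where D: "\<And>f. f \<in> set fs \<Longrightarrow> exp_bounded V (D f) f" by metis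
    have "exp_bounded V (sum D (set fs)) f" if "f \<in> set fs" for f
      by (rule exp_bounded_mono[OF D[OF that]], rule member_le_sum[OF that]) simp_all
    then show ?thesis by blast
  qed
  then obtain D where D: "\<forall>f\<in>set fs. exp_bounded V D f" by blast
  define n where "n = card V"
  \<comment> \<open>The products lie in a space of dimension at most \<open>(N * a) ^ n\<close>; the value of \<open>N\<close> makes this less than \<open>N ^ (n + 1)\<close>.\<close>
  define a where "a = Suc n * D + 1"
  define N where "N = a ^ n + 1"
  let ?A = "lists_below (Suc n) N"
  let ?M = "{m :: 'v \<Rightarrow>\<^sub>0 nat. mons m \<subseteq> V \<and> (\<forall>v. cf m v \<le> Suc n * (N * D))}"
  let ?T = "(\<lambda>m. Poly_Mapping.single m (1::'k)) ` ?M"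
  let ?g = "power_product fs"
  have finT: "finite ?T" using bounded_monomials(1)[OF V] by blast
  have "card ?T \<le> card ?M" using bounded_monomials(1)[OF V] by (rule card_image_le)
  also have "\<dots> \<le> (Suc n * (N * D) + 1) ^ n" using bounded_monomials(2)[OF V] by (simp add: n_def)
  also have "\<dots> \<le> (N * a) ^ n"
    by (rule power_mono) (simp_all add: a_def N_def algebra_simps)
  also have "\<dots> = N ^ n * a ^ n" by (rule power_mult_distrib)
  also have "\<dots> < N ^ n * N" by (simp add: N_def)
  also have "\<dots> = card ?A" using lists_below(2) by simp
  finally have card: "card ?T < card ?A" .
  have span: "?g \<alpha> \<in> mpoly_space.span ?T" if "\<alpha> \<in> ?A" for \<alpha>
  proof -
    have "exp_bounded V (length fs * (N * D)) (?g \<alpha>)"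
      using that by (intro exp_bounded_power_product[OF D]) (auto simp: lists_below_def len n_def)
    then have "m \<in> ?M" if "m \<in> mons (?g \<alpha>)" for m
      using that unfolding exp_bounded_def len n_def by blast
    then have "(\<Sum>m\<in>mons (?g \<alpha>). scalar (cf (?g \<alpha>) m) * Poly_Mapping.single m 1) \<in> mpoly_space.span ?T"
      by (intro mpoly_space.span_sum mpoly_space.span_scale mpoly_space.span_base) blast
    then have "(\<Sum>m\<in>mons (?g \<alpha>). Poly_Mapping.single m (cf (?g \<alpha>) m)) \<in> mpoly_space.span ?T"
      by (simp add: mult_single)
    then show ?thesis unfolding poly_mapping_sum_single[symmetric] .
  qed
  show ?thesis
  proof (cases "inj_on ?g ?A")
    case False
    then obtain \<alpha> \<beta> where ab: "\<alpha> \<in> ?A" "\<beta> \<in> ?A" "\<alpha> \<noteq> \<beta>" "?g \<alpha> = ?g \<beta>"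
      unfolding inj_on_def by blast
    let ?c = "\<lambda>\<gamma>. if \<gamma> = \<alpha> then 1 else - 1 :: 'k"
    have "(\<Sum>\<gamma>\<in>{\<alpha>, \<beta>}. scalar (?c \<gamma>) * ?g \<gamma>) = 0"
      using ab(3,4) by (simp add: single_uminus)
    moreover have "\<forall>\<gamma>\<in>{\<alpha>, \<beta>}. length \<gamma> = length fs \<and> ?c \<gamma> \<noteq> 0"
      using ab(1,2) by (auto simp: lists_below_def len n_def)
    ultimately show ?thesis by (intro exI[of _ "{\<alpha>, \<beta>}"] exI[of _ ?c]) simp
  next
    case True
    have "mpoly_space.dependent (?g ` ?A)"
    proof (rule ccontr)
      assume "\<not> mpoly_space.dependent (?g ` ?A)"
      from mpoly_space.independent_span_bound[OF finT this] span
      have "card (?g ` ?A) \<le> card ?T" by blast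
      then show False using card card_image[OF True] by simp
    qed
    then have "\<exists>U u. finite U \<and> U \<subseteq> ?g ` ?A \<and> (\<Sum>w\<in>U. scalar (u w) * w) = 0 \<and> (\<exists>w\<in>U. u w \<noteq> 0)"
      unfolding mpoly_space.dependent_explicit .
    then obtain U u where U: "finite U" "U \<subseteq> ?g ` ?A" "(\<Sum>w\<in>U. scalar (u w) * w) = 0" "\<exists>w\<in>U. u w \<noteq> 0"
      by (elim exE conjE)
    define S where "S = {\<alpha> \<in> ?A. ?g \<alpha> \<in> U \<and> u (?g \<alpha>) \<noteq> 0}"
    have finS: "finite S" unfolding S_def by (rule finite_subset[OF _ lists_below(1)[of "Suc n" N]]) blast
    have "(\<Sum>\<alpha>\<in>S. scalar (u (?g \<alpha>)) * ?g \<alpha>) = (\<Sum>w\<in>?g ` S. scalar (u w) * w)"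
      using inj_on_subset[OF True, of S] by (subst sum.reindex) (auto simp: S_def)
    also have "\<dots> = (\<Sum>w\<in>U. scalar (u w) * w)"
    proof (rule sum.mono_neutral_left[OF U(1)])
      show "?g ` S \<subseteq> U" by (auto simp: S_def)
      show "\<forall>w\<in>U - ?g ` S. scalar (u w) * w = 0" using U(2) by (force simp: S_def)
    qed
    finally have "(\<Sum>\<alpha>\<in>S. scalar (u (?g \<alpha>)) * ?g \<alpha>) = 0" using U(3) by simp
    moreover have "S \<noteq> {}" using U(2,4) by (force simp: S_def)
    moreover have "\<forall>\<alpha>\<in>S. length \<alpha> = length fs \<and> u (?g \<alpha>) \<noteq> 0"
      by (auto simp: S_def lists_below_def len n_def)
    ultimately show ?thesis using finS by (intro exI[of _ S] exI[of _ "\<lambda>\<alpha>. u (?g \<alpha>)"]) blast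
  qed
qed

lemma prime_power_notin:
  fixes f :: "('v, 'k::field) mpoly"
  assumes "primeideal P (poly_ring V)" "f \<in> PR V" "f \<notin> P"
  shows "f ^ m \<notin> P"
  using assms by (induction m) (auto simp: primeideal_iff)

text \<open>
  In a relation \<open>\<Sum>\<^sub>\<alpha> c\<^sub>\<alpha> f\<^sup>\<alpha> \<in> Q\<^sub>k\<close> factor out the lowest power of the first polynomial \<open>f\<close>. It can
  be cancelled because \<open>f \<notin> Q\<^sub>k\<close>. All terms in which \<open>f\<close> still occurs lie in \<open>Q\<^sub>k\<^sub>+\<^sub>1\<close>, so the other
  terms form a relation between the remaining polynomials in \<open>Q\<^sub>k\<^sub>+\<^sub>1\<close>. At the end a nonzero
  constant would lie in a prime ideal.
\<close>

lemma nonzero_combination_notin_chain: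
  fixes fs :: "('v, 'k::field) mpoly list" and Q :: "nat \<Rightarrow> ('v, 'k) mpoly set"
  assumes "\<And>i. i \<le> k + length fs \<Longrightarrow> primeideal (Q i) (poly_ring V)"
    and "\<And>i. i < k + length fs \<Longrightarrow> Q i \<subseteq> Q (Suc i)"
    and "\<And>i. i < length fs \<Longrightarrow> fs ! i \<in> Q (Suc (k + i)) \<and> fs ! i \<notin> Q (k + i)"
    and "finite S" "S \<noteq> {}" "\<And>\<alpha>. \<alpha> \<in> S \<Longrightarrow> length \<alpha> = length fs \<and> c \<alpha> \<noteq> 0"
  shows "(\<Sum>\<alpha>\<in>S. scalar (c \<alpha>) * power_product fs \<alpha>) \<notin> Q k"
  using assms
proof (induction fs arbitrary: k S c)
  case Nil
  have S: "S = {[]}" using Nil.prems(5,6) by auto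
  have P: "primeideal (Q k) (poly_ring V)" using Nil.prems(1)[of k] by simp
  then have id: "ideal (Q k) (poly_ring V)" and one: "1 \<notin> Q k" by (simp_all add: primeideal_iff)
  show ?case
  proof
    assume "(\<Sum>\<alpha>\<in>S. scalar (c \<alpha>) * power_product [] \<alpha>) \<in> Q k"
    then have "scalar (c []) \<in> Q k" by (simp add: S power_product_def)
    then have "scalar (inverse (c [])) * scalar (c []) \<in> Q k"
      by (rule ideal_times[OF id]) simp
    then show False using one Nil.prems(6)[of "[]"] by (simp add: S mult_single)
  qed
next
  case (Cons f fs)
  have P: "primeideal (Q k) (poly_ring V)" "primeideal (Q (Suc k)) (poly_ring V)"
    using Cons.prems(1) by simp_all
  then have id: "ideal (Q k) (poly_ring V)" "ideal (Q (Suc k)) (poly_ring V)"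
    by (simp_all add: primeideal_iff)
  have f: "f \<in> Q (Suc k)" "f \<notin> Q k" using Cons.prems(3)[of 0] by simp_all
  then have fR: "f \<in> PR V" using ideal_sub[OF id(2)] by blast
  have fsR: "g \<in> PR V" if g: "g \<in> set fs" for g
  proof -
    obtain i where i: "i < length fs" "g = fs ! i" using g by (auto simp: in_set_conv_nth)
    then have "g \<in> Q (Suc (k + Suc i))" using Cons.prems(3)[of "Suc i"] by simp
    moreover have "ideal (Q (Suc (k + Suc i))) (poly_ring V)"
      using Cons.prems(1)[of "Suc (k + Suc i)"] i(1) by (simp add: primeideal_iff)
    ultimately show ?thesis using ideal_sub by blast
  qed
  have ppR: "power_product fs \<beta> \<in> PR V" for \<beta>
    using fsR
  proof (induction fs arbitrary: \<beta>)
    case Nil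
    then show ?case by (simp add: power_product_def)
  next
    case (Cons g gs)
    then show ?case by (cases \<beta>) (simp_all add: power_product_def)
  qed
  define m where "m = Min (hd ` S)"
  have hd: "m \<le> hd \<alpha>" if "\<alpha> \<in> S" for \<alpha> using that Cons.prems(4) by (simp add: m_def)
  have "m \<in> hd ` S" unfolding m_def using Cons.prems(4,5) by (intro Min_in) auto
  then obtain \<alpha>0 where \<alpha>0: "\<alpha>0 \<in> S" "hd \<alpha>0 = m" by blast
  have split: "\<alpha> = hd \<alpha> # tl \<alpha>" "length (tl \<alpha>) = length fs" if "\<alpha> \<in> S" for \<alpha>
    using Cons.prems(6)[OF that] by (cases \<alpha>; simp)+
  define T where "T = {\<beta>. m # \<beta> \<in> S}"
  define S1 where "S1 = {\<alpha> \<in> S. hd \<alpha> \<noteq> m}"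
  have finT: "finite T"
    by (rule finite_subset[OF _ finite_imageI[OF Cons.prems(4), of tl]]) (force simp: T_def)
  have S0: "{\<alpha> \<in> S. hd \<alpha> = m} = (#) m ` T"
  proof (intro equalityI subsetI)
    fix \<alpha> assume "\<alpha> \<in> {\<alpha> \<in> S. hd \<alpha> = m}"
    then have "\<alpha> = m # tl \<alpha>" "m # tl \<alpha> \<in> S" using split(1)[of \<alpha>] by simp_all
    then show "\<alpha> \<in> (#) m ` T" unfolding T_def by blast
  qed (auto simp: T_def)
  define p where "p = (\<Sum>\<beta>\<in>T. scalar (c (m # \<beta>)) * power_product fs \<beta>)"
  define r where "r = (\<Sum>\<alpha>\<in>S1. scalar (c \<alpha>) * (f ^ (hd \<alpha> - Suc m) * power_product fs (tl \<alpha>)))"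
  have pR: "p \<in> PR V" unfolding p_def using ppR by (intro PR_sum PR_mult) auto
  have rR: "r \<in> PR V" unfolding r_def using ppR fR by (intro PR_sum PR_mult) auto
  let ?t = "\<lambda>\<alpha>. scalar (c \<alpha>) * power_product (f # fs) \<alpha>"
  have cons: "power_product (f # fs) (a # \<beta>) = f ^ a * power_product fs \<beta>" for a \<beta>
    by (simp add: power_product_def)
  have t: "?t \<alpha> = f ^ m * (f * (scalar (c \<alpha>) * (f ^ (hd \<alpha> - Suc m) * power_product fs (tl \<alpha>))))"
    if "\<alpha> \<in> S1" for \<alpha>
  proof -
    have \<alpha>: "\<alpha> \<in> S" "m < hd \<alpha>" using that hd[of \<alpha>] by (auto simp: S1_def)
    then have "f ^ hd \<alpha> = f ^ m * (f * f ^ (hd \<alpha> - Suc m))"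
      by (simp add: power_add[symmetric] power_Suc[symmetric] del: power_Suc)
    moreover have "power_product (f # fs) \<alpha> = f ^ hd \<alpha> * power_product fs (tl \<alpha>)"
      using cons[of "hd \<alpha>" "tl \<alpha>"] split(1)[OF \<alpha>(1)] by simp
    ultimately show ?thesis by (simp add: mult_ac)
  qed
  have "(\<Sum>\<alpha>\<in>S. ?t \<alpha>) = (\<Sum>\<alpha>\<in>{\<alpha> \<in> S. hd \<alpha> = m}. ?t \<alpha>) + (\<Sum>\<alpha>\<in>S1. ?t \<alpha>)"
    unfolding S1_def using Cons.prems(4)
    by (subst sum.union_disjoint[symmetric]) (auto intro: sum.cong)
  also have "(\<Sum>\<alpha>\<in>{\<alpha> \<in> S. hd \<alpha> = m}. ?t \<alpha>) = f ^ m * p"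
    unfolding S0 p_def sum_distrib_left
    by (subst sum.reindex) (simp_all add: inj_on_def cons mult_ac)
  also have "(\<Sum>\<alpha>\<in>S1. ?t \<alpha>) = f ^ m * (f * r)"
    unfolding r_def sum_distrib_left by (intro sum.cong refl t)
  finally have total: "(\<Sum>\<alpha>\<in>S. ?t \<alpha>) = f ^ m * (p + f * r)" by (simp add: distrib_left)
  show ?case
  proof
    assume "(\<Sum>\<alpha>\<in>S. ?t \<alpha>) \<in> Q k"
    then have "f ^ m * (p + f * r) \<in> Q k" unfolding total .
    moreover have "p + f * r \<in> PR V" using pR rR fR by simp
    ultimately have "p + f * r \<in> Q k"
      using P(1) prime_power_notin[OF P(1) fR f(2)] fR unfolding primeideal_iff by (meson PR_power)
    then have "p + f * r \<in> Q (Suc k)" using Cons.prems(2)[of k] by auto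
    moreover have "r * f \<in> Q (Suc k)" by (rule ideal_times[OF id(2) f(1) rR])
    ultimately have "p + f * r - r * f \<in> Q (Suc k)" by (rule ideal_minus[OF id(2)])
    then have "p \<in> Q (Suc k)" by (simp add: mult.commute)
    moreover have "p \<notin> Q (Suc k)"
      unfolding p_def
    proof (rule Cons.IH[OF _ _ _ finT])
      show "primeideal (Q i) (poly_ring V)" if "i \<le> Suc k + length fs" for i
        using Cons.prems(1) that by simp
      show "Q i \<subseteq> Q (Suc i)" if "i < Suc k + length fs" for i
        using Cons.prems(2) that by simp
      show "fs ! i \<in> Q (Suc (Suc k + i)) \<and> fs ! i \<notin> Q (Suc k + i)" if "i < length fs" for i
        using Cons.prems(3)[of "Suc i"] that by simp
      have "m # tl \<alpha>0 = \<alpha>0" using split(1)[OF \<alpha>0(1)] unfolding \<alpha>0(2) by (rule sym)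
      then have "tl \<alpha>0 \<in> T" using \<alpha>0(1) by (simp add: T_def)
      then show "T \<noteq> {}" by blast
      show "length \<beta> = length fs \<and> c (m # \<beta>) \<noteq> 0" if "\<beta> \<in> T" for \<beta>
        using Cons.prems(6)[of "m # \<beta>"] that unfolding T_def by simp
    qed
    ultimately show False by blast
  qed
qed

text \<open>
  The polynomial ring in \<open>n\<close> variables has Krull dimension at most \<open>n\<close>: elements chosen from
  the successive differences of a longer chain would be algebraically dependent, against
  \<open>nonzero_combination_notin_chain\<close>.
\<close>

lemma prime_chain_length_le:
  fixes Q :: "nat \<Rightarrow> ('v, 'k::field) mpoly set"
  assumes V: "finite V" and Q: "\<And>i. i \<le> n \<Longrightarrow> primeideal (Q i) (poly_ring V)"
    and strict: "\<And>i. i < n \<Longrightarrow> Q i \<subset> Q (Suc i)"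
  shows "n \<le> card V"
proof (rule ccontr)
  assume "\<not> n \<le> card V"
  then have n: "Suc (card V) \<le> n" by simp
  have "\<exists>f. f \<in> Q (Suc i) \<and> f \<notin> Q i" if "i < n" for i
    using strict[OF that] by blast
  then obtain f where f: "\<And>i. i < n \<Longrightarrow> f i \<in> Q (Suc i) \<and> f i \<notin> Q i" by metis
  define fs where "fs = map f [0..<Suc (card V)]"
  have len: "length fs = Suc (card V)" by (simp add: fs_def)
  have nth: "fs ! i = f i" if "i < length fs" for i
    using that unfolding fs_def by (simp del: upt_Suc)
  have "f i \<in> PR V" if "i < n" for i
  proof -
    have "ideal (Q (Suc i)) (poly_ring V)" using Q[of "Suc i"] that by (simp add: primeideal_iff)
    then show ?thesis using f[OF that] by (intro ideal_sub) blast+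
  qed
  then have "set fs \<subseteq> PR V" using n by (auto simp: fs_def simp del: upt_Suc)
  from algebraic_dependence[OF V this len] obtain S c where S: "finite S" "S \<noteq> {}"
    "\<And>\<alpha>. \<alpha> \<in> S \<Longrightarrow> length \<alpha> = length fs \<and> c \<alpha> \<noteq> 0"
    "(\<Sum>\<alpha>\<in>S. scalar (c \<alpha>) * power_product fs \<alpha>) = 0" by blast
  have "(\<Sum>\<alpha>\<in>S. scalar (c \<alpha>) * power_product fs \<alpha>) \<notin> Q 0"
  proof (rule nonzero_combination_notin_chain[OF _ _ _ S(1-3)])
    show "primeideal (Q i) (poly_ring V)" if "i \<le> 0 + length fs" for i
      using that n len by (intro Q) simp
    show "Q i \<subseteq> Q (Suc i)" if "i < 0 + length fs" for i
      using that n len strict[of i] by auto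
    show "fs ! i \<in> Q (Suc (0 + i)) \<and> fs ! i \<notin> Q (0 + i)" if "i < length fs" for i
      using that n len f[of i] nth[OF that] by simp
  qed
  moreover have "0 \<in> Q 0" using Q[of 0] by (intro ideal_zero[of _ V]) (simp add: primeideal_iff)
  ultimately show False using S(4) by simp
qed

definition prime_chain_lengths :: "('a, 'b) ring_scheme \<Rightarrow> 'a set \<Rightarrow> nat set" where
  "prime_chain_lengths R P = {n. \<exists>Q :: nat \<Rightarrow> 'a set. (\<forall>i \<le> n. primeideal (Q i) R) \<and>
                  (\<forall>i < n. Q i \<subset> Q (Suc i)) \<and> Q n = P}"

lemma var_ideal_strict:
  assumes "A \<subset> A'" "A' \<subseteq> V"
  shows "(var_ideal V A :: ('v, 'k::field) mpoly set) \<subset> var_ideal V A'"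
proof -
  obtain v where "v \<in> A'" "v \<notin> A" using assms(1) by blast
  then have "(var v :: ('v, 'k) mpoly) \<in> var_ideal V A'" "(var v :: ('v, 'k) mpoly) \<notin> var_ideal V A"
    using var_in_var_ideal[of v V] assms(2) by auto
  then show ?thesis using var_ideal_mono[of A A' V] assms(1) by blast
qed

lemma set_take_strict: "distinct xs \<Longrightarrow> i < length xs \<Longrightarrow> set (take i xs) \<subset> set (take (Suc i) xs)"
  using distinct_take[of xs "Suc i"] by (auto simp: take_Suc_conv_app_nth)

text \<open>
  Adding the variables in \<open>C\<close> one after the other gives a chain of primes below \<open>P\<close>; the last
  member of this chain is replaced by \<open>P\<close>.
\<close>

lemma prime_chain_below:
  fixes P :: "('v, 'k::field) mpoly set"
  assumes V: "finite V" and P: "primeideal P (poly_ring V)" and C: "C \<subseteq> V" "var_ideal V C \<subseteq> P"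
  shows "card C \<in> prime_chain_lengths (poly_ring V) P"
proof -
  have "finite C" using V C(1) finite_subset by blast
  then obtain cs where cs: "set cs = C" "distinct cs" using finite_distinct_list by blast
  have len: "length cs = card C" using cs distinct_card by metis
  define Q where "Q i = (if i < card C then var_ideal V (set (take i cs)) else P)" for i
  have prime: "primeideal (Q i) (poly_ring V)" for i
  proof -
    have "set (take i cs) \<subseteq> V" using set_take_subset[of i cs] cs(1) C(1) by blast
    then have "primeideal (var_ideal V (set (take i cs)) :: ('v, 'k) mpoly set) (poly_ring V)"
      by (rule primeideal_var_ideal[OF V])
    then show ?thesis using P by (simp add: Q_def)
  qed
  moreover have "Q i \<subset> Q (Suc i)" if i: "i < card C" for i
  proof -
    have "set (take (Suc i) cs) \<subseteq> C" using set_take_subset[of "Suc i" cs] cs(1) by blast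
    then have "var_ideal V (set (take i cs)) \<subset> (var_ideal V (set (take (Suc i) cs)) :: ('v, 'k) mpoly set)"
      using set_take_strict[OF cs(2)] i len C(1) by (intro var_ideal_strict) auto
    moreover have "(var_ideal V (set (take (Suc i) cs)) :: ('v, 'k) mpoly set) \<subseteq> var_ideal V C"
      using \<open>set (take (Suc i) cs) \<subseteq> C\<close> by (rule var_ideal_mono)
    ultimately show ?thesis using i C(2) by (auto simp: Q_def)
  qed
  moreover have "Q (card C) = P" by (simp add: Q_def)
  ultimately show ?thesis unfolding prime_chain_lengths_def by blast
qed

text \<open>
  A chain that ends in \<open>(x\<^sub>v : v \<in> C)\<close> can be prolonged by adding the other variables one after the
  other. The length of the longer chain is at most \<open>card V\<close>.
\<close>

lemma prime_chain_var_ideal_le: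
  assumes V: "finite V" and C: "C \<subseteq> V"
    and n: "n \<in> prime_chain_lengths (poly_ring V) (var_ideal V C :: ('v, 'k::field) mpoly set)"
  shows "n \<le> card C"
proof -
  obtain Q :: "nat \<Rightarrow> ('v, 'k) mpoly set" where Q: "\<And>i. i \<le> n \<Longrightarrow> primeideal (Q i) (poly_ring V)"
    "\<And>i. i < n \<Longrightarrow> Q i \<subset> Q (Suc i)" "Q n = var_ideal V C"
    using n unfolding prime_chain_lengths_def by blast
  have "finite (V - C)" using V by blast
  then obtain ds where ds: "set ds = V - C" "distinct ds" using finite_distinct_list by blast
  have len: "length ds = card (V - C)" using ds distinct_card by metis
  define Q' where "Q' i = (if i \<le> n then Q i else var_ideal V (C \<union> set (take (i - n) ds)))" for i
  have sub: "C \<union> set (take i ds) \<subseteq> V" for i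
    using set_take_subset[of i ds] ds(1) C by blast
  have "n + card (V - C) \<le> card V"
  proof (rule prime_chain_length_le[OF V])
    show "primeideal (Q' i) (poly_ring V)" for i
    proof (cases "i \<le> n")
      case True
      then show ?thesis using Q(1) by (simp add: Q'_def)
    next
      case False
      then show ?thesis unfolding Q'_def by (simp only: if_False) (rule primeideal_var_ideal[OF V sub])
    qed
    show "Q' i \<subset> Q' (Suc i)" if i: "i < n + card (V - C)" for i
    proof (cases "i < n")
      case True
      then show ?thesis using Q(2) by (simp add: Q'_def)
    next
      case False
      define j where "j = i - n"
      have j: "i = n + j" "j < length ds" using False i len by (simp_all add: j_def)
      have 1: "Q' i = var_ideal V (C \<union> set (take j ds))"
        using Q(3) by (cases j) (simp_all add: Q'_def j(1))
      have 2: "Q' (Suc i) = var_ideal V (C \<union> set (take (Suc j) ds))"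
        by (simp add: Q'_def j(1) Suc_diff_le)
      have "C \<union> set (take j ds) \<subset> C \<union> set (take (Suc j) ds)"
        using set_take_strict[OF ds(2) j(2)] set_take_subset[of "Suc j" ds] ds(1) by blast
      then show ?thesis unfolding 1 2 by (rule var_ideal_strict[OF _ sub])
    qed
  qed
  moreover have "card (V - C) = card V - card C" "card C \<le> card V"
    using V C by (simp_all add: card_Diff_subset finite_subset card_mono)
  ultimately show ?thesis by simp
qed

lemma prime_contains_var:
  fixes P :: "('v, 'k::field) mpoly set"
  assumes P: "primeideal P (poly_ring V)" and A: "finite A" "A \<subseteq> V" "(\<Prod>v\<in>A. var v) \<in> P"
  shows "\<exists>v\<in>A. var v \<in> P"
  using A
proof (induction A rule: finite_induct)
  case empty
  then show ?case using P by (simp add: primeideal_iff)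
next
  case (insert v A)
  have prod: "(\<Prod>v\<in>A. var v :: ('v, 'k) mpoly) \<in> PR V"
  proof -
    have "mons (sq_mon A) \<subseteq> V" using insert by (simp add: mons_sq_mon)
    then show ?thesis unfolding prod_var_eq_single[OF insert.hyps(1)] by simp
  qed
  have "var v * (\<Prod>v\<in>A. var v) \<in> P" using insert by simp
  moreover have "var v \<in> PR V" using insert.prems by simp
  ultimately have "var v \<in> P \<or> (\<Prod>v\<in>A. var v) \<in> P"
    using P prod unfolding primeideal_iff by blast
  then show ?case using insert.IH insert.prems by blast
qed

text \<open>
  A prime ideal that contains the ideal contains a variable from each generator, hence all
  variables of some hitting set. So the ideals generated by the variables of a hitting set suffice
  to compute the height.
\<close>

theorem height_mon_ideal:
  assumes V: "finite V" and E: "E \<subseteq> Pow V" and C: "C \<in> hitting_sets V E"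
    and min: "\<And>C'. C' \<in> hitting_sets V E \<Longrightarrow> card C \<le> card C'"
  shows "height (poly_ring V :: ('v, 'k::field) mpoly ring) (mon_ideal V E) = card C"
proof -
  let ?R = "poly_ring V :: ('v, 'k) mpoly ring" and ?I = "mon_ideal V E :: ('v, 'k) mpoly set"
  let ?\<P> = "{P. primeideal P ?R \<and> ?I \<subseteq> P}"
  have height: "height ?R ?I = (INF P\<in>?\<P>. Sup (prime_chain_lengths ?R P))"
    unfolding height_def prime_chain_lengths_def ..
  have CV: "C \<subseteq> V" using C by (simp add: hitting_sets_def)
  have bdd: "bdd_above (prime_chain_lengths ?R P)" for P
    using prime_chain_length_le[OF V] unfolding prime_chain_lengths_def
    by (intro bdd_aboveI[of _ "card V"]) blast
  have lower: "card C \<le> Sup (prime_chain_lengths ?R P)" if P: "P \<in> ?\<P>" for P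
  proof -
    define D where "D = {v \<in> V. var v \<in> P}"
    have pr: "primeideal P ?R" and IP: "?I \<subseteq> P" using P by auto
    have "D \<inter> e \<noteq> {}" if e: "e \<in> E" for e
    proof -
      have eV: "e \<subseteq> V" "finite e" using e E V finite_subset by blast+
      have "(\<Prod>v\<in>e. var v :: ('v, 'k) mpoly) \<in> ?I"
        using e eV unfolding prod_var_eq_single[OF eV(2)] mon_ideal_def
        by (simp add: mons_sq_mon) blast
      then have "\<exists>v\<in>e. var v \<in> P" using prime_contains_var[OF pr eV(2,1)] IP by blast
      then show ?thesis using eV(1) unfolding D_def by blast
    qed
    then have "D \<in> hitting_sets V E" by (auto simp: hitting_sets_def D_def)
    then have "card C \<le> card D" by (rule min)
    also have "var_ideal V D \<subseteq> P"
    proof -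
      interpret cring ?R by (rule poly_ring_cring)
      have "ideal P ?R" using pr by (simp add: primeideal_iff)
      then have "Idl\<^bsub>?R\<^esub> (var ` D) \<subseteq> P" by (rule genideal_minimal) (auto simp: D_def)
      then show ?thesis using Idl_vars[OF V, of D, where ?'k = 'k] unfolding var_ideal_def D_def by auto
    qed
    then have "card D \<in> prime_chain_lengths ?R P"
      using prime_chain_below[OF V pr, of D] by (simp add: D_def)
    then have "card D \<le> Sup (prime_chain_lengths ?R P)" using bdd by (rule cSup_upper)
    finally show ?thesis .
  qed
  have PC: "var_ideal V C \<in> ?\<P>"
  proof -
    have "?I \<subseteq> var_ideal V C"
    proof
      fix p assume p: "p \<in> ?I"
      have "mons m \<inter> C \<noteq> {}" if m: "m \<in> mons p" for m
      proof -
        obtain e where "e \<in> E" "e \<subseteq> mons m" using p m unfolding mon_ideal_def by blast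
        then show ?thesis using C unfolding hitting_sets_def by blast
      qed
      then show "p \<in> var_ideal V C" using p by (simp add: var_ideal_iff mon_ideal_def)
    qed
    then show ?thesis using primeideal_var_ideal[OF V CV] by blast
  qed
  have upper: "Sup (prime_chain_lengths ?R (var_ideal V C)) \<le> card C"
  proof (rule cSup_least)
    show "prime_chain_lengths ?R (var_ideal V C) \<noteq> {}"
      using prime_chain_below[OF V primeideal_var_ideal[OF V CV] CV order_refl] by blast
  qed (rule prime_chain_var_ideal_le[OF V CV])
  show ?thesis
    unfolding height
  proof (rule antisym)
    show "(INF P\<in>?\<P>. Sup (prime_chain_lengths ?R P)) \<le> card C"
    proof -
      have "(INF P\<in>?\<P>. Sup (prime_chain_lengths ?R P)) \<le> Sup (prime_chain_lengths ?R (var_ideal V C))"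
        by (rule cINF_lower[OF _ PC, where f = "\<lambda>P. Sup (prime_chain_lengths ?R P)"]) simp
      then show ?thesis using upper by (rule order_trans)
    qed
    show "card C \<le> (INF P\<in>?\<P>. Sup (prime_chain_lengths ?R P))"
      using PC lower by (intro cINF_greatest) auto
  qed
qed

section \<open>Resolutions of squarefree ideals by splitting\<close>

lemma mon_idealD: "p \<in> mon_ideal V F \<Longrightarrow> m \<in> mons p \<Longrightarrow> \<exists>A\<in>F. A \<subseteq> mons m"
  by (simp add: mon_ideal_def)

lemma mon_idealI:
  "p \<in> PR V \<Longrightarrow> (\<And>m. m \<in> mons p \<Longrightarrow> \<exists>A\<in>F. A \<subseteq> mons m) \<Longrightarrow> p \<in> mon_ideal V F"
  by (simp add: mon_ideal_def)

lemma mon_ideal_empty: "mon_ideal V {} = {0}"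
  by (auto simp: mon_ideal_def)

lemma mon_ideal_unit: "{} \<in> F \<Longrightarrow> mon_ideal V F = PR V"
  by (auto simp: mon_ideal_def)

text \<open>
  Collect the generators that avoid \<open>x\<close> and those that are divisible by \<open>x\<close>. The second ideal may
  be taken with all generators, \<open>x\<close> removed where it occurs, so that it contains the first one.
\<close>

lemma mon_ideal_splitting:
  assumes x: "x \<in> V"
  shows "(mon_ideal V F :: ('v, 'k::field) mpoly set) =
    {a + var x * b | a b. a \<in> mon_ideal V {A \<in> F. x \<notin> A} \<and> b \<in> mon_ideal V ((\<lambda>A. A - {x}) ` F)}"
    (is "_ = ?R")
proof (intro equalityI subsetI)
  fix p :: "('v, 'k) mpoly" assume p: "p \<in> mon_ideal V F"
  let ?Q = "\<lambda>m::'v \<Rightarrow>\<^sub>0 nat. \<exists>A\<in>F. x \<notin> A \<and> A \<subseteq> mons m"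
  define a where "a = mon_part ?Q p"
  define c where "c = mon_part (\<lambda>m. \<not> ?Q m) p"
  have pR: "p \<in> PR V" using p by (rule mon_ideal_PR)
  have hasF: "\<exists>A\<in>F. A \<subseteq> mons m" if "m \<in> mons p" for m
    using mon_idealD[OF p that] .
  have a: "a \<in> mon_ideal V {A \<in> F. x \<notin> A}"
  proof -
    have "\<exists>A\<in>{A \<in> F. x \<notin> A}. A \<subseteq> mons m" if "m \<in> mons a" for m
      using that unfolding a_def mons_mon_part by blast
    then show ?thesis using pR by (simp add: mon_ideal_def a_def)
  qed
  have "\<exists>r\<in>PR V. c = var x * r"
  proof (rule divide_var)
    show "c \<in> PR V" using pR by (simp add: c_def)
    show "x \<in> mons m" if "m \<in> mons c" for m
      using that hasF[of m] unfolding c_def mons_mon_part by blast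
  qed
  then obtain r where r: "r \<in> PR V" "c = var x * r" by blast
  have "\<exists>A\<in>(\<lambda>A. A - {x}) ` F. A \<subseteq> mons m" if m: "m \<in> mons r" for m
  proof -
    have "Poly_Mapping.single x 1 + m \<in> mons c"
      unfolding r(2) mons_var_mult using m by (rule imageI)
    then have "Poly_Mapping.single x 1 + m \<in> mons p" unfolding c_def mons_mon_part by blast
    then obtain A where A: "A \<in> F" "A \<subseteq> mons (Poly_Mapping.single x (1::nat) + m)" using hasF by blast
    have "A - {x} \<subseteq> mons m" using A(2) unfolding keys_add_nat mons_single_one by blast
    then show ?thesis using A(1) by blast
  qed
  then have "r \<in> mon_ideal V ((\<lambda>A. A - {x}) ` F)" using r(1) by (simp add: mon_ideal_def)
  moreover have "p = a + var x * r"
    unfolding r(2)[symmetric] a_def c_def by (rule mon_part_split)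
  ultimately show "p \<in> ?R" using a by blast
next
  fix p :: "('v, 'k) mpoly" assume "p \<in> ?R"
  then obtain a b where ab: "a \<in> mon_ideal V {A \<in> F. x \<notin> A}" "b \<in> mon_ideal V ((\<lambda>A. A - {x}) ` F)"
    "p = a + var x * b" by blast
  have "a \<in> mon_ideal V F"
    using mon_idealD[OF ab(1)] by (intro mon_idealI mon_ideal_PR[OF ab(1)]) blast
  moreover have "var x * b \<in> mon_ideal V F"
  proof -
    have "\<exists>A\<in>F. A \<subseteq> mons m" if "m \<in> mons (var x * b)" for m
    proof -
      obtain m' where m': "m' \<in> mons b" "m = Poly_Mapping.single x 1 + m'"
        using \<open>m \<in> mons (var x * b)\<close> unfolding mons_var_mult by blast
      then obtain A where "A \<in> F" "A - {x} \<subseteq> mons m'" using mon_idealD[OF ab(2) m'(1)] by blast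
      then have "A \<subseteq> mons m" unfolding m'(2) keys_add_nat mons_single_one by blast
      then show ?thesis using \<open>A \<in> F\<close> by blast
    qed
    moreover have "var x * b \<in> PR V" using x mon_ideal_PR[OF ab(2)] by simp
    ultimately show ?thesis by (simp add: mon_ideal_def)
  qed
  ultimately show "p \<in> mon_ideal V F" unfolding ab(3) by (rule mon_ideal_add)
qed

text \<open>
  With \<open>K\<close> and \<open>L\<close> the two ideals of \<open>mon_ideal_splitting\<close>, the three closure conditions on
  \<open>T\<close> belong to the three summands of the mapping cone.
\<close>

lemma resolved_within_splitting:
  assumes x: "x \<in> V"
    and K: "resolved_within V (mon_ideal V {A \<in> F. x \<notin> A} :: ('v, 'k::field) mpoly set) T1"
    and L: "resolved_within V (mon_ideal V ((\<lambda>A. A - {x}) ` F) :: ('v, 'k) mpoly set) T2"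
    and T: "T1 \<subseteq> T" "\<And>i j. (i, j) \<in> T1 \<Longrightarrow> (Suc i, Suc j) \<in> T" "\<And>i j. (i, j) \<in> T2 \<Longrightarrow> (i, Suc j) \<in> T"
  shows "resolved_within V (mon_ideal V F :: ('v, 'k) mpoly set) T"
proof -
  let ?K = "mon_ideal V {A \<in> F. x \<notin> A} :: ('v, 'k) mpoly set"
  let ?L = "mon_ideal V ((\<lambda>A. A - {x}) ` F) :: ('v, 'k) mpoly set"
  obtain B :: "nat \<Rightarrow> nat set" and d \<Delta> N where P: "graded_resolution V ?K 0 B d \<Delta>"
    "\<forall>i\<ge>N. B i = {}" "\<forall>i. \<forall>b\<in>B (Suc i). (i, d (Suc i) b) \<in> T1"
    using resolved_withinD[OF K] by (elim exE conjE)
  obtain B' :: "nat \<Rightarrow> nat set" and d' \<Delta>' N' where Q: "graded_resolution V ?L 0 B' d' \<Delta>'"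
    "\<forall>i\<ge>N'. B' i = {}" "\<forall>i. \<forall>b\<in>B' (Suc i). (i, d' (Suc i) b) \<in> T2"
    using resolved_withinD[OF L] by (elim exE conjE)
  have KL: "?K \<subseteq> ?L"
  proof
    fix p assume p: "p \<in> ?K"
    have "\<exists>A\<in>(\<lambda>A. A - {x}) ` F. A \<subseteq> mons m" if m: "m \<in> mons p" for m
    proof -
      obtain A where "A \<in> F" "A \<subseteq> mons m" using mon_idealD[OF p m] by blast
      then have "A - {x} \<in> (\<lambda>A. A - {x}) ` F" "A - {x} \<subseteq> mons m" by blast+
      then show ?thesis by blast
    qed
    then show "p \<in> ?L" by (rule mon_idealI[OF mon_ideal_PR[OF p]])
  qed
  obtain \<phi> where \<phi>: "chain_map V B d \<Delta> B' d' \<Delta>' \<phi>" "\<phi> 0 (unitv 0) = unitv 0"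
    using chain_map_lifting[OF P(1) Q(1) KL] by (elim exE conjE)
  have cancel: "p \<in> ?K" if p: "p \<in> PR V" "var x * p \<in> ?K" for p
  proof -
    have "\<exists>A\<in>{A \<in> F. x \<notin> A}. A \<subseteq> mons m" if m: "m \<in> mons p" for m
    proof -
      have "Poly_Mapping.single x 1 + m \<in> mons (var x * p)" unfolding mons_var_mult using m by (rule imageI)
      then obtain A where A: "A \<in> F" "x \<notin> A" "A \<subseteq> mons (Poly_Mapping.single x (1::nat) + m)"
        using mon_idealD[OF p(2)] by blast
      have "A \<subseteq> mons m" using A(2,3) unfolding keys_add_nat mons_single_one by blast
      then show ?thesis using A(1,2) by blast
    qed
    then show ?thesis by (rule mon_idealI[OF p(1)])
  qed
  interpret S: splitting_cone V ?K ?L 0 0 B d \<Delta> B' d' \<Delta>' x \<phi>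
    using P(1) Q(1) x cancel \<phi> by (intro splitting_cone.intro splitting_cone_axioms.intro)
  show ?thesis
    unfolding mon_ideal_splitting[OF x, of F]
  proof (rule bounded_resolution_resolved_within[OF S.cone_resolution])
    show "S.cone_basis i = {}" if "i \<ge> Suc (N + N')" for i
      using that P(2)[rule_format, of i] Q(2)[rule_format, of i] P(2)[rule_format, of "i - 1"] by (simp add: S.cone_basis_def)
    fix i b assume b: "b \<in> S.cone_basis (Suc i)"
    then have "b \<in> B (Suc i) <+> (B' (Suc i) <+> (if i = 0 then {} else B i))"
      by (cases i) (simp_all add: S.cone_basis_def)
    then consider b' where "b = Inl b'" "b' \<in> B (Suc i)" | c where "b = Inr (Inl c)" "c \<in> B' (Suc i)"
      | b' where "b = Inr (Inr b')" "b' \<in> B i" "i \<noteq> 0"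
      by (cases "i = 0") (auto simp: Plus_def)
    then show "(i, S.cone_deg (Suc i) b) \<in> T"
    proof cases
      case 1
      have "(i, d (Suc i) b') \<in> T" using P(3)[rule_format, OF 1(2)] T(1) by (rule rev_subsetD)
      then show ?thesis using 1 by (simp add: S.cone_deg_def)
    next
      case 2
      then show ?thesis using T(3)[OF Q(3)[rule_format, OF 2(2)]] by (simp add: S.cone_deg_def)
    next
      case 3
      then obtain j where j: "i = Suc j" by (cases i) auto
      have "(Suc j, Suc (d (Suc j) b')) \<in> T" using T(2)[OF P(3)[rule_format, OF 3(2)[unfolded j]]] .
      then show ?thesis by (simp add: S.cone_deg_def 3(1) j)
    qed
  qed
qed

lemma resolved_within_mono: "resolved_within V I T \<Longrightarrow> T \<subseteq> T' \<Longrightarrow> resolved_within V I T'"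
  unfolding resolved_within_def by blast

lemma resolved_within_zero: "resolved_within V ({0} :: ('v, 'k::field) mpoly set) T"
proof -
  have "graded_resolution V ({0} :: ('v, 'k) mpoly set) () (\<lambda>i. if i = 0 then {()} else {}) (\<lambda>_ _. 0) (\<lambda>_ _. 0)"
    by unfold_locales
       (auto simp: gmap_def rlinear_const_zero fmod_empty split: if_splits)
  then show ?thesis
    by (rule bounded_resolution_resolved_within[where N = 1]) (auto split: if_splits)
qed

text \<open>
  The resolution is \<open>0 \<rightarrow> R \<rightarrow> R\<close> with the identity as augmentation.
\<close>

lemma resolved_within_unit: "resolved_within V (PR V :: ('v, 'k::field) mpoly set) {(0, 0)}"
proof -
  let ?\<Delta> = "\<lambda>i u. if i = 0 then u else (0 :: unit \<Rightarrow> ('v, 'k) mpoly)"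
  let ?B = "\<lambda>i::nat. if i \<le> 1 then {()} else {}"
  have "graded_resolution V (PR V :: ('v, 'k) mpoly set) () ?B (\<lambda>_ _. 0) ?\<Delta>"
  proof
    show "gmap V (?B (Suc i)) (\<lambda>_. 0) (?B i) (\<lambda>_. 0) (?\<Delta> i)" for i
    proof (cases "i = 0")
      case True
      then show ?thesis
        using homog_unitv[of "\<lambda>_. 0" "()"] by (simp add: gmap_def rlinear_id)
    next
      case False
      then show ?thesis by (simp add: gmap_def rlinear_const_zero)
    qed
    show "(\<lambda>u. ?\<Delta> 0 u ()) ` fmod V (?B (Suc 0)) = (PR V :: ('v, 'k) mpoly set)"
    proof (intro equalityI subsetI)
      fix p :: "('v, 'k) mpoly" assume "p \<in> PR V"
      then have "(\<lambda>_. p) \<in> fmod V {()}" by (simp add: fmod_def)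
      then show "p \<in> (\<lambda>u. ?\<Delta> 0 u ()) ` fmod V (?B (Suc 0))"
        by (intro image_eqI[of _ _ "\<lambda>_. p"]) simp_all
    qed (auto simp: fmod_def)
    fix u :: "unit \<Rightarrow> ('v, 'k) mpoly" and i assume u: "u \<in> fmod V (?B (Suc i))"
    show "?\<Delta> i u = 0 \<longleftrightarrow> (\<exists>w\<in>fmod V (?B (Suc (Suc i))). u = ?\<Delta> (Suc i) w)"
      using u fmod_zero by (cases "i = 0") (auto simp: fmod_empty)
  qed auto
  then show ?thesis
    by (rule bounded_resolution_resolved_within[where N = 2]) (auto split: if_splits)
qed

text \<open>
  For edges and a vertex cover \<open>C\<close> this is \<open>reg I \<le> card C + 1\<close>. In this generality the hypothesis passes
  to both ideals of the splitting at some \<open>x \<in> C\<close>, with \<open>C\<close> replaced by the rest of \<open>C\<close>, and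
  \<open>reg I \<le> max (reg K) (reg L + 1)\<close> gives the induction step. If \<open>C\<close> is empty, all generators are
  variables or 1; splitting at a generator \<open>x\<close> makes \<open>L\<close> the unit ideal.
\<close>

theorem regularity_bound_resolution:
  assumes V: "finite V" and F: "F \<subseteq> Pow V" and C: "finite C" "C \<subseteq> V"
    and le: "\<And>A. A \<in> F \<Longrightarrow> card (A - C) \<le> 1"
  shows "resolved_within V (mon_ideal V F :: ('v, 'k::field) mpoly set) {(i, j). j \<le> i + card C + 1}"
  using C(1) F C(2) le
proof (induction C arbitrary: F rule: finite_induct)
  case empty
  have "finite F" using empty.prems(1) V by (meson finite_Pow_iff finite_subset)
  then show ?case
    using empty.prems
  proof (induction "card F" arbitrary: F rule: less_induct)
    case less
    consider "F = {}" | "{} \<in> F" | "F \<noteq> {}" "{} \<notin> F" by blast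
    then show ?case
    proof cases
      case 1
      show ?thesis unfolding 1 mon_ideal_empty by (rule resolved_within_zero)
    next
      case 2
      show ?thesis unfolding mon_ideal_unit[OF 2] by (rule resolved_within_mono[OF resolved_within_unit]) auto
    next
      case 3
      then obtain A where A: "A \<in> F" "A \<noteq> {}" by blast
      have "finite A" using A(1) less.prems(2) V finite_subset by blast
      then have "card A = 1" using less.prems(4)[OF A(1)] A(2) by (simp add: le_Suc_eq)
      then obtain x where x: "A = {x}" by (rule card_1_singletonE)
      have xV: "x \<in> V" using A(1) x less.prems(2) by blast
      have unit: "{} \<in> (\<lambda>A. A - {x}) ` F" using A(1) x by blast
      have "card {A \<in> F. x \<notin> A} < card F"
        using less.prems(1) A(1) x by (intro psubset_card_mono) blast+
      then have K: "resolved_within V (mon_ideal V {A \<in> F. x \<notin> A} :: ('v, 'k) mpoly set)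
          {(i, j). j \<le> i + card ({} :: 'v set) + 1}"
        using less.prems by (intro less.hyps) auto
      have L: "resolved_within V (mon_ideal V ((\<lambda>A. A - {x}) ` F) :: ('v, 'k) mpoly set) {(0, 0)}"
        unfolding mon_ideal_unit[OF unit] by (rule resolved_within_unit)
      show ?thesis by (rule resolved_within_splitting[OF xV K L]) auto
    qed
  qed
next
  case (insert x C)
  have xV: "x \<in> V" using insert.prems(2) by blast
  have K: "resolved_within V (mon_ideal V {A \<in> F. x \<notin> A} :: ('v, 'k) mpoly set) {(i, j). j \<le> i + card C + 1}"
  proof (rule insert.IH)
    show "card (A - C) \<le> 1" if "A \<in> {A \<in> F. x \<notin> A}" for A
    proof -
      have eq: "A - insert x C = A - C" using that by auto
      have "card (A - insert x C) \<le> 1" using insert.prems(3)[of A] that by blast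
      then show ?thesis unfolding eq .
    qed
  qed (use insert.prems in auto)
  have L: "resolved_within V (mon_ideal V ((\<lambda>A. A - {x}) ` F) :: ('v, 'k) mpoly set) {(i, j). j \<le> i + card C + 1}"
  proof (rule insert.IH)
    show "card (A' - C) \<le> 1" if A': "A' \<in> (\<lambda>A. A - {x}) ` F" for A'
    proof -
      obtain A where A: "A \<in> F" "A' = A - {x}" using A' by blast
      show ?thesis
        using insert.prems(3)[OF A(1)] unfolding A(2) Diff_insert2[of _ x C] .
    qed
  qed (use insert.prems in auto)
  show ?case by (rule resolved_within_splitting[OF xV K L]) (use insert.hyps in auto)
qed

text \<open>
  A set that avoids \<open>x\<close> meets \<open>e\<close> if and only if it meets \<open>e - {x}\<close>, and a set that meets \<open>e - {x}\<close>
  still does so after the removal of \<open>x\<close>. Together with \<open>hitting_sets_link\<close> this keeps the splitting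
  within the ideals generated by hitting sets.
\<close>

lemma hitting_sets_deletion:
  "mon_ideal V {A \<in> hitting_sets V E. x \<notin> A} = mon_ideal V (hitting_sets V ((\<lambda>e. e - {x}) ` E))"
proof -
  have iff: "A \<in> hitting_sets V ((\<lambda>e. e - {x}) ` E) \<longleftrightarrow> A \<in> hitting_sets V E" if "x \<notin> A" for A
  proof -
    have "A \<inter> (e - {x}) = A \<inter> e" for e using that by blast
    then show ?thesis by (simp add: hitting_sets_def)
  qed
  show ?thesis
  proof (rule mon_ideal_cong)
    fix A assume "A \<in> hitting_sets V ((\<lambda>e. e - {x}) ` E)"
    moreover have "(A - {x}) \<inter> (e - {x}) = A \<inter> (e - {x})" for e by blast
    ultimately have "A - {x} \<in> hitting_sets V ((\<lambda>e. e - {x}) ` E)"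
      by (auto simp: hitting_sets_def)
    then have "A - {x} \<in> hitting_sets V E" using iff[of "A - {x}"] by simp
    then have "A - {x} \<in> {A \<in> hitting_sets V E. x \<notin> A}" by simp
    then show "\<exists>A'\<in>{A \<in> hitting_sets V E. x \<notin> A}. A' \<subseteq> A" by blast
  next
    fix A assume "A \<in> {A \<in> hitting_sets V E. x \<notin> A}"
    then show "\<exists>A'\<in>hitting_sets V ((\<lambda>e. e - {x}) ` E). A' \<subseteq> A" using iff by blast
  qed
qed

lemma hitting_sets_link:
  assumes "x \<in> V"
  shows "mon_ideal V ((\<lambda>A. A - {x}) ` hitting_sets V E) = mon_ideal V (hitting_sets V {e \<in> E. x \<notin> e})"
proof (rule mon_ideal_cong)
  fix A assume "A \<in> (\<lambda>A. A - {x}) ` hitting_sets V E"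
  then obtain A0 where A0: "A0 \<in> hitting_sets V E" "A = A0 - {x}" by blast
  have "A \<inter> e = A0 \<inter> e" if "x \<notin> e" for e using that A0(2) by blast
  then have "A \<in> hitting_sets V {e \<in> E. x \<notin> e}"
    using A0 by (auto simp: hitting_sets_def)
  then show "\<exists>A'\<in>hitting_sets V {e \<in> E. x \<notin> e}. A' \<subseteq> A" by blast
next
  fix A assume "A \<in> hitting_sets V {e \<in> E. x \<notin> e}"
  then have A: "A \<subseteq> V" "\<And>e. e \<in> E \<Longrightarrow> x \<notin> e \<Longrightarrow> A \<inter> e \<noteq> {}" by (auto simp: hitting_sets_def)
  have "insert x A \<inter> e \<noteq> {}" if "e \<in> E" for e
    using A(2)[OF that] by (cases "x \<in> e") auto
  then have "insert x A \<in> hitting_sets V E" using assms A(1) by (simp add: hitting_sets_def)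
  then have "insert x A - {x} \<in> (\<lambda>A. A - {x}) ` hitting_sets V E" by (rule imageI)
  then show "\<exists>A'\<in>(\<lambda>A. A - {x}) ` hitting_sets V E. A' \<subseteq> A" by blast
qed

text \<open>
  The dual counterpart, again by splitting at the elements of \<open>C\<close>, now with
  \<open>pdim I \<le> max (pdim K + 1) (pdim L)\<close>. If \<open>C\<close> is empty, the members of \<open>E\<close> have at most one
  element, and the ideal is zero or principal.
\<close>

theorem proj_dim_bound_resolution:
  assumes V: "finite V" and E: "E \<subseteq> Pow V" and C: "finite C" "C \<subseteq> V"
    and le: "\<And>e. e \<in> E \<Longrightarrow> card (e - C) \<le> 1"
  shows "resolved_within V (mon_ideal V (hitting_sets V E) :: ('v, 'k::field) mpoly set) {(i, j). i \<le> card C}"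
  using C(1) E C(2) le
proof (induction C arbitrary: E rule: finite_induct)
  case empty
  have "finite E" using empty.prems(1) V by (meson finite_Pow_iff finite_subset)
  then show ?case
    using empty.prems
  proof (induction "card E" arbitrary: E rule: less_induct)
    case less
    consider "E = {}" | "{} \<in> E" | "E \<noteq> {}" "{} \<notin> E" by blast
    then show ?case
    proof cases
      case 1
      then have "{} \<in> hitting_sets V E" by (simp add: hitting_sets_def)
      show ?thesis unfolding mon_ideal_unit[OF \<open>{} \<in> hitting_sets V E\<close>]
        by (rule resolved_within_mono[OF resolved_within_unit]) auto
    next
      case 2
      then have "hitting_sets V E = {}" unfolding hitting_sets_def by blast
      then show ?thesis by (simp only: mon_ideal_empty resolved_within_zero)
    next
      case 3
      then obtain e where e: "e \<in> E" "e \<noteq> {}" by blast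
      have "finite e" using e(1) less.prems(2) V finite_subset by blast
      then have "card e = 1" using less.prems(4)[OF e(1)] e(2) by (simp add: le_Suc_eq)
      then obtain x where x: "e = {x}" by (rule card_1_singletonE)
      have xV: "x \<in> V" using e(1) x less.prems(2) by blast
      have "{A \<in> hitting_sets V E. x \<notin> A} = {}" using e(1) x unfolding hitting_sets_def by blast
      then have "(mon_ideal V {A \<in> hitting_sets V E. x \<notin> A} :: ('v, 'k) mpoly set) = {0}"
        by (simp only: mon_ideal_empty)
      then have K: "resolved_within V (mon_ideal V {A \<in> hitting_sets V E. x \<notin> A} :: ('v, 'k) mpoly set) {}"
        by (simp only: resolved_within_zero)
      have "card {e \<in> E. x \<notin> e} < card E"
        using less.prems(1) e(1) x by (intro psubset_card_mono) blast+
      then have L: "resolved_within V (mon_ideal V ((\<lambda>A. A - {x}) ` hitting_sets V E) :: ('v, 'k) mpoly set)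
          {(i, j). i \<le> card ({} :: 'v set)}"
        unfolding hitting_sets_link[OF xV] using less.prems by (intro less.hyps) auto
      show ?thesis by (rule resolved_within_splitting[OF xV K L]) auto
    qed
  qed
next
  case (insert x C)
  have xV: "x \<in> V" using insert.prems(2) by blast
  have "resolved_within V (mon_ideal V (hitting_sets V ((\<lambda>e. e - {x}) ` E)) :: ('v, 'k) mpoly set) {(i, j). i \<le> card C}"
  proof (rule insert.IH)
    show "(\<lambda>e. e - {x}) ` E \<subseteq> Pow V" using insert.prems(1) by auto
    show "C \<subseteq> V" using insert.prems(2) by simp
    fix e' assume "e' \<in> (\<lambda>e. e - {x}) ` E"
    then obtain e where e: "e' = e - {x}" "e \<in> E" by (rule imageE)
    show "card (e' - C) \<le> 1"
      using insert.prems(3)[OF e(2)] unfolding e(1) Diff_insert2[of _ x C] .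
  qed
  then have K: "resolved_within V (mon_ideal V {A \<in> hitting_sets V E. x \<notin> A} :: ('v, 'k) mpoly set) {(i, j). i \<le> card C}"
    by (simp only: hitting_sets_deletion[of V E x])
  have "resolved_within V (mon_ideal V (hitting_sets V {e \<in> E. x \<notin> e}) :: ('v, 'k) mpoly set) {(i, j). i \<le> card C}"
  proof (rule insert.IH)
    show "{e \<in> E. x \<notin> e} \<subseteq> Pow V" using insert.prems(1) by auto
    show "C \<subseteq> V" using insert.prems(2) by simp
    fix e assume e: "e \<in> {e \<in> E. x \<notin> e}"
    then have eq: "e - insert x C = e - C" by auto
    have "e \<in> E" using e by simp
    then show "card (e - C) \<le> 1"
      using insert.prems(3)[of e] unfolding eq by simp
  qed
  then have L: "resolved_within V (mon_ideal V ((\<lambda>A. A - {x}) ` hitting_sets V E) :: ('v, 'k) mpoly set) {(i, j). i \<le> card C}"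
    by (simp only: hitting_sets_link[OF xV, of E])
  show ?case by (rule resolved_within_splitting[OF xV K L]) (use insert.hyps in auto)
qed

section \<open>Edge ideals and their Alexander duals\<close>

lemma proj_dim_eq_Max:
  assumes "I \<noteq> {0}"
  shows "proj_dim V I = Max ((\<lambda>(i, j). int i) ` {(i, j). betti V I i j \<noteq> 0})"
proof -
  have "{int i | i. \<exists>j. betti V I i j \<noteq> 0} = (\<lambda>(i, j). int i) ` {(i, j). betti V I i j \<noteq> 0}"
    by (auto simp: image_iff)
  then show ?thesis using assms by (simp add: proj_dim_def)
qed

lemma regularity_eq_Max:
  assumes "I \<noteq> {0}"
  shows "regularity V I = Max ((\<lambda>(i, j). int j - int i) ` {(i, j). betti V I i j \<noteq> 0})"
proof -
  have "{int j - int i | i j. betti V I i j \<noteq> 0} = (\<lambda>(i, j). int j - int i) ` {(i, j). betti V I i j \<noteq> 0}"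
    by (auto simp: image_iff)
  then show ?thesis using assms by (simp add: regularity_def)
qed

context
  fixes V :: "'v set" and I :: "('v, 'k::field) mpoly set" and i j :: nat
  assumes ne: "I \<noteq> {0}" and fin: "finite {(i, j). betti V I i j \<noteq> 0}" and betti: "betti V I i j \<noteq> 0"
begin

lemma proj_dim_ge: "int i \<le> proj_dim V I"
  unfolding proj_dim_eq_Max[OF ne] using betti
  by (intro Max_ge finite_imageI fin) (auto simp: image_iff)

lemma regularity_ge: "int j - int i \<le> regularity V I"
  unfolding regularity_eq_Max[OF ne] using betti
  by (intro Max_ge finite_imageI fin) (auto simp: image_iff)

lemma proj_dim_le: "(\<And>i j. betti V I i j \<noteq> 0 \<Longrightarrow> int i \<le> c) \<Longrightarrow> proj_dim V I \<le> c"
  unfolding proj_dim_eq_Max[OF ne] using betti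
  by (intro Max.boundedI finite_imageI fin) (auto simp: image_iff)

lemma regularity_le: "(\<And>i j. betti V I i j \<noteq> 0 \<Longrightarrow> int j - int i \<le> c) \<Longrightarrow> regularity V I \<le> c"
  unfolding regularity_eq_Max[OF ne] using betti
  by (intro Max.boundedI finite_imageI fin) (auto simp: image_iff)

end

lemma minimal_vertex_cover_iff:
  "minimal_vertex_cover V E C \<longleftrightarrow>
     C \<in> hitting_sets V E \<and> (\<forall>C'\<in>hitting_sets V E. C' \<subseteq> C \<longrightarrow> C' = C)"
proof -
  have "vertex_cover V E C \<longleftrightarrow> C \<in> hitting_sets V E" for C
    by (simp add: vertex_cover_def hitting_sets_def)
  then show ?thesis unfolding minimal_vertex_cover_def by blast
qed

lemma minimal_cover_private_edge:
  assumes C: "minimal_vertex_cover V E C" and v: "v \<in> C"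
  shows "\<exists>e\<in>E. e \<inter> C = {v}"
proof -
  have "C - {v} \<notin> hitting_sets V E" "C \<in> hitting_sets V E"
    using C v unfolding minimal_vertex_cover_iff by blast+
  then obtain e where "e \<in> E" "(C - {v}) \<inter> e = {}" "C \<inter> e \<noteq> {}"
    unfolding hitting_sets_def by blast
  then show ?thesis using v by blast
qed

lemma nonzero_squarefree:
  assumes "A \<in> F" "finite A" "A \<subseteq> V"
  shows "(mon_ideal V F :: ('v, 'k::field) mpoly set) \<noteq> {0}"
proof
  assume e: "(mon_ideal V F :: ('v, 'k) mpoly set) = {0}"
  have "(Poly_Mapping.single (sq_mon A) 1 :: ('v, 'k) mpoly) \<in> mon_ideal V F"
    using assms by (auto simp: mon_ideal_def mons_sq_mon)
  then have "(Poly_Mapping.single (sq_mon A) 1 :: ('v, 'k) mpoly) = 0" unfolding e by simp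
  then have "mons (Poly_Mapping.single (sq_mon A) 1 :: ('v, 'k) mpoly) = {}" by simp
  then show False by simp
qed

text \<open>
  The product \<open>y\<close> of the variables outside \<open>C\<close> is not in the ideal, since every edge meets
  \<open>C\<close>. Each \<open>v \<in> C\<close> lies on an edge without any other vertex in \<open>C\<close>, so \<open>x\<^sub>v y\<close> is in the
  ideal. Hence the annihilator of \<open>y\<close> modulo the ideal contains \<open>card C\<close> variables.
\<close>

lemma (in graded_resolution) length_ge_minimal_cover:
  assumes I: "I = mon_ideal V E" and V: "finite V" and E: "E \<subseteq> Pow V" and C: "minimal_vertex_cover V E C"
  shows "B (card C) \<noteq> {}"
proof -
  have CV: "C \<subseteq> V" and hit: "\<And>e. e \<in> E \<Longrightarrow> C \<inter> e \<noteq> {}"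
    using C unfolding minimal_vertex_cover_iff hitting_sets_def by blast+
  let ?y = "Poly_Mapping.single (sq_mon (V - C)) 1 :: ('v, 'k) mpoly"
  have my: "mons (sq_mon (V - C)) = V - C" using V by (simp add: mons_sq_mon)
  show ?thesis
  proof (rule length_ge_card_annihilator[of ?y])
    show "?y \<in> PR V" by (rule PR_single) (simp add: my)
    show "?y \<notin> I"
    proof
      assume "?y \<in> I"
      then obtain e where "e \<in> E" "e \<subseteq> V - C" unfolding I mon_ideal_def by (auto simp: my)
      then show False using hit by blast
    qed
    show "var v * ?y \<in> I" if v: "v \<in> C" for v
    proof -
      obtain e where e: "e \<in> E" "e \<inter> C = {v}" using minimal_cover_private_edge[OF C v] by blast
      have "var v * ?y = Poly_Mapping.single (Poly_Mapping.single v 1 + sq_mon (V - C)) 1"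
        by (simp add: var_def mult_single)
      moreover have m: "mons (Poly_Mapping.single v (1::nat) + sq_mon (V - C)) = insert v (V - C)"
        unfolding keys_add_nat my mons_single_one by simp
      moreover have "e \<subseteq> insert v (V - C)" using e E by blast
      ultimately show ?thesis
        using e(1) v CV unfolding I mon_ideal_def poly_ring_carrier
        by (simp del: One_nat_def) blast
    qed
    show "finite C" using CV V finite_subset by blast
  qed (rule CV)
qed

theorem theorem1p6:
  fixes V :: "'v set" and E :: "'v set set"
    and I J :: "('v, 'k::field) mpoly set" and h :: int
  assumes graph: "simple_graph V E"
    and I: "I = edge_ideal V E"
    and J: "J = alexander_dual V I"
    and h: "h = int (height (poly_ring V :: ('v, 'k) mpoly ring) I)"
  shows
    "(unmixed V E \<longrightarrow>
        (regularity V I \<le> h + 1 \<and> h + 1 \<le> regularity V J + 1) \<and>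
        (proj_dim V J \<le> h \<and> h \<le> proj_dim V I + 1)) \<and>
     (\<not> unmixed V E \<longrightarrow>
        (regularity V I \<le> h + 1 \<and> h + 1 \<le> regularity V J) \<and>
        (proj_dim V J \<le> h \<and> h \<le> proj_dim V I))"
proof -
  have V: "finite V" and E: "E \<subseteq> Pow V" and card2: "\<And>e. e \<in> E \<Longrightarrow> card e = 2"
    using graph by (auto simp: simple_graph_def)
  have I': "I = mon_ideal V E"
    unfolding I edge_ideal_eq_sqfree_ideal[OF graph] by (rule sqfree_ideal_eq_mon_ideal[OF V E])
  have J': "J = mon_ideal V (hitting_sets V E)"
    unfolding J I edge_ideal_eq_sqfree_ideal[OF graph] alexander_dual_sqfree_ideal[OF V E]
    by (rule var_ideal_Inter_eq_mon_ideal[OF V E])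
  have fin: "finite A" if "A \<subseteq> V" for A using that V by (rule finite_subset)
  have ne_edge: "e \<noteq> {}" if "e \<in> E" for e using card2[OF that] by auto
  have Vhit: "V \<in> hitting_sets V E" using E ne_edge by (fastforce simp: hitting_sets_def)
  obtain C where C: "C \<in> hitting_sets V E" "\<And>C'. C' \<in> hitting_sets V E \<Longrightarrow> card C \<le> card C'"
    using ex_has_least_nat[of "\<lambda>C. C \<in> hitting_sets V E" V card] Vhit by blast
  have CV: "C \<subseteq> V" using C(1) by (simp add: hitting_sets_def)
  have hC: "h = int (card C)"
    unfolding h I' by (simp add: height_mon_ideal[OF V E C])
  have Cmin: "minimal_vertex_cover V E C"
    unfolding minimal_vertex_cover_iff
  proof (intro conjI C(1) ballI impI)
    fix C' assume "C' \<in> hitting_sets V E" "C' \<subseteq> C"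
    then show "C' = C" using card_subset_eq[OF fin[OF CV]] C(2) card_mono[OF fin[OF CV]] by (metis le_antisym)
  qed
  have eC: "card (e - C) \<le> 1" if e: "e \<in> E" for e
  proof -
    have "e \<inter> C \<noteq> {}" using C(1) e unfolding hitting_sets_def by blast
    moreover have fe: "finite e" using e E fin by blast
    ultimately have "card (e \<inter> C) \<ge> 1" by (simp add: Suc_le_eq card_gt_0_iff)
    moreover have "card (e - C) + card (e \<inter> C) = 2"
      using card_Diff_subset_Int[of e C] fe card2[OF e] card_mono[of e "e \<inter> C"] by simp
    ultimately show ?thesis by linarith
  qed
  have resI: "resolved_within V I {(i, j). j \<le> i + card C + 1}"
    unfolding I' by (rule regularity_bound_resolution[OF V E fin[OF CV] CV eC])
  have resJ: "resolved_within V J {(i, j). i \<le> card C}"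
    unfolding J' by (rule proj_dim_bound_resolution[OF V E fin[OF CV] CV eC])
  note resI' = betti_from_resolution[OF resI]
  obtain BI :: "nat \<Rightarrow> nat set" and dI \<Delta>I where RI: "graded_resolution V I 0 BI dI \<Delta>I"
    "\<forall>i j. betti V I i j \<noteq> 0 \<longleftrightarrow> (\<exists>b\<in>BI (Suc i). dI (Suc i) b = j)"
    using resI'(1) by (elim exE conjE)
  note resJ' = betti_from_resolution[OF resJ]
  obtain BJ :: "nat \<Rightarrow> nat set" and dJ \<Delta>J where RJ: "graded_resolution V J 0 BJ dJ \<Delta>J"
    "\<forall>i j. betti V J i j \<noteq> 0 \<longleftrightarrow> (\<exists>b\<in>BJ (Suc i). dJ (Suc i) b = j)"
    using resJ'(1) by (elim exE conjE)
  interpret RI: graded_resolution V I 0 BI dI \<Delta>I by (rule RI(1))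
  interpret RJ: graded_resolution V J 0 BJ dJ \<Delta>J by (rule RJ(1))
  have J0: "J \<noteq> {0}" unfolding J' by (rule nonzero_squarefree[OF Vhit V order_refl])
  have bJ: "betti V J 0 (card D) \<noteq> 0" if D: "minimal_vertex_cover V E D" for D
  proof -
    have D': "D \<in> hitting_sets V E" "\<And>D'. D' \<in> hitting_sets V E \<Longrightarrow> D' \<subseteq> D \<Longrightarrow> D' = D"
      using D unfolding minimal_vertex_cover_iff by blast+
    have DV: "D \<subseteq> V" using D'(1) by (simp add: hitting_sets_def)
    show ?thesis
      unfolding RJ(2)[rule_format] by (rule RJ.minimal_generator_degree[OF J' D'(1) fin[OF DV] DV D'(2)])
  qed
  have regJ: "int (card D) \<le> regularity V J" if "minimal_vertex_cover V E D" for D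
    using regularity_ge[OF J0 resJ'(3) bJ[OF that]] by simp
  have pdJ: "proj_dim V J \<le> h"
    using proj_dim_le[OF J0 resJ'(3) bJ[OF Cmin], of h] resJ'(2) hC by simp
  have regI: "regularity V I \<le> h + 1" and pdI: "\<And>D. minimal_vertex_cover V E D \<Longrightarrow> int (card D) - 1 \<le> proj_dim V I"
  proof -
    have "regularity V I \<le> h + 1 \<and> (\<forall>D. minimal_vertex_cover V E D \<longrightarrow> int (card D) - 1 \<le> proj_dim V I)"
    proof (cases "E = {}")
      case True
      have I0: "I = {0}" unfolding I' True by (rule mon_ideal_empty)
      have D0: "card D = 0" if "minimal_vertex_cover V E D" for D
        using that unfolding minimal_vertex_cover_iff True hitting_sets_def by auto
      show ?thesis
      proof (intro conjI allI impI)
        \<comment> \<open>Without edges the ideal is zero, and the conventional values 1 and -1 apply.\<close>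
        show "regularity V I \<le> h + 1" using hC by (simp add: regularity_def I0)
        show "int (card D) - 1 \<le> proj_dim V I" if "minimal_vertex_cover V E D" for D
          using D0[OF that] by (simp add: proj_dim_def I0)
      qed
    next
      case False
      then obtain e where e: "e \<in> E" by blast
      have I0: "I \<noteq> {0}" unfolding I' using e E fin by (intro nonzero_squarefree[of e]) auto
      have bD: "\<exists>i j. card D = Suc i \<and> betti V I i j \<noteq> 0" if D: "minimal_vertex_cover V E D" for D
      proof -
        have "D \<in> hitting_sets V E" using D by (simp add: minimal_vertex_cover_iff)
        then have D': "D \<subseteq> V" "D \<inter> e \<noteq> {}" using e by (simp_all add: hitting_sets_def)
        have "card D \<noteq> 0" using D' fin[OF D'(1)] by auto
        then obtain i where i: "card D = Suc i" by (cases "card D") simp_all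
        then obtain b where "b \<in> BI (Suc i)" using RI.length_ge_minimal_cover[OF I' V E D] by auto
        then show ?thesis using i unfolding RI(2)[rule_format] by blast
      qed
      obtain i j where ij: "betti V I i j \<noteq> 0" using bD[OF Cmin] by blast
      have "regularity V I \<le> h + 1"
      proof (rule regularity_le[OF I0 resI'(3) ij])
        show "int j - int i \<le> h + 1" if "betti V I i j \<noteq> 0" for i j
          using resI'(2)[OF that] hC by simp
      qed
      moreover have "int (card D) - 1 \<le> proj_dim V I" if D: "minimal_vertex_cover V E D" for D
      proof -
        obtain i j where "card D = Suc i" "betti V I i j \<noteq> 0" using bD[OF D] by blast
        then show ?thesis using proj_dim_ge[OF I0 resI'(3), of i j] by simp
      qed
      ultimately show ?thesis by blast
    qed
    then show "regularity V I \<le> h + 1" "\<And>D. minimal_vertex_cover V E D \<Longrightarrow> int (card D) - 1 \<le> proj_dim V I"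
      by blast+
  qed
  have unmixed_bounds: "h \<le> regularity V J" "h \<le> proj_dim V I + 1"
    using regJ[OF Cmin] pdI[OF Cmin] hC by simp_all
  have mixed_bounds: "h + 1 \<le> regularity V J \<and> h \<le> proj_dim V I" if mixed: "\<not> unmixed V E"
  proof -
    obtain D D' where D: "minimal_vertex_cover V E D" "minimal_vertex_cover V E D'" "card D \<noteq> card D'"
      using mixed unfolding unmixed_def by blast
    have "D \<in> hitting_sets V E" "D' \<in> hitting_sets V E"
      using D(1,2) by (simp_all add: minimal_vertex_cover_iff)
    then have "card C \<le> card D" "card C \<le> card D'" by (simp_all add: C(2))
    then have "h + 1 \<le> int (card D) \<or> h + 1 \<le> int (card D')" using D(3) hC by linarith
    then show ?thesis
      using regJ[OF D(1)] regJ[OF D(2)] pdI[OF D(1)] pdI[OF D(2)] by linarith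
  qed
  show ?thesis
    using regI pdJ unmixed_bounds mixed_bounds by (intro conjI impI) simp_all
qed

end
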